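(* Let $n\ge 2$. Suppose that, for functions $g$ on $\mathbb{S}^{n-1}$ which are constant at scale $\delta^{1/2}$, $$\big\| \widehat{g\,\mathrm{d}\sigma} \big\|_{L^{\frac{2n}{n-1}}(B(0,\delta^{-1}))} \leq C_n \Big\| \Big(\sum_\alpha \big| \widehat{g_\alpha\, \mathrm{d}\sigma} \big|^2\Big)^{1/2} \Big\|_{L^{\frac{2n}{n-1}}(B(0,\delta^{-1}))}$$ holds for all small $\delta>0$ with $C_n$ independent of $\delta$ and $g$, where $\{E_\alpha\}$ are the spherical caps of radius $\delta^{1/2}$ decomposing $\mathbb{S}^{n-1}$ and $g_\alpha=g\chi_{E_\alpha}$. Then, for all large $N$ and all $f$ on $\mathbb{R}^n$, $$\|M_N f \|_{L^n(\mathbb{S}^{n-1})} \leq C_n \left( \log N \right)^{\frac{n-1}{n}} \|f \|_{L^n(\mathbb{R}^{n})},$$ and hence also, for all large $R$ and all $g$ on $\mathbb{S}^{n-1}$ (now with no requirement that $g$ be constant at any scale), $$\big\| \widehat{g\, \mathrm{d}\sigma} \big\|_{L^{\frac{2n}{n-1}}(B(0,R))} \leq C_n \left( \log R \right)^{\frac{n-1}{2n}}\|g\|_{L^{\frac{2n}{n-1}}(\mathbb{S}^{n-1})}.$$ In each inequality $C_n$ denotes a constant, possibly different at each occurrence, which does not depend on $\delta$, $N$, $R$, $f$ or $g$.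
   Context: $\sigma$ is the Lebesgue (surface) measure on the unit sphere $\mathbb{S}^{n-1}\subset\mathbb{R}^n$, $B(0,r)$ is the ball of radius $r$ centred at the origin of $\mathbb{R}^n$, and for a function $h$ on $\mathbb{S}^{n-1}$ $$\widehat{h\,\mathrm{d}\sigma}(x)=\int_{\mathbb{S}^{n-1}} h(\xi)e^{-2\pi i x\cdot\xi}\,\mathrm{d}\sigma(\xi),\qquad x\in\mathbb{R}^n .$$ For each small $\delta>0$ the sphere is decomposed into spherical caps ("$\delta^{1/2}$-cells") $E_\alpha$ of radius $\delta^{1/2}$; one such decomposition is taken for each $\delta$. The hypothesis concerns smooth functions $g$ on $\mathbb{S}^{n-1}$ that are constant at scale $\delta^{1/2}$, that is (in the informal sense used here) constant on the cells $E_\alpha$, $g=\sum_\alpha c_\alpha\phi_\alpha$ with scalars $c_\alpha$ and $\phi_\alpha$ a smooth bump function associated to the cell $E_\alpha$. Kakeya maximal function: for a large parameter $N\gg 1$, $f$ defined on $\mathbb{R}^n$ and $\omega\in\mathbb{S}^{n-1}$, $$M_N f(\omega) = \sup_{T \parallel \omega} \frac{1}{|T|} \int_T |f|,$$ where the supremum is over all tubes $T$ of dimensions $1\times\dots\times1\times N$ whose axis is parallel to $\omega$. *)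

theory Defs
  imports "HOL-Analysis.Analysis" "HOL-Library.Disjoint_Sets"
begin

(* Real powers on the extended half-line; only used for exponents p > 0. *)
definition ennpowr :: "ennreal \<Rightarrow> real \<Rightarrow> ennreal" where
  "ennpowr x p = (if x = \<infinity> then \<infinity> else ennreal (enn2real x powr p))"

definition Lnorm :: "real \<Rightarrow> 'a measure \<Rightarrow> ('a \<Rightarrow> ennreal) \<Rightarrow> ennreal" where
  "Lnorm p M F = ennpowr (\<integral>\<^sup>+ x. ennpowr (F x) p \<partial>M) (1 / p)"

(* Polar coordinates: sigma(A) = n * |{r \<xi> | 0 < r < 1, \<xi> \<in> A}|.
   The completion makes every Lebesgue measurable function on the sphere measurable. *)
definition sphere_measure :: "'a::euclidean_space measure" where
  "sphere_measure =
     completion (scale_measure (of_nat DIM('a))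
       (distr (restrict_space lborel (ball 0 1 - {0})) (restrict_space borel (sphere 0 1))
          (\<lambda>x. x /\<^sub>R norm x)))"

definition extension :: "('a::euclidean_space \<Rightarrow> complex) \<Rightarrow> 'a \<Rightarrow> complex" where
  "extension g x =
     (\<integral>\<xi>. g \<xi> * exp (- 2 * of_real pi * \<i> * of_real (x \<bullet> \<xi>)) \<partial>sphere_measure)"

(* Length N along the axis and a transverse cross-section of diameter 1. *)
definition tube :: "real \<Rightarrow> 'a::euclidean_space \<Rightarrow> 'a \<Rightarrow> 'a set" where
  "tube N \<omega> a =
     {x. \<bar>(x - a) \<bullet> \<omega>\<bar> \<le> N / 2 \<and> norm ((x - a) - ((x - a) \<bullet> \<omega>) *\<^sub>R \<omega>) \<le> 1 / 2}"

definition kakeya_maximal ::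
    "real \<Rightarrow> ('a::euclidean_space \<Rightarrow> complex) \<Rightarrow> 'a \<Rightarrow> ennreal" where
  "kakeya_maximal N f \<omega> =
     (SUP a. (\<integral>\<^sup>+ x\<in>tube N \<omega> a. ennreal (norm (f x)) \<partial>lebesgue) / emeasure lebesgue (tube N \<omega> a))"

definition cap :: "'a::euclidean_space \<Rightarrow> real \<Rightarrow> 'a set" where
  "cap \<xi> r = sphere 0 1 \<inter> ball \<xi> r"

(* For n \<ge> 3 exact caps cannot tile the sphere. The cells of a decomposition are
   pairwise disjoint and comparable to caps of radius sqrt \<delta>, with constants a and b
   that will not depend on \<delta>. *)
definition cap_decomposition :: "real \<Rightarrow> real \<Rightarrow> real \<Rightarrow> 'a::euclidean_space set set \<Rightarrow> bool" where
  "cap_decomposition a b \<delta> \<E> \<longleftrightarrow>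
     finite \<E> \<and> partition_on (sphere 0 1) \<E> \<and> \<E> \<subseteq> sets sphere_measure \<and>
     (\<forall>A\<in>\<E>. \<exists>\<xi>\<in>sphere 0 1. cap \<xi> (a * sqrt \<delta>) \<subseteq> A \<and> A \<subseteq> cap \<xi> (b * sqrt \<delta>))"

fun iter_partial :: "'n list \<Rightarrow> (real^'n \<Rightarrow> real) \<Rightarrow> real^'n \<Rightarrow> real" where
  "iter_partial [] f = f"
| "iter_partial (i # is) f = (\<lambda>x. frechet_derivative (iter_partial is f) (at x) (axis i 1))"

definition smooth :: "(real^'n \<Rightarrow> real) \<Rightarrow> bool" where
  "smooth f \<longleftrightarrow> (\<forall>is. iter_partial is f differentiable_on UNIV)"

(* A bump on the cell A at scale sqrt \<delta>: smooth on the sphere (as the restriction of a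
   smooth function F on the whole space), vanishing off A, equal to 1 on a cap of radius
   a * sqrt \<delta>, and with derivatives of order k bounded by K k * \<delta> powr (- k / 2). *)
definition cell_bump ::
    "real \<Rightarrow> (nat \<Rightarrow> real) \<Rightarrow> real \<Rightarrow> (real^'n) set \<Rightarrow> (real^'n \<Rightarrow> real) \<Rightarrow> bool" where
  "cell_bump a K \<delta> A \<phi> \<longleftrightarrow>
     (\<exists>F. smooth F \<and> (\<forall>\<xi>\<in>sphere 0 1. F \<xi> = \<phi> \<xi>) \<and>
        (\<forall>is x. \<bar>iter_partial is F x\<bar> \<le> K (length is) * \<delta> powr (- real (length is) / 2))) \<and>
     (\<forall>\<xi>\<in>sphere 0 1. 0 \<le> \<phi> \<xi> \<and> \<phi> \<xi> \<le> 1 \<and> (\<xi> \<notin> A \<longrightarrow> \<phi> \<xi> = 0)) \<and>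
     (\<exists>\<xi>\<in>sphere 0 1. \<forall>\<eta>\<in>cap \<xi> (a * sqrt \<delta>). \<phi> \<eta> = 1)"

(* g is a combination of the bumps \<phi> A of the cells A, so that g * indicator A = c A * \<phi> A
   on the sphere: being constant at scale sqrt \<delta> is meant up to the cutoff near the
   boundary of each cell. *)
definition constant_at_scale ::
    "'a::euclidean_space set set \<Rightarrow> ('a set \<Rightarrow> 'a \<Rightarrow> real) \<Rightarrow> ('a \<Rightarrow> complex) \<Rightarrow> bool" where
  "constant_at_scale \<E> \<phi> g \<longleftrightarrow>
     (\<exists>c. \<forall>\<xi>\<in>sphere 0 1. g \<xi> = (\<Sum>A\<in>\<E>. c A * of_real (\<phi> A \<xi>)))"

definition square_function ::
    "'a::euclidean_space set set \<Rightarrow> ('a \<Rightarrow> complex) \<Rightarrow> 'a \<Rightarrow> real" where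
  "square_function \<E> g x =
     sqrt (\<Sum>A\<in>\<E>. (norm (extension (\<lambda>\<xi>. g \<xi> * indicator A \<xi>) x))\<^sup>2)"

end

theory Submission
  imports Defs
begin

text \<open>
  The Kakeya inequality is elementary, because tubes have volume bounded below. For the restriction
  inequality, integration by parts along rotations of the sphere shows that on \<open>B(0, 1/\<delta>)\<close> the
  extension of the bump of a cell with centre \<open>\<theta>\<close> is at most
  \<open>C \<delta> powr ((n-1)/2) (1 + \<surd>\<delta> |x'|) powr (-n)\<close>, where \<open>x'\<close> is the component of \<open>x\<close> orthogonal to
  \<open>\<theta>\<close>: it lives on a tube through the origin. About \<open>(\<delta> |x|) powr (-(n-1))\<close> of these tubes meet at \<open>x\<close>,
  and Jensen's inequality together with a sum over the dyadic shells \<open>|x| \<sim> 2^k / \<surd>\<delta>\<close> bounds the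
  square function with a loss of one logarithm. The hypothesis turns this into a restriction bound for
  sums of bumps.

  For general \<open>g\<close> take \<open>\<surd>\<delta> = \<tau> / R\<close> with a small constant \<open>\<tau>\<close>, and compare \<open>g\<close> with the sum of bumps
  that has the same mean on every cell. A Taylor expansion on each cell writes the extension
  of the difference on \<open>B(0, R)\<close> as a series of monomials in \<open>x\<close> times extensions of functions
  that are small in \<open>L\<^sup>q\<close>. So if \<open>B\<close> is admissible in the restriction bound at scale \<open>R\<close>, then so is
  \<open>S + B / 2\<close> with \<open>S\<close> of size \<open>log R\<close>, and iteration removes \<open>B\<close>.
\<close>

text \<open>The exponents \<open>p = n / (n - 1)\<close> and \<open>q = 2 * p\<close> are those for
  which all shells weigh the same: Jensen's inequality raises the overlap
  \<open>(D / 2 ^ k) ^ (n - 1)\<close> to the power \<open>p - 1 = 1 / (n - 1)\<close>, and the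
  length \<open>2 ^ k * D\<close> of the tubes cancels the \<open>2 ^ k\<close> that is left. The
  logarithm counts shells.

  The hypothesis says nothing about the error of the approximation by bumps. To control it,
  \<open>character x \<xi>\<close> is factored as
  \<open>character x \<eta> * character x (\<xi> - \<eta>)\<close>, and \<open>\<eta>\<close> is
  averaged over the cell against the normalised bump. Each Taylor monomial in
  \<open>\<xi> - \<eta>\<close> then yields the extension of a new function of
  \<open>\<eta>\<close>, to which the unknown bound for arbitrary functions applies; degree k comes
  with a factor \<open>\<Lambda> ^ k\<close>, where \<open>\<Lambda>\<close> is proportional to
  \<open>R * d\<close> and \<open>d\<close> is the cell diameter. This is why the cells have
  diameter of order \<open>1 / R\<close> and not \<open>1 / sqrt R\<close>: the hypothesis is then
  used on the ball of radius \<open>1 / \<delta> = (R / \<tau>)\<^sup>2\<close>, which changes a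
  logarithm only by a constant factor.\<close>

section \<open>Powers and norms with values in the extended half-line\<close>

lemma ennpowr_ennreal: "0 \<le> x \<Longrightarrow> ennpowr (ennreal x) p = ennreal (x powr p)"
  by (simp add: ennpowr_def)

lemma ennpowr_mono: "x \<le> y \<Longrightarrow> 0 \<le> p \<Longrightarrow> ennpowr x p \<le> ennpowr y p"
  by (cases x; cases y) (auto simp: ennpowr_def top_unique intro!: ennreal_leI powr_mono2)

lemma ennpowr_ennpowr: "ennpowr (ennpowr x p) r = ennpowr x (p * r)"
  by (cases x) (auto simp: ennpowr_def powr_powr)

lemma ennpowr_one: "ennpowr x 1 = x"
  by (cases x) (auto simp: ennpowr_def)

lemma ennpowr_mult_ennreal:
  assumes "0 < c"
  shows "ennpowr (ennreal c * x) p = ennreal (c powr p) * ennpowr x p"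
proof (cases x)
  case (real r)
  then show ?thesis using assms
    by (simp add: ennpowr_ennreal powr_mult flip: ennreal_mult)
next
  case top
  then show ?thesis using assms by (simp add: ennpowr_def ennreal_mult_top)
qed

lemma ennpowr_Lnorm: "0 < p \<Longrightarrow> ennpowr (Lnorm p M F) p = (\<integral>\<^sup>+ x. ennpowr (F x) p \<partial>M)"
  by (simp add: Lnorm_def ennpowr_ennpowr ennpowr_one)

lemma Lnorm_leI:
  assumes "0 < p" "0 < c"
    and "(\<integral>\<^sup>+ x. ennpowr (F x) p \<partial>M) \<le> ennreal c * (\<integral>\<^sup>+ x. ennpowr (G x) p \<partial>M')"
  shows "Lnorm p M F \<le> ennreal (c powr (1 / p)) * Lnorm p M' G"
  using ennpowr_mono[OF assms(3), of "1/p"] assms(1,2)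
  by (simp add: Lnorm_def ennpowr_mult_ennreal)

lemma Lnorm_leD:
  assumes "0 < p" "0 < c" "Lnorm p M F \<le> ennreal c * Lnorm p M' G"
  shows "(\<integral>\<^sup>+ x. ennpowr (F x) p \<partial>M) \<le> ennreal (c powr p) * (\<integral>\<^sup>+ x. ennpowr (G x) p \<partial>M')"
  using ennpowr_mono[OF assms(3), of p] assms(1,2)
  by (simp add: ennpowr_mult_ennreal ennpowr_Lnorm)

text \<open>The convex function \<open>u powr q\<close> lies above its tangent at \<open>m\<close>;
  this is Young's inequality with the exponents \<open>q\<close> and \<open>q / (q - 1)\<close>. The
  linear form yields Jensen's inequality for integrals and for finite sums alike.\<close>

lemma powr_tangent_le:
  fixes m u q :: real
  assumes "1 \<le> q" "0 < m" "0 \<le> u"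
  shows "q * m powr (q - 1) * u \<le> u powr q + (q - 1) * m powr q"
proof (cases "q = 1")
  case True
  then show ?thesis using assms by (cases "u = 0") auto
next
  case False
  then have q: "1 < q" using assms by simp
  have "u * m powr (q - 1) \<le> u powr q / q + (m powr (q - 1)) powr (q / (q - 1)) / (q / (q - 1))"
    by (rule Youngs_inequality) (use q assms in \<open>auto simp: field_simps\<close>)
  also have "(m powr (q - 1)) powr (q / (q - 1)) = m powr q"
    using q by (simp add: powr_powr)
  finally show ?thesis using q by (simp add: field_simps)
qed

text \<open>Integrate the tangent inequality over \<open>A\<close> and take the mean
  \<open>U / \<mu>\<close> as the point of tangency. The integral is handed over as a real number
  \<open>U\<close>, so that its power is an ordinary real power.\<close>

lemma nn_integral_power_mean:
  fixes h :: "'a \<Rightarrow> real"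
  assumes q: "1 \<le> q" and h[measurable]: "h \<in> borel_measurable M" and h0: "\<And>x. 0 \<le> h x"
    and A[measurable]: "A \<in> sets M" and fin: "emeasure M A < \<infinity>"
    and I: "(\<integral>\<^sup>+ x\<in>A. ennreal (h x powr q) \<partial>M) = ennreal I" "0 \<le> I"
  obtains U where "0 \<le> U" "(\<integral>\<^sup>+ x\<in>A. ennreal (h x) \<partial>M) = ennreal U"
    "U powr q \<le> measure M A powr (q - 1) * I"
proof -
  define \<mu> where "\<mu> = measure M A"
  have \<mu>: "emeasure M A = ennreal \<mu>" "0 \<le> \<mu>"
    using fin by (auto simp: \<mu>_def emeasure_eq_ennreal_measure)
  have tang: "ennreal (q * m powr (q - 1)) * (\<integral>\<^sup>+ x\<in>A. ennreal (h x) \<partial>M)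
      \<le> ennreal (I + (q - 1) * m powr q * \<mu>)" if "0 < m" for m
  proof -
    have "ennreal (q * m powr (q - 1)) * (\<integral>\<^sup>+ x\<in>A. ennreal (h x) \<partial>M)
        = (\<integral>\<^sup>+ x\<in>A. ennreal (q * m powr (q - 1) * h x) \<partial>M)"
      using q h0 by (subst nn_integral_cmult[symmetric])
        (auto simp: ennreal_mult mult.assoc intro!: nn_integral_cong)
    also have "\<dots> \<le> (\<integral>\<^sup>+ x\<in>A. (ennreal (h x powr q) + ennreal ((q - 1) * m powr q)) \<partial>M)"
      using powr_tangent_le[OF q that h0] q
      by (intro nn_integral_mono) (auto simp: indicator_def ennreal_plus[symmetric] simp del: ennreal_plus intro!: ennreal_leI)
    also have "\<dots> = (\<integral>\<^sup>+ x\<in>A. ennreal (h x powr q) \<partial>M) + ennreal ((q - 1) * m powr q) * emeasure M A"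
      by (simp add: distrib_right nn_integral_add nn_integral_cmult)
    also have "\<dots> = ennreal (I + (q - 1) * m powr q * \<mu>)"
      using q I \<mu> by (simp add: ennreal_mult)
    finally show ?thesis .
  qed
  \<comment> \<open>The tangent at 1 already shows that the integral is finite; the optimal point of
    tangency is only available once the value \<open>U\<close> exists.\<close>
  have "ennreal q * (\<integral>\<^sup>+ x\<in>A. ennreal (h x) \<partial>M) < \<infinity>"
    using tang[of 1] by (auto simp: less_top[symmetric] top_unique)
  then have "(\<integral>\<^sup>+ x\<in>A. ennreal (h x) \<partial>M) < \<infinity>"
    using q by (auto simp: ennreal_mult_less_top)
  then obtain U where U: "0 \<le> U" "(\<integral>\<^sup>+ x\<in>A. ennreal (h x) \<partial>M) = ennreal U"
    by (cases "\<integral>\<^sup>+ x\<in>A. ennreal (h x) \<partial>M") auto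
  have "U powr q \<le> \<mu> powr (q - 1) * I"
  proof (cases "U = 0 \<or> \<mu> = 0")
    case True
    have "U = 0"
    proof (rule ccontr)
      assume "U \<noteq> 0"
      with True have "\<mu> = 0" by simp
      then have "A \<in> null_sets M" using \<mu> A by auto
      then have "(\<integral>\<^sup>+ x\<in>A. ennreal (h x) \<partial>M) = 0"
        by (rule nn_integral_null_set)
      with U \<open>U \<noteq> 0\<close> show False by simp
    qed
    then show ?thesis using I by simp
  next
    case False
    with U \<mu> have pos: "0 < U" "0 < \<mu>" by auto
    have "ennreal (q * (U/\<mu>) powr (q - 1) * U) \<le> ennreal (I + (q - 1) * (U/\<mu>) powr q * \<mu>)"
      using tang[of "U/\<mu>"] pos U q by (simp add: ennreal_mult)
    then have "q * (U/\<mu>) powr (q - 1) * U \<le> I + (q - 1) * (U/\<mu>) powr q * \<mu>"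
      using pos I q by (subst (asm) ennreal_le_iff) auto
    moreover have "(U/\<mu>) powr q * \<mu> = (U/\<mu>) powr (q - 1) * U"
      using pos powr_add[of "U/\<mu>" "q - 1" 1] by simp
    then have "(q - 1) * (U/\<mu>) powr q * \<mu> = (q - 1) * ((U/\<mu>) powr (q - 1) * U)"
      by simp
    ultimately have "(U/\<mu>) powr (q - 1) * U \<le> I"
      by (simp add: algebra_simps)
    moreover have "(U/\<mu>) powr (q - 1) * \<mu> powr (q - 1) = U powr (q - 1)"
      using pos by (simp flip: powr_mult)
    then have "\<mu> powr (q - 1) * ((U/\<mu>) powr (q - 1) * U) = U powr q"
      using pos powr_add[of U "q - 1" 1] by (simp add: mult_ac)
    ultimately show ?thesis
      by (metis mult_left_mono powr_ge_zero)
  qed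
  with U show ?thesis unfolding \<mu>_def by (rule that)
qed

section \<open>Tubes and the pointwise bound for the Kakeya maximal function\<close>

lemma norm_perp_le:
  fixes \<theta> x :: "'a::euclidean_space"
  assumes "norm \<theta> = 1"
  shows "norm (x - (x \<bullet> \<theta>) *\<^sub>R \<theta>) \<le> norm x"
    "(norm (x - (x \<bullet> \<theta>) *\<^sub>R \<theta>))\<^sup>2 = (norm x)\<^sup>2 - (x \<bullet> \<theta>)\<^sup>2"
proof -
  show *: "(norm (x - (x \<bullet> \<theta>) *\<^sub>R \<theta>))\<^sup>2 = (norm x)\<^sup>2 - (x \<bullet> \<theta>)\<^sup>2"
    using assms unfolding power2_norm_eq_inner
    by (simp add: inner_diff_left inner_diff_right inner_commute power2_eq_square algebra_simps norm_eq_1)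
  then show "norm (x - (x \<bullet> \<theta>) *\<^sub>R \<theta>) \<le> norm x"
    by (intro power2_le_imp_le[OF _ norm_ge_zero]) simp
qed

text \<open>The inscribed ball bounds the volume of a tube from below, uniformly in its length,
  direction and position.\<close>

lemma tube_props:
  fixes \<omega> a :: "'a::euclidean_space"
  assumes "norm \<omega> = 1" "1 \<le> N"
  shows "closed (tube N \<omega> a)" "bounded (tube N \<omega> a)" "cball a (1/2) \<subseteq> tube N \<omega> a"
proof -
  show "closed (tube N \<omega> a)"
    unfolding tube_def by (intro closed_Collect_conj closed_Collect_le continuous_intros)
  show "bounded (tube N \<omega> a)"
  proof (rule bounded_subset[OF bounded_cball[of a "N/2 + 1/2"]], rule)
    fix x assume "x \<in> tube N \<omega> a"
    then have "\<bar>(x - a) \<bullet> \<omega>\<bar> \<le> N / 2" "norm ((x - a) - ((x - a) \<bullet> \<omega>) *\<^sub>R \<omega>) \<le> 1 / 2"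
      by (auto simp: tube_def)
    moreover have "norm (x - a) \<le> norm ((x - a) - ((x - a) \<bullet> \<omega>) *\<^sub>R \<omega>) + norm (((x - a) \<bullet> \<omega>) *\<^sub>R \<omega>)"
      by (metis diff_add_cancel norm_triangle_ineq)
    ultimately show "x \<in> cball a (N/2 + 1/2)"
      using assms by (simp add: dist_norm norm_minus_commute)
  qed
  show "cball a (1/2) \<subseteq> tube N \<omega> a"
  proof
    fix x assume "x \<in> cball a (1/2)"
    then have n: "norm (x - a) \<le> 1/2" by (simp add: dist_norm norm_minus_commute)
    have "\<bar>(x - a) \<bullet> \<omega>\<bar> \<le> norm (x - a)"
      using Cauchy_Schwarz_ineq2[of "x - a" \<omega>] assms by simp
    moreover have "norm ((x - a) - ((x - a) \<bullet> \<omega>) *\<^sub>R \<omega>) \<le> norm (x - a)"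
      by (rule norm_perp_le(1)[OF assms(1)])
    ultimately show "x \<in> tube N \<omega> a"
      unfolding tube_def mem_Collect_eq using n assms(2) by linarith
  qed
qed

text \<open>The tubes are normalised to have volume at least a constant, so Jensen's inequality on a
  single tube already bounds the maximal function by the \<open>L\<^sup>n\<close> norm.\<close>

lemma kakeya_maximal_le:
  fixes f :: "'a::euclidean_space \<Rightarrow> complex"
  assumes f: "f \<in> borel_measurable lebesgue" and p: "1 \<le> p" and \<omega>: "norm \<omega> = 1" and N: "1 \<le> N"
  shows "ennpowr (kakeya_maximal N f \<omega>) p
    \<le> ennreal (1 / measure lebesgue (cball (0::'a) (1/2))) * (\<integral>\<^sup>+ x. ennpowr (ennreal (norm (f x))) p \<partial>lebesgue)"
proof -
  define J where "J = (\<integral>\<^sup>+ x. ennpowr (ennreal (norm (f x))) p \<partial>lebesgue)"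
  define m where "m = measure lebesgue (cball (0::'a) (1/2))"
  have m: "0 < m" unfolding m_def using content_cball_pos[of "1/2" "0::'a"] by simp
  show ?thesis
  proof (cases "J = \<infinity>")
    case True
    then show ?thesis unfolding J_def[symmetric] using m m_def by (simp add: ennreal_mult_top)
  next
    case False
    then obtain j where j: "J = ennreal j" "0 \<le> j" by (cases J) auto
    have "(\<integral>\<^sup>+ x\<in>tube N \<omega> a. ennreal (norm (f x)) \<partial>lebesgue) / emeasure lebesgue (tube N \<omega> a)
        \<le> ennreal ((j / m) powr (1 / p))" for a
    proof -
      let ?T = "tube N \<omega> a"
      note T = tube_props[OF \<omega> N, of a]
      have T': "?T \<in> lmeasurable"
        using T by (simp add: compact_eq_bounded_closed lmeasurable_compact)
      have mT: "m \<le> measure lebesgue ?T"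
      proof -
        have "m = measure lebesgue (cball a (1/2))"
          unfolding m_def
          using content_ball_conv_unit_ball[of "1/2" a] content_ball_conv_unit_ball[of "1/2" "0::'a"]
          by (simp add: content_cball_conv_ball)
        also have "\<dots> \<le> measure lebesgue ?T"
          using T(3) T' by (intro measure_mono_fmeasurable) auto
        finally show ?thesis .
      qed
      have Jle: "(\<integral>\<^sup>+ x\<in>?T. ennreal (norm (f x) powr p) \<partial>lebesgue) \<le> ennreal j"
        unfolding j(1)[symmetric] J_def
        by (intro nn_integral_mono) (auto simp: ennpowr_ennreal indicator_def)
      then obtain I where I: "(\<integral>\<^sup>+ x\<in>?T. ennreal (norm (f x) powr p) \<partial>lebesgue) = ennreal I" "0 \<le> I" "I \<le> j"
        using j by (cases "\<integral>\<^sup>+ x\<in>?T. ennreal (norm (f x) powr p) \<partial>lebesgue") (auto simp: top_unique)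
      obtain U where U: "0 \<le> U" "(\<integral>\<^sup>+ x\<in>?T. ennreal (norm (f x)) \<partial>lebesgue) = ennreal U"
        "U powr p \<le> measure lebesgue ?T powr (p - 1) * I"
      proof (rule nn_integral_power_mean[OF p _ _ _ _ I(1,2)])
        show "(\<lambda>x. norm (f x)) \<in> borel_measurable lebesgue" using f by measurable
        show "?T \<in> sets lebesgue" using T' by auto
        show "emeasure lebesgue ?T < \<infinity>" using T' by (auto simp: fmeasurable_def)
      qed (auto)
      let ?t = "measure lebesgue ?T"
      have t: "0 < ?t" using mT m by simp
      have "(U / ?t) powr p \<le> ?t powr (p - 1) * I / ?t powr p"
        using U t by (simp add: powr_divide divide_right_mono)
      also have "\<dots> = I / ?t" using t by (simp add: powr_diff)
      also have "\<dots> \<le> j / m" using I mT m j by (intro frac_le) auto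
      finally have "((U / ?t) powr p) powr (1/p) \<le> (j / m) powr (1/p)"
        using p by (intro powr_mono2) auto
      then have "U / ?t \<le> (j / m) powr (1/p)" using p U t by (simp add: powr_powr)
      moreover have "emeasure lebesgue ?T = ennreal ?t"
        using T' by (simp add: emeasure_eq_measure2)
      ultimately show ?thesis using U t by (simp add: divide_ennreal ennreal_leI)
    qed
    then have "kakeya_maximal N f \<omega> \<le> ennreal ((j / m) powr (1 / p))"
      unfolding kakeya_maximal_def by (intro SUP_least) auto
    then have "ennpowr (kakeya_maximal N f \<omega>) p \<le> ennpowr (ennreal ((j / m) powr (1 / p))) p"
      using p by (intro ennpowr_mono) auto
    also have "\<dots> = ennreal (1 / m) * ennreal j"
      using p m j by (simp add: ennpowr_ennreal powr_powr flip: ennreal_mult)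
    finally show ?thesis using j by (simp add: J_def m_def)
  qed
qed

subsection \<open>Surface measure\<close>

text \<open>Two cases matter: translations (\<open>c = 1\<close>), and the reflections
  \<open>y \<mapsto> t - y\<close> (\<open>c = -1\<close>) that occur in the Fubini
  argument.\<close>

lemma lborel_distr_affine_unit:
  fixes t :: "'a::euclidean_space"
  assumes "\<bar>c\<bar> = 1"
  shows "distr lborel borel (\<lambda>x. t + c *\<^sub>R x) = lborel"
  using lborel_affine[of c t] assms by (simp add: density_1)

text \<open>Uniqueness of Haar measure by Fubini's theorem: for translation invariant \<open>\<mu>\<close> both
  \<open>|B| \<mu>(A)\<close> and \<open>|A| \<mu>(B)\<close> equal the integral of \<open>1\<^sub>A(x) 1\<^sub>B(x + y)\<close>.\<close>

lemma translation_invariant_measure_swap: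
  fixes M :: "'a::euclidean_space measure"
  assumes sets[measurable_cong]: "sets M = sets borel" and "sigma_finite_measure M"
    and inv: "\<And>t. distr M borel (\<lambda>x. t + x) = M"
    and A[measurable]: "A \<in> sets borel" and B[measurable]: "B \<in> sets borel"
  shows "emeasure lborel B * emeasure M A = emeasure lborel A * emeasure M B"
proof -
  interpret M: sigma_finite_measure M by fact
  interpret P: pair_sigma_finite M "lborel :: 'a measure" ..
  let ?i = "indicator :: 'a set \<Rightarrow> 'a \<Rightarrow> ennreal"
  have L: "(\<integral>\<^sup>+y. h (t + c *\<^sub>R y) \<partial>lborel) = (\<integral>\<^sup>+y. h y \<partial>lborel)"
    if "h \<in> borel_measurable borel" "\<bar>c\<bar> = 1" for h :: "'a \<Rightarrow> ennreal" and t c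
    using that by (subst (2) lborel_distr_affine_unit[symmetric, OF that(2), of t]) (simp add: nn_integral_distr)
  have T: "(\<integral>\<^sup>+x. h (t + x) \<partial>M) = (\<integral>\<^sup>+x. h x \<partial>M)"
    if "h \<in> borel_measurable borel" for h :: "'a \<Rightarrow> ennreal" and t
    using that by (subst (2) inv[symmetric, of t]) (simp add: nn_integral_distr)
  have [simp]: "space M = UNIV" using sets_eq_imp_space_eq[OF sets] by simp
  have "emeasure lborel B * emeasure M A = (\<integral>\<^sup>+x. ?i A x * (\<integral>\<^sup>+y. ?i B y \<partial>lborel) \<partial>M)"
    by (simp add: nn_integral_multc mult.commute)
  also have "\<dots> = (\<integral>\<^sup>+x. (\<integral>\<^sup>+y. ?i A x * ?i B (x + y) \<partial>lborel) \<partial>M)"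
    using L[of "?i B" 1] by (intro nn_integral_cong) (simp add: nn_integral_cmult)
  also have "\<dots> = (\<integral>\<^sup>+y. (\<integral>\<^sup>+x. ?i A x * ?i B (x + y) \<partial>M) \<partial>lborel)"
    by (rule P.Fubini'[symmetric]) measurable
  also have "\<dots> = (\<integral>\<^sup>+y. (\<integral>\<^sup>+x. ?i A (x - y) * ?i B x \<partial>M) \<partial>lborel)"
  proof (rule nn_integral_cong)
    fix y
    show "(\<integral>\<^sup>+x. ?i A x * ?i B (x + y) \<partial>M) = (\<integral>\<^sup>+x. ?i A (x - y) * ?i B x \<partial>M)"
      using T[of "\<lambda>x. ?i A (x - y) * ?i B x" y] by (simp add: add.commute)
  qed
  also have "\<dots> = (\<integral>\<^sup>+x. (\<integral>\<^sup>+y. ?i A (x - y) * ?i B x \<partial>lborel) \<partial>M)"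
    by (rule P.Fubini') measurable
  also have "\<dots> = (\<integral>\<^sup>+x. emeasure lborel A * ?i B x \<partial>M)"
    using L[of "?i A" "-1"] by (intro nn_integral_cong) (simp add: nn_integral_multc)
  also have "\<dots> = emeasure lborel A * emeasure M B"
    by (simp add: nn_integral_cmult)
  finally show ?thesis .
qed

text \<open>The image of Lebesgue measure under \<open>f\<close> is again translation invariant,
  hence proportional to Lebesgue measure. Since \<open>f\<close> preserves the unit ball, the factor
  is 1.\<close>

lemma lborel_distr_orthogonal:
  fixes f :: "'a::euclidean_space \<Rightarrow> 'a"
  assumes f: "orthogonal_transformation f"
  shows "distr lborel borel f = lborel"
proof -
  have lin: "linear f" by (rule orthogonal_transformation_linear[OF f])
  then have cont: "continuous_on UNIV f" by (simp add: linear_continuous_on linear_conv_bounded_linear)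
  then have fm[measurable]: "f \<in> borel \<rightarrow>\<^sub>M borel" by (rule borel_measurable_continuous_onI)
  have nf: "norm (f x) = norm x" for x by (rule orthogonal_transformation_norm[OF f])
  define M where "M = distr lborel borel f"
  have [simp]: "sets M = sets borel" "space M = UNIV" by (simp_all add: M_def)
  have fball: "f -` ball 0 r = ball 0 r" for r by (auto simp: nf)
  have ball: "emeasure M (ball 0 r) = emeasure lborel (ball (0::'a) r)" for r
    by (simp add: M_def emeasure_distr fball)
  have "sigma_finite_measure M"
  proof
    have "\<Union> (range (\<lambda>n. ball (0::'a) (real n))) = UNIV"
    proof (intro equalityI subsetI UNIV_I)
      fix x :: 'a
      obtain n where "norm x < real n" using reals_Archimedean2 by blast
      then show "x \<in> \<Union> (range (\<lambda>n. ball (0::'a) (real n)))" by auto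
    qed
    moreover have "emeasure M (ball 0 (real n)) \<noteq> \<infinity>" for n
      unfolding ball using emeasure_bounded_finite[of "ball (0::'a) (real n)"] by auto
    ultimately show "\<exists>A. countable A \<and> A \<subseteq> sets M \<and> \<Union> A = space M \<and> (\<forall>a\<in>A. emeasure M a \<noteq> \<infinity>)"
      by (intro exI[of _ "range (\<lambda>n. ball 0 (real n))"]) auto
  qed
  moreover have "distr M borel (\<lambda>x. t + x) = M" for t
  proof -
    \<comment> \<open>Translating by \<open>t\<close> after \<open>f\<close> is the same as
      translating by a preimage of \<open>t\<close> before \<open>f\<close>.\<close>
    obtain s where s: "f s = t" using orthogonal_transformation_surj[OF f] by (metis surjD)
    have "distr M borel (\<lambda>x. t + x) = distr lborel borel (\<lambda>x. t + f x)"
      by (simp add: M_def distr_distr comp_def)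
    also have "\<dots> = distr lborel borel (\<lambda>x. f (s + 1 *\<^sub>R x))"
      by (simp add: linear_add[OF lin] s)
    also have "\<dots> = distr (distr lborel borel (\<lambda>x. s + 1 *\<^sub>R x)) borel f"
      by (simp add: distr_distr comp_def)
    also have "\<dots> = M"
      unfolding M_def by (subst lborel_distr_affine_unit) auto
    finally show ?thesis .
  qed
  ultimately have swap: "emeasure lborel B * emeasure M (ball 0 1) = emeasure lborel (ball (0::'a) 1) * emeasure M B"
    if "B \<in> sets borel" for B
    using that by (intro translation_invariant_measure_swap) auto
  have pos: "emeasure lborel (ball (0::'a) 1) \<noteq> 0" "emeasure lborel (ball (0::'a) 1) \<noteq> \<infinity>"
    using content_ball_pos[of 1 "0::'a"] emeasure_bounded_finite[of "ball (0::'a) 1"]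
    by (auto simp: measure_def)
  show ?thesis unfolding M_def[symmetric]
  proof (rule measure_eqI)
    fix A assume "A \<in> sets M"
    then have "emeasure lborel (ball (0::'a) 1) * emeasure M A = emeasure lborel (ball (0::'a) 1) * emeasure lborel A"
      using swap[of A] ball[of 1] by (simp add: mult.commute)
    then show "emeasure M A = emeasure lborel A"
      using pos by (simp add: ennreal_mult_cancel_left)
  qed simp
qed

text \<open>The surface measure before completion. Here measurability is Borel measurability, so
  image measures under rotations are easy to form; integrals pass to the completion through
  \<open>integral_completion\<close>.\<close>

definition cone_measure :: "'a::euclidean_space measure" where
  "cone_measure = scale_measure (of_nat DIM('a))
       (distr (restrict_space lborel (ball 0 1 - {0})) (restrict_space borel (sphere 0 1))
          (\<lambda>x. x /\<^sub>R norm x))"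

lemma sphere_measure_eq: "sphere_measure = completion cone_measure"
  by (simp add: sphere_measure_def cone_measure_def)

lemma sets_cone_measure [measurable_cong]: "sets cone_measure = sets (restrict_space borel (sphere 0 1))"
  by (simp add: cone_measure_def)

lemma space_cone_measure [simp]: "space cone_measure = sphere 0 1"
  by (simp add: cone_measure_def space_scale_measure space_restrict_space)

lemma space_sphere_measure [simp]: "space sphere_measure = sphere 0 1"
  by (simp add: sphere_measure_eq)

lemma measurable_cone_measure: "f \<in> borel \<rightarrow>\<^sub>M N \<Longrightarrow> f \<in> cone_measure \<rightarrow>\<^sub>M N"
  by (subst measurable_cong_sets[OF sets_cone_measure refl]) (rule measurable_restrict_space1)

lemma measurable_sphere_measure: "f \<in> borel \<rightarrow>\<^sub>M N \<Longrightarrow> f \<in> sphere_measure \<rightarrow>\<^sub>M N"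
  unfolding sphere_measure_eq by (rule measurable_completion[OF measurable_cone_measure])

lemma sets_sphere_measure_borel: "A \<in> sets borel \<Longrightarrow> sphere 0 1 \<inter> A \<in> sets sphere_measure"
  unfolding sphere_measure_eq
  by (intro sets_completionI_sets) (auto simp: sets_cone_measure sets_restrict_space)

lemma measurable_radial_projection [measurable]:
  "(\<lambda>x::'a::euclidean_space. x /\<^sub>R norm x) \<in> restrict_space lborel (ball 0 1 - {0}) \<rightarrow>\<^sub>M restrict_space borel (sphere 0 1)"
proof (rule measurable_restrict_space2)
  show "(\<lambda>x::'a. x /\<^sub>R norm x) \<in> restrict_space lborel (ball 0 1 - {0}) \<rightarrow>\<^sub>M borel"
    by (rule measurable_restrict_space1) measurable
qed (auto simp: space_restrict_space)

lemma emeasure_cone_measure: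
  fixes A :: "'a::euclidean_space set"
  assumes "A \<in> sets borel" "A \<subseteq> sphere 0 1"
  shows "emeasure cone_measure A
    = of_nat DIM('a) * emeasure lborel {y \<in> ball 0 1 - {0}. y /\<^sub>R norm y \<in> A}"
proof -
  have A: "A \<in> sets (restrict_space borel (sphere 0 1))"
    using assms by (auto simp: sets_restrict_space)
  have "(\<lambda>x. x /\<^sub>R norm x) -` A \<inter> space (restrict_space lborel (ball 0 1 - {0}))
      = {y \<in> ball 0 1 - {0}. y /\<^sub>R norm y \<in> A}"
    by (auto simp: space_restrict_space)
  moreover have "emeasure (restrict_space lborel (ball 0 1 - {0})) {y \<in> ball 0 1 - {0}. y /\<^sub>R norm y \<in> A}
      = emeasure lborel {y \<in> ball 0 1 - {0}. y /\<^sub>R norm y \<in> A}"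
    by (rule emeasure_restrict_space) auto
  ultimately show ?thesis using A
    by (simp only: cone_measure_def emeasure_distr[OF measurable_radial_projection A] emeasure_scale_measure)
qed

lemma emeasure_sphere_measure:
  fixes A :: "'a::euclidean_space set"
  assumes "A \<in> sets borel" "A \<subseteq> sphere 0 1"
  shows "emeasure sphere_measure A
    = of_nat DIM('a) * emeasure lborel {y \<in> ball 0 1 - {0}. y /\<^sub>R norm y \<in> A}"
proof -
  have "A \<in> sets cone_measure" using assms by (auto simp: sets_cone_measure sets_restrict_space)
  then show ?thesis using emeasure_cone_measure[OF assms] by (simp add: sphere_measure_eq)
qed

lemma finite_measure_sphere_measure: "finite_measure (sphere_measure :: 'a::euclidean_space measure)"
proof
  have "emeasure lborel {y \<in> ball 0 1 - {0::'a}. y /\<^sub>R norm y \<in> sphere 0 1} \<le> emeasure lborel (ball 0 1 :: 'a set)"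
    by (rule emeasure_mono) auto
  also have "\<dots> < \<infinity>" by (rule emeasure_bounded_finite) simp
  finally show "emeasure (sphere_measure :: 'a measure) (space sphere_measure) \<noteq> \<infinity>"
    by (simp add: emeasure_sphere_measure ennreal_mult_eq_top_iff)
qed

text \<open>As \<open>Q\<close> is linear and isometric, the cone over the preimage of a set is the
  preimage of the cone over the set. So invariance of Lebesgue measure passes to the sphere.\<close>

lemma distr_cone_measure_orthogonal:
  fixes Q :: "'a::euclidean_space \<Rightarrow> 'a"
  assumes Q: "orthogonal_transformation Q"
  shows "distr cone_measure cone_measure Q = cone_measure" "Q \<in> cone_measure \<rightarrow>\<^sub>M cone_measure"
proof -
  have lin: "linear Q" by (rule orthogonal_transformation_linear[OF Q])
  then have "continuous_on UNIV Q" by (simp add: linear_continuous_on linear_conv_bounded_linear)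
  then have Qm[measurable]: "Q \<in> borel \<rightarrow>\<^sub>M borel" by (rule borel_measurable_continuous_onI)
  have nQ: "norm (Q x) = norm x" for x by (rule orthogonal_transformation_norm[OF Q])
  show m: "Q \<in> cone_measure \<rightarrow>\<^sub>M cone_measure"
  proof (subst measurable_cong_sets[OF refl sets_cone_measure], rule measurable_restrict_space2)
    show "Q \<in> cone_measure \<rightarrow>\<^sub>M borel" by (rule measurable_cone_measure[OF Qm])
  qed (auto simp: nQ)
  show "distr cone_measure cone_measure Q = cone_measure"
  proof (rule measure_eqI)
    fix A assume "A \<in> sets (distr cone_measure cone_measure Q)"
    then have A: "A \<in> sets cone_measure" by simp
    then have A': "A \<in> sets borel" "A \<subseteq> sphere 0 1"
      by (auto simp: sets_cone_measure sets_restrict_space)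
    define D where "D = {y \<in> ball 0 1 - {0}. y /\<^sub>R norm y \<in> A}"
    have D: "D \<in> sets borel" using A' unfolding D_def by measurable
    have "emeasure (distr cone_measure cone_measure Q) A = emeasure cone_measure (Q -` A \<inter> sphere 0 1)"
      using emeasure_distr[OF m A] by simp
    also have "\<dots> = of_nat DIM('a) * emeasure lborel {y \<in> ball 0 1 - {0}. y /\<^sub>R norm y \<in> Q -` A \<inter> sphere 0 1}"
      using A' by (intro emeasure_cone_measure) (auto intro!: sets.Int measurable_sets_borel[OF Qm])
    also have "{y \<in> ball 0 1 - {0}. y /\<^sub>R norm y \<in> Q -` A \<inter> sphere 0 1} = Q -` D"
    proof -
      have "Q y = 0 \<longleftrightarrow> y = 0" for y using nQ[of y] by (metis norm_eq_zero)
      then show ?thesis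
        unfolding D_def using linear_scale[OF lin] by (auto simp: nQ)
    qed
    also have "emeasure lborel (Q -` D) = emeasure (distr lborel borel Q) D"
      using D by (simp add: emeasure_distr)
    also have "\<dots> = emeasure lborel D" by (simp add: lborel_distr_orthogonal[OF Q])
    also have "of_nat DIM('a) * emeasure lborel D = emeasure cone_measure A"
      unfolding D_def by (rule emeasure_cone_measure[OF A', symmetric])
    finally show "emeasure (distr cone_measure cone_measure Q) A = emeasure cone_measure A" .
  qed simp
qed

lemma integral_sphere_measure_orthogonal:
  fixes f :: "'a::euclidean_space \<Rightarrow> 'b::{banach, second_countable_topology}"
    and Q :: "'a \<Rightarrow> 'a"
  assumes Q: "orthogonal_transformation Q" and f: "f \<in> borel_measurable borel"
  shows "(\<integral>\<xi>. f (Q \<xi>) \<partial>sphere_measure) = (\<integral>\<xi>. f \<xi> \<partial>sphere_measure)"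
proof -
  note Qm = distr_cone_measure_orthogonal(2)[OF Q]
  have fm: "f \<in> borel_measurable cone_measure" by (rule measurable_cone_measure[OF f])
  have "(\<integral>\<xi>. f (Q \<xi>) \<partial>sphere_measure) = (\<integral>\<xi>. f (Q \<xi>) \<partial>cone_measure)"
    unfolding sphere_measure_eq by (rule integral_completion) (rule measurable_compose[OF Qm fm])
  also have "\<dots> = (\<integral>\<xi>. f \<xi> \<partial>distr cone_measure cone_measure Q)"
    by (rule integral_distr[OF Qm fm, symmetric])
  also have "\<dots> = (\<integral>\<xi>. f \<xi> \<partial>sphere_measure)"
    unfolding distr_cone_measure_orthogonal(1)[OF Q] sphere_measure_eq
    by (rule integral_completion[OF fm, symmetric])
  finally show ?thesis .
qed

lemma integrable_sphere_bounded:
  fixes f :: "'a::euclidean_space \<Rightarrow> 'b::{banach, second_countable_topology}"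
  assumes "f \<in> borel_measurable sphere_measure" "\<And>\<xi>. norm \<xi> = 1 \<Longrightarrow> norm (f \<xi>) \<le> B"
  shows "integrable sphere_measure f"
proof -
  interpret finite_measure "sphere_measure :: 'a measure" by (rule finite_measure_sphere_measure)
  show ?thesis
    by (rule integrable_const_bound[of _ B]) (use assms in auto)
qed

subsection \<open>Integration by parts on the sphere\<close>

text \<open>For an orthonormal pair this is the rotation by the angle \<open>t\<close> that turns
  \<open>\<theta>\<close> towards \<open>v\<close> and fixes the orthogonal complement of their
  plane.\<close>

definition plane_rotation :: "'a::euclidean_space \<Rightarrow> 'a \<Rightarrow> real \<Rightarrow> 'a \<Rightarrow> 'a" where
  "plane_rotation \<theta> v t z = z + (cos t - 1) *\<^sub>R ((z \<bullet> \<theta>) *\<^sub>R \<theta> + (z \<bullet> v) *\<^sub>R v)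
     + sin t *\<^sub>R ((z \<bullet> \<theta>) *\<^sub>R v - (z \<bullet> v) *\<^sub>R \<theta>)"

definition orthonormal_pair :: "'a::euclidean_space \<Rightarrow> 'a \<Rightarrow> bool" where
  "orthonormal_pair \<theta> v \<longleftrightarrow> \<theta> \<bullet> \<theta> = 1 \<and> v \<bullet> v = 1 \<and> \<theta> \<bullet> v = 0"

lemma plane_rotation_inner:
  assumes "orthonormal_pair \<theta> v"
  shows "plane_rotation \<theta> v t z \<bullet> \<theta> = cos t * (z \<bullet> \<theta>) - sin t * (z \<bullet> v)"
    "plane_rotation \<theta> v t z \<bullet> v = cos t * (z \<bullet> v) + sin t * (z \<bullet> \<theta>)"
  using assms by (auto simp: plane_rotation_def orthonormal_pair_def inner_add_left inner_diff_left
      inner_commute[of v \<theta>] algebra_simps)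

lemma plane_rotation_0 [simp]: "plane_rotation \<theta> v 0 z = z"
  by (simp add: plane_rotation_def)

lemma orthogonal_transformation_plane_rotation:
  assumes on: "orthonormal_pair \<theta> v"
  shows "orthogonal_transformation (plane_rotation \<theta> v t)"
  unfolding orthogonal_transformation_def
proof (intro conjI allI)
  show "linear (plane_rotation \<theta> v t)"
    by (rule linearI) (simp_all add: plane_rotation_def inner_add_left algebra_simps)
  fix y z
  let ?a = "y \<bullet> \<theta>" and ?b = "y \<bullet> v" and ?c = "z \<bullet> \<theta>" and ?d = "z \<bullet> v"
  have *: "\<theta> \<bullet> \<theta> = 1" "v \<bullet> v = 1" "\<theta> \<bullet> v = 0" "v \<bullet> \<theta> = 0"
    using on by (auto simp: orthonormal_pair_def inner_commute)
  have "plane_rotation \<theta> v t y \<bullet> plane_rotation \<theta> v t z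
      = y \<bullet> plane_rotation \<theta> v t z
        + (cos t - 1) * (?a * (plane_rotation \<theta> v t z \<bullet> \<theta>) + ?b * (plane_rotation \<theta> v t z \<bullet> v))
        + sin t * (?a * (plane_rotation \<theta> v t z \<bullet> v) - ?b * (plane_rotation \<theta> v t z \<bullet> \<theta>))"
    by (subst (1) plane_rotation_def)
       (simp add: inner_add_left inner_diff_left inner_commute algebra_simps)
  also have "y \<bullet> plane_rotation \<theta> v t z = y \<bullet> z + (cos t - 1) * (?a * ?c + ?b * ?d) + sin t * (?c * ?b - ?d * ?a)"
    by (simp add: plane_rotation_def inner_add_right inner_diff_right algebra_simps)
  also have "y \<bullet> z + (cos t - 1) * (?a * ?c + ?b * ?d) + sin t * (?c * ?b - ?d * ?a)
        + (cos t - 1) * (?a * (plane_rotation \<theta> v t z \<bullet> \<theta>) + ?b * (plane_rotation \<theta> v t z \<bullet> v))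
        + sin t * (?a * (plane_rotation \<theta> v t z \<bullet> v) - ?b * (plane_rotation \<theta> v t z \<bullet> \<theta>))
      = y \<bullet> z + (?a * ?c + ?b * ?d) * ((cos t)\<^sup>2 + (sin t)\<^sup>2 - 1)"
    unfolding plane_rotation_inner[OF on]
    by (simp add: power2_eq_square algebra_simps
        del: sin_cos_squared_add sin_cos_squared_add2 sin_cos_squared_add3)
  finally show "plane_rotation \<theta> v t y \<bullet> plane_rotation \<theta> v t z = y \<bullet> z" by simp
qed

text \<open>\<open>w\<close> is the derivative of \<open>u\<close> along the vector field that
  generates the rotations. As a relation it asks for differentiability along the orbits only, and
  sums and products are handled without any other regularity.\<close>

definition flow_deriv ::
    "'a::euclidean_space \<Rightarrow> 'a \<Rightarrow> ('a \<Rightarrow> complex) \<Rightarrow> ('a \<Rightarrow> complex) \<Rightarrow> bool" where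
  "flow_deriv \<theta> v u w \<longleftrightarrow> (\<forall>\<xi> t. ((\<lambda>t. u (plane_rotation \<theta> v t \<xi>))
      has_vector_derivative w (plane_rotation \<theta> v t \<xi>)) (at t))"

lemma flow_deriv_const: "flow_deriv \<theta> v (\<lambda>\<xi>. c) (\<lambda>\<xi>. 0)"
  by (simp add: flow_deriv_def)

lemma flow_deriv_add:
  "flow_deriv \<theta> v u w \<Longrightarrow> flow_deriv \<theta> v u' w' \<Longrightarrow> flow_deriv \<theta> v (\<lambda>\<xi>. u \<xi> + u' \<xi>) (\<lambda>\<xi>. w \<xi> + w' \<xi>)"
  by (auto simp: flow_deriv_def intro!: has_vector_derivative_add)

lemma flow_deriv_mult:
  "flow_deriv \<theta> v u w \<Longrightarrow> flow_deriv \<theta> v u' w' \<Longrightarrow>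
    flow_deriv \<theta> v (\<lambda>\<xi>. u \<xi> * u' \<xi>) (\<lambda>\<xi>. u \<xi> * w' \<xi> + w \<xi> * u' \<xi>)"
  by (auto simp: flow_deriv_def intro!: has_vector_derivative_mult)

text \<open>The velocity is expressed through the current point of the orbit and not through its
  starting point. Only in this form is the derivative along the flow a function of the
  point.\<close>

lemma plane_rotation_has_vector_derivative:
  assumes "orthonormal_pair \<theta> v"
  shows "((\<lambda>t. plane_rotation \<theta> v t \<xi>) has_vector_derivative
      (plane_rotation \<theta> v t \<xi> \<bullet> \<theta>) *\<^sub>R v - (plane_rotation \<theta> v t \<xi> \<bullet> v) *\<^sub>R \<theta>) (at t)"
  unfolding plane_rotation_inner[OF assms] unfolding plane_rotation_def
  by (rule derivative_eq_intros refl | simp)+ (simp add: algebra_simps)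

lemma flow_deriv_differentiable:
  assumes on: "orthonormal_pair \<theta> v" and F: "\<And>\<xi>. (F has_derivative F' \<xi>) (at \<xi>)"
  shows "flow_deriv \<theta> v (\<lambda>\<xi>. of_real (F \<xi>)) (\<lambda>\<xi>. of_real (F' \<xi> ((\<xi> \<bullet> \<theta>) *\<^sub>R v - (\<xi> \<bullet> v) *\<^sub>R \<theta>)))"
  unfolding flow_deriv_def
proof (intro allI)
  fix \<xi> t
  have "((\<lambda>t. F (plane_rotation \<theta> v t \<xi>)) has_derivative (\<lambda>h. F' (plane_rotation \<theta> v t \<xi>)
      (h *\<^sub>R ((plane_rotation \<theta> v t \<xi> \<bullet> \<theta>) *\<^sub>R v - (plane_rotation \<theta> v t \<xi> \<bullet> v) *\<^sub>R \<theta>)))) (at t)"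
    using plane_rotation_has_vector_derivative[OF on, of \<xi> t]
    unfolding has_vector_derivative_def by (rule has_derivative_compose) (rule F)
  then have "((\<lambda>t. F (plane_rotation \<theta> v t \<xi>)) has_vector_derivative F' (plane_rotation \<theta> v t \<xi>)
      ((plane_rotation \<theta> v t \<xi> \<bullet> \<theta>) *\<^sub>R v - (plane_rotation \<theta> v t \<xi> \<bullet> v) *\<^sub>R \<theta>)) (at t)"
    unfolding has_vector_derivative_def
    using linear_scale[OF has_derivative_linear[OF F]] by (simp del: scaleR_scaleR)
  then have "((\<lambda>t. F (plane_rotation \<theta> v t \<xi>)) has_real_derivative F' (plane_rotation \<theta> v t \<xi>)
      ((plane_rotation \<theta> v t \<xi> \<bullet> \<theta>) *\<^sub>R v - (plane_rotation \<theta> v t \<xi> \<bullet> v) *\<^sub>R \<theta>)) (at t)"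
    by (simp add: has_real_derivative_iff_has_vector_derivative)
  then show "((\<lambda>t. of_real (F (plane_rotation \<theta> v t \<xi>)) :: complex) has_vector_derivative of_real (F' (plane_rotation \<theta> v t \<xi>)
      ((plane_rotation \<theta> v t \<xi> \<bullet> \<theta>) *\<^sub>R v - (plane_rotation \<theta> v t \<xi> \<bullet> v) *\<^sub>R \<theta>))) (at t)"
    by (rule has_vector_derivative_of_real)
qed

lemma continuous_measurable_sphere:
  "continuous_on UNIV f \<Longrightarrow> f \<in> borel_measurable sphere_measure"
  by (intro measurable_sphere_measure borel_measurable_continuous_onI)

lemma continuous_bounded_sphere:
  fixes w :: "'a::euclidean_space \<Rightarrow> complex"
  assumes "continuous_on UNIV w"
  obtains B where "\<And>\<xi>. norm \<xi> = 1 \<Longrightarrow> norm (w \<xi>) \<le> B"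
proof -
  have "compact (w ` sphere 0 1)"
    by (intro compact_continuous_image continuous_on_subset[OF assms]) auto
  then obtain B where "\<forall>y\<in>w ` sphere 0 1. norm y \<le> B"
    using compact_imp_bounded bounded_iff by metis
  then show ?thesis by (intro that[of B]) auto
qed

lemma integrable_sphere_continuous:
  fixes w :: "'a::euclidean_space \<Rightarrow> complex"
  assumes "continuous_on UNIV w"
  shows "integrable sphere_measure w"
  using continuous_bounded_sphere[OF assms] integrable_sphere_bounded continuous_measurable_sphere[OF assms]
  by metis

text \<open>Rotation invariance: the difference quotients \<open>(u \<circ> Q\<^sub>t - u) / t\<close> have integral zero.\<close>

lemma integral_flow_deriv_eq_0:
  fixes u w :: "'a::euclidean_space \<Rightarrow> complex"
  assumes on: "orthonormal_pair \<theta> v" and uw: "flow_deriv \<theta> v u w"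
    and cu: "continuous_on UNIV u" and cw: "continuous_on UNIV w"
  shows "(\<integral>\<xi>. w \<xi> \<partial>sphere_measure) = 0"
proof -
  let ?Q = "plane_rotation \<theta> v"
  interpret finite_measure "sphere_measure :: 'a measure" by (rule finite_measure_sphere_measure)
  note ot = orthogonal_transformation_plane_rotation[OF on]
  have cQ: "continuous_on UNIV (?Q t)" for t
    unfolding plane_rotation_def by (intro continuous_intros)
  have cuQ: "continuous_on UNIV (\<lambda>\<xi>. u (?Q t \<xi>))" for t
    by (rule continuous_on_compose2[OF cu cQ]) auto
  obtain B where B: "\<And>\<xi>. norm \<xi> = 1 \<Longrightarrow> norm (w \<xi>) \<le> B"
    using continuous_bounded_sphere[OF cw] by blast
  define s where "s m \<xi> = (u (?Q (1 / real (Suc m)) \<xi>) - u \<xi>) * of_nat (Suc m)" for m \<xi>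
  have s0: "(\<integral>\<xi>. s m \<xi> \<partial>sphere_measure) = 0" for m
  proof -
    have "(\<integral>\<xi>. s m \<xi> \<partial>sphere_measure)
        = ((\<integral>\<xi>. u (?Q (1 / real (Suc m)) \<xi>) \<partial>sphere_measure) - (\<integral>\<xi>. u \<xi> \<partial>sphere_measure)) * of_nat (Suc m)"
      unfolding s_def
      by (subst integral_mult_left_zero, subst Bochner_Integration.integral_diff)
         (auto intro!: integrable_sphere_continuous cu cuQ)
    also have "(\<integral>\<xi>. u (?Q (1 / real (Suc m)) \<xi>) \<partial>sphere_measure) = (\<integral>\<xi>. u \<xi> \<partial>sphere_measure)"
      by (rule integral_sphere_measure_orthogonal[OF ot borel_measurable_continuous_onI[OF cu]])
    finally show ?thesis by simp
  qed
  have "(\<lambda>m. \<integral>\<xi>. s m \<xi> \<partial>sphere_measure) \<longlonglongrightarrow> (\<integral>\<xi>. w \<xi> \<partial>sphere_measure)"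
  proof (rule integral_dominated_convergence[where w = "\<lambda>_. B"])
    show "w \<in> borel_measurable sphere_measure" by (rule continuous_measurable_sphere[OF cw])
    show "s m \<in> borel_measurable sphere_measure" for m
      unfolding s_def by (intro continuous_measurable_sphere continuous_intros cuQ cu)
    show "AE \<xi> in sphere_measure. (\<lambda>m. s m \<xi>) \<longlonglongrightarrow> w \<xi>"
    proof (rule AE_I2)
      fix \<xi> :: 'a
      have "((\<lambda>t. u (?Q t \<xi>)) has_vector_derivative w \<xi>) (at 0)"
        using uw[unfolded flow_deriv_def, rule_format, of \<xi> 0] by simp
      then have "((\<lambda>t. norm ((u (?Q t \<xi>) - u \<xi>) - t *\<^sub>R w \<xi>) / norm t) \<longlongrightarrow> 0) (at 0)"
        by (simp add: has_vector_derivative_def has_derivative_iff_norm)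
      moreover have "filterlim (\<lambda>m. 1 / real (Suc m)) (at 0) sequentially"
        by (rule filterlim_atI) (use LIMSEQ_Suc[OF lim_1_over_n] in auto)
      ultimately have "(\<lambda>m. norm ((u (?Q (1 / real (Suc m)) \<xi>) - u \<xi>) - (1 / real (Suc m)) *\<^sub>R w \<xi>)
          / norm (1 / real (Suc m))) \<longlonglongrightarrow> 0"
        by (rule filterlim_compose)
      moreover have "norm ((u (?Q (1 / real (Suc m)) \<xi>) - u \<xi>) - (1 / real (Suc m)) *\<^sub>R w \<xi>)
          / norm (1 / real (Suc m)) = norm (s m \<xi> - w \<xi>)" for m
      proof -
        have "s m \<xi> - w \<xi> = real (Suc m) *\<^sub>R ((u (?Q (1 / real (Suc m)) \<xi>) - u \<xi>) - (1 / real (Suc m)) *\<^sub>R w \<xi>)"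
          unfolding s_def scaleR_diff_right scaleR_scaleR by (simp add: scaleR_conv_of_real algebra_simps)
        then show ?thesis by (simp only: norm_scaleR) (simp add: mult.commute)
      qed
      ultimately show "(\<lambda>m. s m \<xi>) \<longlonglongrightarrow> w \<xi>"
        by (simp add: tendsto_norm_zero_iff LIM_zero_iff)
    qed
    show "AE \<xi> in sphere_measure. norm (s m \<xi>) \<le> B" for m
    proof (rule AE_I2)
      fix \<xi> :: 'a assume "\<xi> \<in> space sphere_measure"
      then have nQ: "norm (?Q t \<xi>) = 1" for t using orthogonal_transformation_norm[OF ot] by simp
      let ?h = "1 / real (Suc m)"
      \<comment> \<open>The mean value inequality along the orbit, which stays on the sphere, bounds
        the difference quotients by the constant \<open>B\<close> and so dominates them.\<close>
      have "norm (u (?Q ?h \<xi>) - u (?Q 0 \<xi>)) \<le> B * norm (?h - 0)"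
      proof (rule differentiable_bound[where S = UNIV])
        show "((\<lambda>t. u (?Q t \<xi>)) has_derivative (\<lambda>h. h *\<^sub>R w (?Q t \<xi>))) (at t within UNIV)" for t
          using uw[unfolded flow_deriv_def, rule_format, of \<xi> t] by (simp add: has_vector_derivative_def)
        show "onorm (\<lambda>h. h *\<^sub>R w (?Q t \<xi>)) \<le> B" for t
        proof (rule onorm_le)
          fix h :: real
          show "norm (h *\<^sub>R w (?Q t \<xi>)) \<le> B * norm h"
            using mult_right_mono[OF B[OF nQ[of t]] norm_ge_zero[of h]] by (simp add: mult.commute)
        qed
      qed auto
      then have "norm (u (?Q ?h \<xi>) - u \<xi>) * real (Suc m) \<le> B * norm (?h - 0) * real (Suc m)"
        by (intro mult_right_mono) auto
      also have "\<dots> = B" by (simp add: abs_of_pos del: of_nat_Suc)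
      finally show "norm (s m \<xi>) \<le> B"
        by (simp only: s_def norm_mult norm_of_nat)
    qed
  qed auto
  then show ?thesis unfolding s0 by (simp add: LIMSEQ_const_iff)
qed

section \<open>Characters and integration by parts in extensions\<close>

definition character :: "'a::euclidean_space \<Rightarrow> 'a \<Rightarrow> complex" where
  "character x \<xi> = exp (- 2 * of_real pi * \<i> * of_real (x \<bullet> \<xi>))"

lemma norm_character [simp]: "norm (character x \<xi>) = 1"
  by (simp add: character_def norm_exp_eq_Re)

lemma continuous_character [continuous_intros]: "continuous_on S (\<lambda>\<xi>. character x \<xi>)"
  unfolding character_def by (intro continuous_intros)

lemma extension_eq: "extension g x = (\<integral>\<xi>. g \<xi> * character x \<xi> \<partial>sphere_measure)"
  by (simp add: extension_def character_def)

lemma flow_deriv_inner: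
  assumes "orthonormal_pair \<theta> v"
  shows "flow_deriv \<theta> v (\<lambda>\<xi>. of_real (x \<bullet> \<xi>)) (\<lambda>\<xi>. of_real (x \<bullet> ((\<xi> \<bullet> \<theta>) *\<^sub>R v - (\<xi> \<bullet> v) *\<^sub>R \<theta>)))"
  by (rule flow_deriv_differentiable[OF assms]) (auto intro!: derivative_eq_intros)

lemma flow_deriv_character:
  assumes on: "orthonormal_pair \<theta> v"
  shows "flow_deriv \<theta> v (character x)
    (\<lambda>\<xi>. - 2 * of_real pi * \<i> * of_real (x \<bullet> ((\<xi> \<bullet> \<theta>) *\<^sub>R v - (\<xi> \<bullet> v) *\<^sub>R \<theta>)) * character x \<xi>)"
  unfolding flow_deriv_def
proof (intro allI)
  fix \<xi> t
  let ?Q = "plane_rotation \<theta> v"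
  have "((\<lambda>t. - 2 * of_real pi * \<i> * of_real (x \<bullet> ?Q t \<xi>)) has_vector_derivative
      - 2 * of_real pi * \<i> * of_real (x \<bullet> ((?Q t \<xi> \<bullet> \<theta>) *\<^sub>R v - (?Q t \<xi> \<bullet> v) *\<^sub>R \<theta>))) (at t)"
    using flow_deriv_mult[OF flow_deriv_const[of _ _ "- 2 * of_real pi * \<i>"] flow_deriv_inner[OF on, of x]]
    by (simp add: flow_deriv_def)
  from field_vector_diff_chain_at[OF this DERIV_exp]
  show "((\<lambda>t. character x (?Q t \<xi>)) has_vector_derivative
      - 2 * of_real pi * \<i> * of_real (x \<bullet> ((?Q t \<xi> \<bullet> \<theta>) *\<^sub>R v - (?Q t \<xi> \<bullet> v) *\<^sub>R \<theta>)) * character x (?Q t \<xi>)) (at t)"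
    by (simp add: comp_def character_def)
qed

text \<open>Integration by parts without division by the derivative of the phase: that derivative is
  \<open>s (\<xi> \<bullet> \<theta>) - \<tau> (\<xi> \<bullet> v)\<close>, whose deviation from the constant \<open>s\<close> stays in the amplitude.\<close>

lemma extension_integration_by_parts:
  fixes u w :: "'a::euclidean_space \<Rightarrow> complex"
  assumes on: "orthonormal_pair \<theta> v" and uw: "flow_deriv \<theta> v u w"
    and cu: "continuous_on UNIV u" and cw: "continuous_on UNIV w"
    and x: "x = \<tau> *\<^sub>R \<theta> + s *\<^sub>R v"
  shows "of_real s * extension u x
    = extension (\<lambda>\<xi>. w \<xi> / (2 * of_real pi * \<i>) + of_real ((\<xi> \<bullet> v) * \<tau> + s * (1 - \<xi> \<bullet> \<theta>)) * u \<xi>) x"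
proof -
  define p where "p \<xi> = x \<bullet> ((\<xi> \<bullet> \<theta>) *\<^sub>R v - (\<xi> \<bullet> v) *\<^sub>R \<theta>)" for \<xi>
  let ?c = "2 * of_real pi * \<i> :: complex"
  have p: "p \<xi> = (\<xi> \<bullet> \<theta>) * s - (\<xi> \<bullet> v) * \<tau>" for \<xi>
    using on unfolding p_def x orthonormal_pair_def
    by (simp add: inner_add_left inner_diff_right inner_commute[of v \<theta>])
  have cp: "continuous_on UNIV p" unfolding p_def by (intro continuous_intros)
  have "flow_deriv \<theta> v (\<lambda>\<xi>. u \<xi> * character x \<xi>)
      (\<lambda>\<xi>. u \<xi> * (- 2 * of_real pi * \<i> * of_real (p \<xi>) * character x \<xi>) + w \<xi> * character x \<xi>)"
    unfolding p_def by (rule flow_deriv_mult[OF uw flow_deriv_character[OF on]])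
  then have "(\<integral>\<xi>. u \<xi> * (- 2 * of_real pi * \<i> * of_real (p \<xi>) * character x \<xi>) + w \<xi> * character x \<xi> \<partial>sphere_measure) = 0"
    by (rule integral_flow_deriv_eq_0[OF on]) (intro continuous_intros cu cw cp)+
  also have "(\<integral>\<xi>. u \<xi> * (- 2 * of_real pi * \<i> * of_real (p \<xi>) * character x \<xi>) + w \<xi> * character x \<xi> \<partial>sphere_measure)
      = (\<integral>\<xi>. ?c * ((w \<xi> / ?c + of_real ((\<xi> \<bullet> v) * \<tau> + s * (1 - \<xi> \<bullet> \<theta>)) * u \<xi>) * character x \<xi>
          - of_real s * (u \<xi> * character x \<xi>)) \<partial>sphere_measure)"
    unfolding p by (rule Bochner_Integration.integral_cong) (auto simp: field_simps)
  also have "\<dots> = ?c * (extension (\<lambda>\<xi>. w \<xi> / ?c + of_real ((\<xi> \<bullet> v) * \<tau> + s * (1 - \<xi> \<bullet> \<theta>)) * u \<xi>) x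
      - of_real s * extension u x)"
    unfolding extension_eq
    by (subst integral_mult_right_zero, subst Bochner_Integration.integral_diff)
       (auto intro!: integrable_sphere_continuous continuous_intros cu cw)
  finally show ?thesis by simp
qed

subsection \<open>Uniform decay of the extension of a bump\<close>

text \<open>All data depend on an abstract parameter \<open>p\<close>, so that one constant for all
  \<open>p \<in> S\<close> means uniformity in the scale, the bump, the cell and the point. The
  point is \<open>\<tau> p *\<^sub>R \<theta> p + s p *\<^sub>R v p\<close>, where
  \<open>v p\<close> is the direction of its transverse component.\<close>

locale bump_family =
  fixes S :: "'p set" and \<delta> :: "'p \<Rightarrow> real" and F :: "'p \<Rightarrow> real^'n \<Rightarrow> real"
    and \<theta> v :: "'p \<Rightarrow> real^'n" and s \<tau> :: "'p \<Rightarrow> real" and b :: real and K :: "nat \<Rightarrow> real"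
  assumes delta: "p \<in> S \<Longrightarrow> 0 < \<delta> p" "p \<in> S \<Longrightarrow> \<delta> p \<le> 1"
    and smooth: "p \<in> S \<Longrightarrow> smooth (F p)"
    and deriv_bound: "p \<in> S \<Longrightarrow> \<bar>iter_partial is (F p) x\<bar> \<le> K (length is) * \<delta> p powr (- real (length is) / 2)"
    and support: "p \<in> S \<Longrightarrow> norm \<xi> = 1 \<Longrightarrow> b * sqrt (\<delta> p) < norm (\<xi> - \<theta> p) \<Longrightarrow> F p \<xi> = 0"
    and orthonormal: "p \<in> S \<Longrightarrow> orthonormal_pair (\<theta> p) (v p)"
    and s: "p \<in> S \<Longrightarrow> \<bar>s p\<bar> \<le> 1 / \<delta> p" and \<tau>: "p \<in> S \<Longrightarrow> \<bar>\<tau> p\<bar> \<le> 1 / \<delta> p"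
    and b: "0 \<le> b"
begin

text \<open>Amplitudes that are bounded uniformly in the parameter on the caps of radius \<open>b \<surd>\<delta>\<close>,
  together with all their flow derivatives at scale \<open>\<surd>\<delta>\<close>.\<close>

inductive symbol :: "('p \<Rightarrow> real^'n \<Rightarrow> complex) \<Rightarrow> bool" where
  const: "(\<And>p. p \<in> S \<Longrightarrow> norm (c p) \<le> C) \<Longrightarrow> symbol (\<lambda>p \<xi>. c p)"
| normal: "symbol (\<lambda>p \<xi>. of_real (\<xi> \<bullet> \<theta> p))"
| tangential: "symbol (\<lambda>p \<xi>. of_real ((\<xi> \<bullet> v p) / sqrt (\<delta> p)))"
| height: "symbol (\<lambda>p \<xi>. of_real (sqrt (\<delta> p) * s p * (1 - \<xi> \<bullet> \<theta> p)))"
| partial: "symbol (\<lambda>p \<xi>. of_real (sqrt (\<delta> p) ^ length is * iter_partial is (F p) \<xi>))"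
| add: "symbol u \<Longrightarrow> symbol u' \<Longrightarrow> symbol (\<lambda>p \<xi>. u p \<xi> + u' p \<xi>)"
| mult: "symbol u \<Longrightarrow> symbol u' \<Longrightarrow> symbol (\<lambda>p \<xi>. u p \<xi> * u' p \<xi>)"

text \<open>The height \<open>1 - \<xi> \<bullet> \<theta> p\<close> is half the squared distance
  from \<open>\<theta> p\<close>, hence of order \<open>\<delta> p\<close>. This is what balances
  the size \<open>1 / \<delta> p\<close> allowed for \<open>s p\<close>.\<close>

lemma sphere_geometry:
  assumes "p \<in> S" "norm \<xi> = 1" "norm (\<xi> - \<theta> p) \<le> b * sqrt (\<delta> p)"
  shows "\<bar>\<xi> \<bullet> \<theta> p\<bar> \<le> 1" "\<bar>\<xi> \<bullet> v p\<bar> \<le> b * sqrt (\<delta> p)" "\<bar>1 - \<xi> \<bullet> \<theta> p\<bar> \<le> b\<^sup>2 / 2 * \<delta> p"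
proof -
  have on: "\<theta> p \<bullet> \<theta> p = 1" "v p \<bullet> v p = 1" "\<theta> p \<bullet> v p = 0"
    using orthonormal[OF assms(1)] by (auto simp: orthonormal_pair_def)
  then have n: "norm (\<theta> p) = 1" "norm (v p) = 1" by (auto simp: norm_eq_1)
  show le1: "\<bar>\<xi> \<bullet> \<theta> p\<bar> \<le> 1"
    using Cauchy_Schwarz_ineq2[of \<xi> "\<theta> p"] n assms by simp
  have "\<xi> \<bullet> v p = (\<xi> - \<theta> p) \<bullet> v p" using on by (simp add: inner_diff_left)
  then show "\<bar>\<xi> \<bullet> v p\<bar> \<le> b * sqrt (\<delta> p)"
    using Cauchy_Schwarz_ineq2[of "\<xi> - \<theta> p" "v p"] n assms by simp
  have "(norm (\<xi> - \<theta> p))\<^sup>2 = 2 * (1 - \<xi> \<bullet> \<theta> p)"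
    using on assms(2) unfolding power2_norm_eq_inner
    by (simp add: inner_diff_left inner_diff_right inner_commute norm_eq_1)
  moreover have "(norm (\<xi> - \<theta> p))\<^sup>2 \<le> (b * sqrt (\<delta> p))\<^sup>2"
    using assms(3) by (intro power_mono) auto
  ultimately show "\<bar>1 - \<xi> \<bullet> \<theta> p\<bar> \<le> b\<^sup>2 / 2 * \<delta> p"
    using le1 delta[OF assms(1)] by (simp add: power_mult_distrib)
qed

lemma sqrt_power_eq: "p \<in> S \<Longrightarrow> sqrt (\<delta> p) ^ k = \<delta> p powr (real k / 2)"
  using delta[of p] by (simp add: powr_half_sqrt[symmetric] powr_power)

lemma symbol_bounded:
  assumes "symbol u"
  shows "\<exists>C. \<forall>p\<in>S. \<forall>\<xi>. norm \<xi> = 1 \<longrightarrow> norm (\<xi> - \<theta> p) \<le> b * sqrt (\<delta> p) \<longrightarrow> norm (u p \<xi>) \<le> C"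
  using assms
proof induction
  case (const c C)
  then show ?case by blast
next
  case normal
  then show ?case using sphere_geometry(1) by (intro exI[of _ 1]) auto
next
  case tangential
  show ?case
  proof (intro exI[of _ b] ballI allI impI)
    fix p \<xi> assume p: "p \<in> S" and \<xi>: "norm \<xi> = 1" "norm (\<xi> - \<theta> p) \<le> b * sqrt (\<delta> p)"
    show "norm (complex_of_real ((\<xi> \<bullet> v p) / sqrt (\<delta> p))) \<le> b"
      using sphere_geometry(2)[OF p \<xi>] delta(1)[OF p] unfolding norm_of_real
      by (simp add: divide_le_eq)
  qed
next
  case height
  show ?case
  proof (intro exI[of _ "b\<^sup>2 / 2"] ballI allI impI)
    fix p \<xi> assume p: "p \<in> S" and \<xi>: "norm \<xi> = 1" "norm (\<xi> - \<theta> p) \<le> b * sqrt (\<delta> p)"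
    have "\<bar>sqrt (\<delta> p) * s p * (1 - \<xi> \<bullet> \<theta> p)\<bar> = sqrt (\<delta> p) * (\<bar>s p\<bar> * \<bar>1 - \<xi> \<bullet> \<theta> p\<bar>)"
      using delta[OF p] by (simp add: abs_mult)
    also have "\<dots> \<le> 1 * (1 / \<delta> p * (b\<^sup>2 / 2 * \<delta> p))"
      using delta[OF p] s[OF p] sphere_geometry(3)[OF p \<xi>] by (intro mult_mono) auto
    finally show "norm (complex_of_real (sqrt (\<delta> p) * s p * (1 - \<xi> \<bullet> \<theta> p))) \<le> b\<^sup>2 / 2"
      using delta[OF p] unfolding norm_of_real by simp
  qed
next
  case (partial "is")
  show ?case
  proof (intro exI[of _ "K (length is)"] ballI allI impI)
    fix p \<xi> assume p: "p \<in> S"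
    have "\<bar>sqrt (\<delta> p) ^ length is * iter_partial is (F p) \<xi>\<bar>
        \<le> \<delta> p powr (real (length is) / 2) * (K (length is) * \<delta> p powr (- real (length is) / 2))"
      using deriv_bound[OF p] unfolding abs_mult sqrt_power_eq[OF p] by (intro mult_mono) auto
    also have "\<dots> = K (length is)"
      using delta(1)[OF p] powr_add[of "\<delta> p" "real (length is) / 2" "- real (length is) / 2"] by simp
    finally show "norm (complex_of_real (sqrt (\<delta> p) ^ length is * iter_partial is (F p) \<xi>)) \<le> K (length is)"
      unfolding norm_of_real .
  qed
next
  case (add u u')
  then obtain C C' where C: "\<forall>p\<in>S. \<forall>\<xi>. norm \<xi> = 1 \<longrightarrow> norm (\<xi> - \<theta> p) \<le> b * sqrt (\<delta> p) \<longrightarrow> norm (u p \<xi>) \<le> C"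
    "\<forall>p\<in>S. \<forall>\<xi>. norm \<xi> = 1 \<longrightarrow> norm (\<xi> - \<theta> p) \<le> b * sqrt (\<delta> p) \<longrightarrow> norm (u' p \<xi>) \<le> C'" by blast
  show ?case
    by (rule exI[of _ "C + C'"]) (use C in \<open>blast intro: norm_triangle_mono\<close>)
next
  case (mult u u')
  then obtain C C' where C: "\<forall>p\<in>S. \<forall>\<xi>. norm \<xi> = 1 \<longrightarrow> norm (\<xi> - \<theta> p) \<le> b * sqrt (\<delta> p) \<longrightarrow> norm (u p \<xi>) \<le> C"
    "\<forall>p\<in>S. \<forall>\<xi>. norm \<xi> = 1 \<longrightarrow> norm (\<xi> - \<theta> p) \<le> b * sqrt (\<delta> p) \<longrightarrow> norm (u' p \<xi>) \<le> C'" by blast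
  show ?case
  proof (intro exI[of _ "C * C'"] ballI allI impI)
    fix p \<xi> assume "p \<in> S" "norm \<xi> = 1" "norm (\<xi> - \<theta> p) \<le> b * sqrt (\<delta> p)"
    then have "norm (u p \<xi>) \<le> C" "norm (u' p \<xi>) \<le> C'" using C by blast+
    then show "norm (u p \<xi> * u' p \<xi>) \<le> C * C'"
      unfolding norm_mult by (intro mult_mono) (auto intro: order_trans[OF norm_ge_zero])
  qed
qed

text \<open>Smoothness makes each iterated partial derivative differentiable; its derivative is
  linear and therefore determined on the axes, where its values are the iterated partials of the
  next order.\<close>

lemma iter_partial_has_derivative:
  assumes "p \<in> S"
  shows "(iter_partial is (F p) has_derivative (\<lambda>h. \<Sum>i\<in>UNIV. h $ i * iter_partial (i # is) (F p) \<xi>)) (at \<xi>)"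
proof -
  let ?f = "iter_partial is (F p)"
  have "?f differentiable at \<xi>"
    using smooth[OF assms] by (simp add: smooth_def differentiable_on_def)
  then have D: "(?f has_derivative frechet_derivative ?f (at \<xi>)) (at \<xi>)"
    by (simp add: frechet_derivative_works)
  have lin: "linear (frechet_derivative ?f (at \<xi>))" by (rule has_derivative_linear[OF D])
  have "frechet_derivative ?f (at \<xi>) h = (\<Sum>i\<in>UNIV. h $ i * iter_partial (i # is) (F p) \<xi>)" for h
  proof -
    have "h = (\<Sum>i\<in>UNIV. h $ i *\<^sub>R axis i 1)"
      using basis_expansion[of h] by (simp add: scalar_mult_eq_scaleR)
    then have "frechet_derivative ?f (at \<xi>) h = frechet_derivative ?f (at \<xi>) (\<Sum>i\<in>UNIV. h $ i *\<^sub>R axis i 1)"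
      by simp
    then show ?thesis by (simp add: linear_sum[OF lin] linear_scale[OF lin])
  qed
  with D show ?thesis by (metis (no_types, lifting) ext)
qed

lemma symbol_continuous: "symbol u \<Longrightarrow> p \<in> S \<Longrightarrow> continuous_on UNIV (u p)"
proof (induction rule: symbol.induct)
  case (partial "is")
  have "continuous_on UNIV (iter_partial is (F p))"
    by (rule has_derivative_continuous_on[OF has_derivative_at_withinI[OF iter_partial_has_derivative[OF partial]]])
  then show ?case by (intro continuous_intros)
next
  case tangential
  then show ?case using delta(1)[OF tangential] by (intro continuous_intros) auto
qed (intro continuous_intros; simp)+

lemma symbol_zero: "symbol (\<lambda>p \<xi>. 0)"
  by (rule const[of "\<lambda>_. 0" 0]) simp

lemma symbol_sum: "finite I \<Longrightarrow> (\<And>i. i \<in> I \<Longrightarrow> symbol (u i)) \<Longrightarrow> symbol (\<lambda>p \<xi>. \<Sum>i\<in>I. u i p \<xi>)"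
  by (induction rule: finite_induct) (auto intro: symbol_zero symbol.add)

text \<open>Every flow derivative costs exactly one factor \<open>1 / sqrt (\<delta> p)\<close> and
  stays in the class, which is why integration by parts can be repeated. The height is
  differentiated to a tangential coordinate with coefficient
  \<open>\<delta> p * s p * sqrt (\<delta> p)\<close>, which is bounded because
  \<open>\<bar>s p\<bar> \<le> 1 / \<delta> p\<close>.\<close>

lemma symbol_flow_deriv:
  assumes "symbol u"
  shows "\<exists>w. symbol w \<and> (\<forall>p\<in>S. flow_deriv (\<theta> p) (v p) (u p) (\<lambda>\<xi>. w p \<xi> / of_real (sqrt (\<delta> p))))"
  using assms
proof induction
  case (const c C)
  show ?case
    by (rule exI[of _ "\<lambda>p \<xi>. 0"]) (auto intro: symbol_zero flow_deriv_const)
next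
  case normal
  have "symbol (\<lambda>p \<xi>. of_real (- \<delta> p) * of_real ((\<xi> \<bullet> v p) / sqrt (\<delta> p)))"
    by (intro mult tangential const[of _ 1]) (simp add: delta abs_of_pos)
  moreover have "flow_deriv (\<theta> p) (v p) (\<lambda>\<xi>. of_real (\<xi> \<bullet> \<theta> p))
      (\<lambda>\<xi>. of_real (- \<delta> p) * of_real ((\<xi> \<bullet> v p) / sqrt (\<delta> p)) / of_real (sqrt (\<delta> p)))" if "p \<in> S" for p
    using flow_deriv_inner[OF orthonormal[OF that], of "\<theta> p"] orthonormal[OF that] delta[OF that]
    by (simp add: orthonormal_pair_def inner_diff_right inner_commute flip: of_real_mult of_real_divide of_real_minus)
  ultimately show ?case by blast
next
  case tangential
  have "flow_deriv (\<theta> p) (v p) (\<lambda>\<xi>. of_real ((\<xi> \<bullet> v p) / sqrt (\<delta> p)))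
      (\<lambda>\<xi>. of_real (\<xi> \<bullet> \<theta> p) / of_real (sqrt (\<delta> p)))" if "p \<in> S" for p
    using flow_deriv_mult[OF flow_deriv_const[of _ _ "of_real (1 / sqrt (\<delta> p))"] flow_deriv_inner[OF orthonormal[OF that], of "v p"]]
      orthonormal[OF that] delta[OF that]
    by (simp add: orthonormal_pair_def inner_diff_right inner_commute)
  then show ?case using symbol.normal by blast
next
  case height
  have "symbol (\<lambda>p \<xi>. of_real (\<delta> p * s p * sqrt (\<delta> p)) * of_real ((\<xi> \<bullet> v p) / sqrt (\<delta> p)))"
  proof (intro mult symbol.tangential const[of _ 1])
    fix p assume p: "p \<in> S"
    have "\<bar>\<delta> p * s p * sqrt (\<delta> p)\<bar> = \<delta> p * \<bar>s p\<bar> * sqrt (\<delta> p)"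
      using delta[OF p] by (simp add: abs_mult)
    also have "\<dots> \<le> (\<delta> p * (1 / \<delta> p)) * 1"
      using delta[OF p] s[OF p] by (intro mult_mono) auto
    finally show "norm (complex_of_real (\<delta> p * s p * sqrt (\<delta> p))) \<le> 1"
      using delta[OF p] unfolding norm_of_real by simp
  qed
  moreover have "flow_deriv (\<theta> p) (v p) (\<lambda>\<xi>. of_real (sqrt (\<delta> p) * s p * (1 - \<xi> \<bullet> \<theta> p)))
      (\<lambda>\<xi>. of_real (\<delta> p * s p * sqrt (\<delta> p)) * of_real ((\<xi> \<bullet> v p) / sqrt (\<delta> p)) / of_real (sqrt (\<delta> p)))" if p: "p \<in> S" for p
  proof -
    have *: "\<delta> p * s p * sqrt (\<delta> p) * (x / sqrt (\<delta> p)) / sqrt (\<delta> p) = sqrt (\<delta> p) * s p * x" for x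
      using delta(1)[OF p] by (simp add: field_simps) 
    have "((\<lambda>\<xi>. sqrt (\<delta> p) * s p * (1 - \<xi> \<bullet> \<theta> p)) has_derivative (\<lambda>h. - sqrt (\<delta> p) * s p * (h \<bullet> \<theta> p))) (at \<xi>)" for \<xi>
      by (auto intro!: derivative_eq_intros)
    from flow_deriv_differentiable[OF orthonormal[OF p], OF this]
    show ?thesis using orthonormal[OF p]
      unfolding of_real_mult[symmetric] of_real_divide[symmetric] *
      by (simp add: orthonormal_pair_def inner_diff_left inner_commute[of "v p" "\<theta> p"])
  qed
  ultimately show ?case by blast
next
  case (partial "is")
  \<comment> \<open>The chain rule along the generating field \<open>(\<xi> \<bullet> \<theta> p)
    *\<^sub>R v p - (\<xi> \<bullet> v p) *\<^sub>R \<theta> p\<close>, multiplied by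
    \<open>sqrt (\<delta> p)\<close>. The word grows by one letter, and the power of
    \<open>sqrt (\<delta> p)\<close> grows with it.\<close>
  define w :: "'p \<Rightarrow> real^'n \<Rightarrow> complex" where "w p \<xi> = (\<Sum>i\<in>UNIV. (of_real (\<xi> \<bullet> \<theta> p) * of_real (v p $ i)
      + of_real (- sqrt (\<delta> p) * \<theta> p $ i) * of_real ((\<xi> \<bullet> v p) / sqrt (\<delta> p)))
      * of_real (sqrt (\<delta> p) ^ length (i # is) * iter_partial (i # is) (F p) \<xi>))" for p \<xi>
  have comp: "\<bar>v p $ i\<bar> \<le> 1" "\<bar>\<theta> p $ i\<bar> \<le> 1" if "p \<in> S" for p i
    using component_le_norm_cart[of "v p" i] component_le_norm_cart[of "\<theta> p" i] orthonormal[OF that]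
    by (auto simp: orthonormal_pair_def norm_eq_sqrt_inner)
  have "symbol w"
    unfolding w_def
  proof (intro symbol_sum mult add symbol.normal symbol.tangential symbol.partial)
    show "symbol (\<lambda>p \<xi>. of_real (v p $ i))" for i
      by (rule const[of _ 1]) (simp add: comp)
    show "symbol (\<lambda>p \<xi>. of_real (- sqrt (\<delta> p) * \<theta> p $ i))" for i
    proof (rule const[of _ 1])
      fix p assume p: "p \<in> S"
      have "sqrt (\<delta> p) * \<bar>\<theta> p $ i\<bar> \<le> 1 * 1"
        using delta[OF p] comp[OF p] by (intro mult_mono) auto
      then show "norm (complex_of_real (- sqrt (\<delta> p) * \<theta> p $ i)) \<le> 1"
        using delta[OF p] unfolding norm_of_real by (simp add: abs_mult)
    qed
  qed auto
  moreover have "flow_deriv (\<theta> p) (v p) (\<lambda>\<xi>. of_real (sqrt (\<delta> p) ^ length is * iter_partial is (F p) \<xi>))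
      (\<lambda>\<xi>. w p \<xi> / of_real (sqrt (\<delta> p)))" if p: "p \<in> S" for p
  proof -
    have "((\<lambda>\<xi>. sqrt (\<delta> p) ^ length is * iter_partial is (F p) \<xi>) has_derivative
        (\<lambda>h. sqrt (\<delta> p) ^ length is * (\<Sum>i\<in>UNIV. h $ i * iter_partial (i # is) (F p) \<xi>))) (at \<xi>)" for \<xi>
      by (rule has_derivative_mult_right[OF iter_partial_has_derivative[OF p]])
    from flow_deriv_differentiable[OF orthonormal[OF p], OF this]
    have "flow_deriv (\<theta> p) (v p) (\<lambda>\<xi>. of_real (sqrt (\<delta> p) ^ length is * iter_partial is (F p) \<xi>))
      (\<lambda>\<xi>. of_real (sqrt (\<delta> p) ^ length is * (\<Sum>i\<in>UNIV. ((\<xi> \<bullet> \<theta> p) *\<^sub>R v p - (\<xi> \<bullet> v p) *\<^sub>R \<theta> p) $ i * iter_partial (i # is) (F p) \<xi>)))" .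
    moreover have "of_real (sqrt (\<delta> p) ^ length is * (\<Sum>i\<in>UNIV. ((\<xi> \<bullet> \<theta> p) *\<^sub>R v p - (\<xi> \<bullet> v p) *\<^sub>R \<theta> p) $ i * iter_partial (i # is) (F p) \<xi>))
        = w p \<xi> / of_real (sqrt (\<delta> p))" for \<xi>
    proof -
      have "w p \<xi> = of_real (\<Sum>i\<in>UNIV. sqrt (\<delta> p) * (sqrt (\<delta> p) ^ length is * (((\<xi> \<bullet> \<theta> p) *\<^sub>R v p - (\<xi> \<bullet> v p) *\<^sub>R \<theta> p) $ i * iter_partial (i # is) (F p) \<xi>)))"
        unfolding w_def of_real_sum using delta(1)[OF p]
        by (intro sum.cong refl) (simp add: field_simps)
      then show ?thesis using delta(1)[OF p] by (simp add: sum_distrib_left[symmetric])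
    qed
    ultimately show ?thesis by simp
  qed
  ultimately show ?case by blast
next
  case (add u u')
  then obtain w w' where "symbol w" "symbol w'"
    "\<forall>p\<in>S. flow_deriv (\<theta> p) (v p) (u p) (\<lambda>\<xi>. w p \<xi> / of_real (sqrt (\<delta> p)))"
    "\<forall>p\<in>S. flow_deriv (\<theta> p) (v p) (u' p) (\<lambda>\<xi>. w' p \<xi> / of_real (sqrt (\<delta> p)))" by blast
  then show ?case
    by (intro exI[of _ "\<lambda>p \<xi>. w p \<xi> + w' p \<xi>"])
       (auto intro!: symbol.add flow_deriv_add simp: add_divide_distrib)
next
  case (mult u u')
  then obtain w w' where *: "symbol w" "symbol w'"
    "\<forall>p\<in>S. flow_deriv (\<theta> p) (v p) (u p) (\<lambda>\<xi>. w p \<xi> / of_real (sqrt (\<delta> p)))"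
    "\<forall>p\<in>S. flow_deriv (\<theta> p) (v p) (u' p) (\<lambda>\<xi>. w' p \<xi> / of_real (sqrt (\<delta> p)))" by blast
  have "flow_deriv (\<theta> p) (v p) (\<lambda>\<xi>. u p \<xi> * u' p \<xi>) (\<lambda>\<xi>. (u p \<xi> * w' p \<xi> + w p \<xi> * u' p \<xi>) / of_real (sqrt (\<delta> p)))"
    if "p \<in> S" for p
    using flow_deriv_mult[OF *(3)[rule_format, OF that] *(4)[rule_format, OF that]]
    by (simp add: add_divide_distrib)
  then show ?case using * mult.hyps
    by (intro exI[of _ "\<lambda>p \<xi>. u p \<xi> * w' p \<xi> + w p \<xi> * u' p \<xi>"]) (auto intro!: symbol.add symbol.mult)
qed

text \<open>Each integration by parts trades one factor \<open>sqrt (\<delta> p) * s p\<close> for a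
  new amplitude of the same class that vanishes off the same cap. After \<open>k\<close> of them a
  bounded amplitude is integrated over the cap.\<close>

lemma symbol_decay:
  assumes "symbol u"
    and "\<And>p \<xi>. p \<in> S \<Longrightarrow> norm \<xi> = 1 \<Longrightarrow> b * sqrt (\<delta> p) < norm (\<xi> - \<theta> p) \<Longrightarrow> u p \<xi> = 0"
  shows "\<exists>C\<ge>0. \<forall>p\<in>S. (sqrt (\<delta> p) * \<bar>s p\<bar>) ^ k * norm (extension (u p) (\<tau> p *\<^sub>R \<theta> p + s p *\<^sub>R v p))
    \<le> C * measure sphere_measure (sphere 0 1 \<inter> cball (\<theta> p) (b * sqrt (\<delta> p)))"
  using assms
proof (induction k arbitrary: u)
  case 0
  obtain C0 where C0: "\<forall>p\<in>S. \<forall>\<xi>. norm \<xi> = 1 \<longrightarrow> norm (\<xi> - \<theta> p) \<le> b * sqrt (\<delta> p) \<longrightarrow> norm (u p \<xi>) \<le> C0"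
    using symbol_bounded[OF 0(1)] by blast
  define C where "C = max 0 C0"
  have C: "norm (u p \<xi>) \<le> C" if "p \<in> S" "norm \<xi> = 1" "norm (\<xi> - \<theta> p) \<le> b * sqrt (\<delta> p)" for p \<xi>
    using C0 that by (force simp: C_def)
  show ?case
  proof (intro exI[of _ C] conjI ballI)
    show "0 \<le> C" by (simp add: C_def)
    fix p assume p: "p \<in> S"
    let ?x = "\<tau> p *\<^sub>R \<theta> p + s p *\<^sub>R v p"
    let ?B = "sphere 0 1 \<inter> cball (\<theta> p) (b * sqrt (\<delta> p))"
    interpret finite_measure "sphere_measure :: (real^'n) measure" by (rule finite_measure_sphere_measure)
    have B: "?B \<in> sets sphere_measure" by (intro sets_sphere_measure_borel) auto
    have "norm (extension (u p) ?x) \<le> (\<integral>\<xi>. C * indicator ?B \<xi> \<partial>sphere_measure)"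
      unfolding extension_eq
    proof (rule Bochner_Integration.integral_norm_bound_integral)
      show "integrable sphere_measure (\<lambda>\<xi>. u p \<xi> * character ?x \<xi>)"
        by (intro integrable_sphere_continuous continuous_intros symbol_continuous[OF 0(1) p])
      show "integrable sphere_measure (\<lambda>\<xi>. C * indicator ?B \<xi>)"
        using B by (intro integrable_mult_right integrable_real_indicator) (auto simp: less_top[symmetric])
      fix \<xi> :: "real^'n" assume "\<xi> \<in> space sphere_measure"
      then have \<xi>: "norm \<xi> = 1" by simp
      show "norm (u p \<xi> * character ?x \<xi>) \<le> C * indicator ?B \<xi>"
        using C[OF p \<xi>] 0(2)[OF p \<xi>] \<xi> by (auto simp: norm_mult indicator_def dist_norm norm_minus_commute)
    qed
    then show "(sqrt (\<delta> p) * \<bar>s p\<bar>) ^ 0 * norm (extension (u p) ?x) \<le> C * measure sphere_measure ?B"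
      using B by (simp add: Int_absorb2 inf_commute inf_left_commute)
  qed
next
  case (Suc k)
  obtain w where w: "symbol w" "\<And>p. p \<in> S \<Longrightarrow> flow_deriv (\<theta> p) (v p) (u p) (\<lambda>\<xi>. w p \<xi> / of_real (sqrt (\<delta> p)))"
    using symbol_flow_deriv[OF Suc.prems(1)] by blast
  \<comment> \<open>The amplitude produced by \<open>extension_integration_by_parts\<close>,
    multiplied by \<open>sqrt (\<delta> p)\<close> and arranged as products of bounded factors;
    \<open>\<tau> p * \<delta> p\<close> is one of them because
    \<open>\<bar>\<tau> p\<bar> \<le> 1 / \<delta> p\<close>.\<close>
  define u' where "u' p \<xi> = of_real 1 / (2 * of_real pi * \<i>) * w p \<xi>
      + (of_real (\<tau> p * \<delta> p) * of_real ((\<xi> \<bullet> v p) / sqrt (\<delta> p)) + of_real (sqrt (\<delta> p) * s p * (1 - \<xi> \<bullet> \<theta> p))) * u p \<xi>" for p \<xi>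
  have "symbol u'" unfolding u'_def
  proof (intro symbol.add symbol.mult w(1) Suc.prems(1) symbol.tangential symbol.height)
    show "symbol (\<lambda>p \<xi>. of_real 1 / (2 * of_real pi * \<i>))" by (rule symbol.const) auto
    show "symbol (\<lambda>p \<xi>. of_real (\<tau> p * \<delta> p))"
    proof (rule symbol.const[of _ 1])
      fix p assume p: "p \<in> S"
      show "norm (complex_of_real (\<tau> p * \<delta> p)) \<le> 1"
        using \<tau>[OF p] delta[OF p] unfolding norm_of_real by (simp add: abs_mult field_simps)
    qed
  qed
  \<comment> \<open>The strict inequality describes an open set. Thus \<open>u p\<close> vanishes
    along the orbit for all times near 0, and its flow derivative at \<open>\<xi>\<close> is zero as
    well.\<close>
  moreover have "u' p \<xi> = 0" if p: "p \<in> S" and \<xi>: "norm \<xi> = 1" "b * sqrt (\<delta> p) < norm (\<xi> - \<theta> p)" for p \<xi>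
  proof -
    let ?Q = "\<lambda>t. plane_rotation (\<theta> p) (v p) t \<xi>"
    have "continuous (at 0) ?Q"
      by (rule has_vector_derivative_continuous[OF plane_rotation_has_vector_derivative[OF orthonormal[OF p]]])
    then have "((\<lambda>t. norm (?Q t - \<theta> p)) \<longlongrightarrow> norm (?Q 0 - \<theta> p)) (at 0)"
      by (intro tendsto_intros) (simp add: continuous_at)
    then have "\<forall>\<^sub>F t in at 0. b * sqrt (\<delta> p) < norm (?Q t - \<theta> p)"
      using \<xi> by (intro order_tendstoD) auto
    then have ev: "\<forall>\<^sub>F t in at 0. u p (?Q t) = 0"
    proof (rule eventually_mono)
      fix t assume "b * sqrt (\<delta> p) < norm (?Q t - \<theta> p)"
      then show "u p (?Q t) = 0"
        using Suc.prems(2)[OF p] orthogonal_transformation_norm[OF orthogonal_transformation_plane_rotation[OF orthonormal[OF p]]] \<xi>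
        by metis
    qed
    have u0: "u p \<xi> = 0" using Suc.prems(2)[OF p \<xi>] .
    have D: "((\<lambda>t. u p (?Q t)) has_vector_derivative w p \<xi> / of_real (sqrt (\<delta> p))) (at 0)"
      using w(2)[OF p, unfolded flow_deriv_def, rule_format, of \<xi> 0] by simp
    have "((\<lambda>t. 0) has_vector_derivative w p \<xi> / of_real (sqrt (\<delta> p))) (at 0)"
      using D ev u0 unfolding has_vector_derivative_def
      by (elim has_derivative_transform_eventually) auto
    then have "w p \<xi> / of_real (sqrt (\<delta> p)) = 0"
      using has_vector_derivative_const vector_derivative_unique_at by metis
    then show ?thesis using u0 delta(1)[OF p] by (simp add: u'_def)
  qed
  ultimately obtain C where C: "C \<ge> 0" "\<forall>p\<in>S. (sqrt (\<delta> p) * \<bar>s p\<bar>) ^ k * norm (extension (u' p) (\<tau> p *\<^sub>R \<theta> p + s p *\<^sub>R v p))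
    \<le> C * measure sphere_measure (sphere 0 1 \<inter> cball (\<theta> p) (b * sqrt (\<delta> p)))"
    using Suc.IH[of u'] by blast
  have step: "(sqrt (\<delta> p) * \<bar>s p\<bar>) * norm (extension (u p) (\<tau> p *\<^sub>R \<theta> p + s p *\<^sub>R v p))
     = norm (extension (u' p) (\<tau> p *\<^sub>R \<theta> p + s p *\<^sub>R v p))" if p: "p \<in> S" for p
  proof -
    let ?x = "\<tau> p *\<^sub>R \<theta> p + s p *\<^sub>R v p"
    let ?g = "\<lambda>\<xi>. w p \<xi> / of_real (sqrt (\<delta> p)) / (2 * of_real pi * \<i>)
        + of_real ((\<xi> \<bullet> v p) * \<tau> p + s p * (1 - \<xi> \<bullet> \<theta> p)) * u p \<xi>"
    have "of_real (s p) * extension (u p) ?x = extension ?g ?x"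
      by (rule extension_integration_by_parts[OF orthonormal[OF p] w(2)[OF p]])
         (use delta(1)[OF p] symbol_continuous[OF w(1) p] symbol_continuous[OF Suc.prems(1) p] in
           \<open>auto intro!: continuous_intros\<close>)
    then have "of_real (sqrt (\<delta> p) * s p) * extension (u p) ?x = of_real (sqrt (\<delta> p)) * extension ?g ?x"
      by simp
    also have "\<dots> = extension (\<lambda>\<xi>. of_real (sqrt (\<delta> p)) * ?g \<xi>) ?x"
      unfolding extension_eq mult.assoc by (rule integral_mult_right_zero[symmetric])
    also have "(\<lambda>\<xi>. of_real (sqrt (\<delta> p)) * ?g \<xi>) = u' p"
    proof (rule ext)
      fix \<xi>
      define r where "r = sqrt (\<delta> p)"
      have r: "0 < r" "\<delta> p = r * r" using delta(1)[OF p] by (auto simp: r_def)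
      have "of_real r * ?g \<xi> = w p \<xi> / (2 * of_real pi * \<i>)
          + of_real (r * ((\<xi> \<bullet> v p) * \<tau> p + s p * (1 - \<xi> \<bullet> \<theta> p))) * u p \<xi>"
        using r by (simp add: r_def[symmetric] distrib_left mult.assoc)
      also have "r * ((\<xi> \<bullet> v p) * \<tau> p + s p * (1 - \<xi> \<bullet> \<theta> p))
          = \<tau> p * \<delta> p * ((\<xi> \<bullet> v p) / r) + r * s p * (1 - \<xi> \<bullet> \<theta> p)"
        using r(1) unfolding r(2) by (simp add: field_simps)
      finally show "of_real (sqrt (\<delta> p)) * ?g \<xi> = u' p \<xi>"
        unfolding u'_def r_def[symmetric] by simp
    qed
    finally have "norm (of_real (sqrt (\<delta> p) * s p) * extension (u p) ?x) = norm (extension (u' p) ?x)"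
      by simp
    then show ?thesis using delta(1)[OF p] by (simp add: norm_mult abs_mult)
  qed
  then show ?case
    unfolding power_Suc2 mult.assoc[of "_ ^ k"] using C by (intro exI[of _ C]) (simp add: step)
qed

lemma bump_decay:
  "\<exists>C\<ge>0. \<forall>p\<in>S. (sqrt (\<delta> p) * \<bar>s p\<bar>) ^ k * norm (extension (\<lambda>\<xi>. of_real (F p \<xi>)) (\<tau> p *\<^sub>R \<theta> p + s p *\<^sub>R v p))
    \<le> C * measure sphere_measure (sphere 0 1 \<inter> cball (\<theta> p) (b * sqrt (\<delta> p)))"
  using symbol_decay[of "\<lambda>p \<xi>. of_real (F p \<xi>)" k] symbol.partial[of "[]"] support by simp

end

subsection \<open>Volumes of tubes and caps\<close>

text \<open>A rotation that takes a coordinate axis to \<open>\<theta>\<close> preserves both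
  quantities in \<open>P\<close> and Lebesgue measure. Tubes can then be compared with coordinate
  boxes.\<close>

lemma emeasure_lborel_axial:
  fixes \<theta> :: "real^'n"
  assumes \<theta>: "norm \<theta> = 1"
    and S: "{x. P (x \<bullet> \<theta>) (norm (x - (x \<bullet> \<theta>) *\<^sub>R \<theta>))} \<in> sets borel"
  shows "emeasure lborel {x. P (x \<bullet> \<theta>) (norm (x - (x \<bullet> \<theta>) *\<^sub>R \<theta>))}
    = emeasure lborel {y :: real^'n. P (y $ k) (norm (y - (y $ k) *\<^sub>R axis k 1))}"
proof -
  let ?S = "{x. P (x \<bullet> \<theta>) (norm (x - (x \<bullet> \<theta>) *\<^sub>R \<theta>))}"
  obtain Q :: "real^'n \<Rightarrow> real^'n" where Q: "orthogonal_transformation Q" "Q (axis k 1) = \<theta>"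
    using orthogonal_transformation_exists_1[OF norm_axis_1 \<theta>] by metis
  have lin: "linear Q" by (rule orthogonal_transformation_linear[OF Q(1)])
  have [measurable]: "Q \<in> borel \<rightarrow>\<^sub>M borel"
    using lin by (intro borel_measurable_continuous_onI) (simp add: linear_continuous_on linear_conv_bounded_linear)
  have i: "Q y \<bullet> \<theta> = y $ k" for y
    using Q unfolding orthogonal_transformation_def by (metis inner_axis inner_real_def mult.right_neutral)
  have "Q y - (y $ k) *\<^sub>R \<theta> = Q (y - (y $ k) *\<^sub>R axis k 1)" for y
    using Q(2) by (simp add: linear_diff[OF lin] linear_scale[OF lin])
  then have n: "norm (Q y - (y $ k) *\<^sub>R \<theta>) = norm (y - (y $ k) *\<^sub>R axis k 1)" for y
    by (simp only: orthogonal_transformation_norm[OF Q(1)])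
  have "emeasure lborel ?S = emeasure (distr lborel borel Q) ?S"
    by (simp only: lborel_distr_orthogonal[OF Q(1)])
  also have "\<dots> = emeasure lborel (Q -` ?S)"
    using S by (subst emeasure_distr) auto
  also have "Q -` ?S = {y. P (y $ k) (norm (y - (y $ k) *\<^sub>R axis k 1))}"
    by (auto simp: i n)
  finally show ?thesis .
qed

lemma emeasure_lborel_cbox_cart:
  fixes l u :: "real^'n"
  assumes "\<And>i. l $ i \<le> u $ i"
  shows "emeasure lborel (cbox l u) = ennreal (\<Prod>i\<in>UNIV. u $ i - l $ i)"
proof -
  have "emeasure lborel (cbox l u) = ennreal (measure lborel (cbox l u))"
    using emeasure_lborel_cbox_finite[of l u] by (intro emeasure_eq_ennreal_measure) auto
  also have "measure lborel (cbox l u) = (\<Prod>i\<in>UNIV. u $ i - l $ i)"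
    by (rule content_cbox_cart) (use assms in \<open>auto simp: interval_ne_empty_cart interval_eq_empty_cart not_less\<close>)
  finally show ?thesis .
qed

lemma prod_if_singleton:
  fixes c d :: real
  shows "(\<Prod>i\<in>(UNIV::'n::finite set). if i = k then c else d) = c * d ^ (CARD('n) - 1)"
  by (subst prod.remove[of _ k]) (auto intro!: prod.cong simp: card_Diff_singleton)

lemma emeasure_tube_le:
  fixes \<theta> :: "real^'n"
  assumes \<theta>: "norm \<theta> = 1" and "0 \<le> l" "0 \<le> \<rho>"
  shows "emeasure lborel {x. \<bar>x \<bullet> \<theta>\<bar> \<le> l \<and> norm (x - (x \<bullet> \<theta>) *\<^sub>R \<theta>) \<le> \<rho>}
    \<le> ennreal (2 ^ CARD('n) * l * \<rho> ^ (CARD('n) - 1))"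
proof -
  obtain k :: 'n where True by blast
  define c :: "real^'n" where "c = (\<chi> i. if i = k then l else \<rho>)"
  have "emeasure lborel {x. \<bar>x \<bullet> \<theta>\<bar> \<le> l \<and> norm (x - (x \<bullet> \<theta>) *\<^sub>R \<theta>) \<le> \<rho>}
      = emeasure lborel {y :: real^'n. \<bar>y $ k\<bar> \<le> l \<and> norm (y - (y $ k) *\<^sub>R axis k 1) \<le> \<rho>}"
    by (rule emeasure_lborel_axial[OF \<theta>]) measurable
  also have "\<dots> \<le> emeasure lborel (cbox (- c) c)"
  proof (rule emeasure_mono, rule subsetI)
    fix y :: "real^'n" assume "y \<in> {y. \<bar>y $ k\<bar> \<le> l \<and> norm (y - (y $ k) *\<^sub>R axis k 1) \<le> \<rho>}"
    then have y: "\<bar>y $ k\<bar> \<le> l" "norm (y - (y $ k) *\<^sub>R axis k 1) \<le> \<rho>" by auto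
    have "\<bar>y $ i\<bar> \<le> c $ i" for i
      using y component_le_norm_cart[of "y - (y $ k) *\<^sub>R axis k 1" i]
      by (cases "i = k") (auto simp: c_def axis_def)
    then show "y \<in> cbox (- c) c" by (auto simp: mem_box_cart abs_le_iff minus_le_iff)
  qed simp
  also have "\<dots> = ennreal (\<Prod>i\<in>UNIV. c $ i - (- c) $ i)"
    using assms by (intro emeasure_lborel_cbox_cart) (auto simp: c_def)
  also have "(\<Prod>i\<in>UNIV. c $ i - (- c) $ i) = (\<Prod>i\<in>UNIV. if i = k then 2 * l else 2 * \<rho>)"
    by (intro prod.cong) (auto simp: c_def)
  also have "\<dots> = 2 * 2 ^ (CARD('n) - 1) * l * \<rho> ^ (CARD('n) - 1)"
    by (simp add: prod_if_singleton power_mult_distrib)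
  also have "2 * 2 ^ (CARD('n) - 1) = (2::real) ^ CARD('n)"
    by (metis power_minus_mult zero_less_card_finite mult.commute)
  finally show ?thesis .
qed

text \<open>Restricting the axial coordinate to the interval from 1/4 to 3/4 keeps thin tubes inside
  the unit ball and away from the origin, as the cone over a cap requires.\<close>

lemma emeasure_tube_ge:
  fixes \<theta> :: "real^'n"
  assumes \<theta>: "norm \<theta> = 1" and "0 \<le> \<rho>"
  shows "ennreal (1 / 2 * (2 * \<rho> / CARD('n)) ^ (CARD('n) - 1))
    \<le> emeasure lborel {x. (1 / 4 \<le> x \<bullet> \<theta> \<and> x \<bullet> \<theta> \<le> 3 / 4) \<and> norm (x - (x \<bullet> \<theta>) *\<^sub>R \<theta>) \<le> \<rho>}"
proof -
  obtain k :: 'n where True by blast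
  \<comment> \<open>With this half-width the sum of the absolute values of the transverse
    coordinates, and hence their Euclidean norm, is at most \<open>\<rho>\<close>.\<close>
  define r where "r = \<rho> / CARD('n)"
  have r: "0 \<le> r" using assms by (simp add: r_def)
  define l u :: "real^'n" where "l = (\<chi> i. if i = k then 1/4 else - r)"
    and "u = (\<chi> i. if i = k then 3/4 else r)"
  have "(\<Prod>i\<in>UNIV. u $ i - l $ i) = (\<Prod>i\<in>UNIV. if i = k then 1/2 else 2 * r)"
    by (intro prod.cong) (auto simp: l_def u_def)
  then have "ennreal (1 / 2 * (2 * \<rho> / CARD('n)) ^ (CARD('n) - 1)) = ennreal (\<Prod>i\<in>UNIV. u $ i - l $ i)"
    unfolding r_def by (simp only: prod_if_singleton) (simp add: mult.commute)
  also have "\<dots> = emeasure lborel (cbox l u)"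
    using r by (intro emeasure_lborel_cbox_cart[symmetric]) (auto simp: l_def u_def)
  also have "\<dots> \<le> emeasure lborel {y :: real^'n. (1/4 \<le> y $ k \<and> y $ k \<le> 3/4) \<and> norm (y - (y $ k) *\<^sub>R axis k 1) \<le> \<rho>}"
  proof (rule emeasure_mono, rule subsetI)
    fix y assume "y \<in> cbox l u"
    then have y: "l $ i \<le> y $ i" "y $ i \<le> u $ i" for i by (auto simp: mem_box_cart)
    have "norm (y - (y $ k) *\<^sub>R axis k 1) \<le> (\<Sum>i\<in>UNIV. \<bar>(y - (y $ k) *\<^sub>R axis k 1) $ i\<bar>)"
      by (rule norm_le_l1_cart)
    also have "\<dots> \<le> (\<Sum>i\<in>(UNIV::'n set). r)"
    proof (rule sum_mono)
      fix i
      show "\<bar>(y - (y $ k) *\<^sub>R axis k 1) $ i\<bar> \<le> r"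
        using y[of i] r by (cases "i = k") (auto simp: l_def u_def axis_def)
    qed
    also have "\<dots> = \<rho>" by (simp add: r_def)
    finally show "y \<in> {y. (1/4 \<le> y $ k \<and> y $ k \<le> 3/4) \<and> norm (y - (y $ k) *\<^sub>R axis k 1) \<le> \<rho>}"
      using y[of k] by (auto simp: l_def u_def)
  qed measurable
  also have "\<dots> = emeasure lborel {x. (1/4 \<le> x \<bullet> \<theta> \<and> x \<bullet> \<theta> \<le> 3/4) \<and> norm (x - (x \<bullet> \<theta>) *\<^sub>R \<theta>) \<le> \<rho>}"
    by (rule emeasure_lborel_axial[OF \<theta>, symmetric]) measurable
  finally show ?thesis .
qed

text \<open>In polar coordinates: the cone over the cap lies in a tube of half-length 1 and radius
  \<open>\<rho>\<close>.\<close>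

lemma cap_measure_le:
  fixes \<theta> :: "real^'n" and \<rho> :: real
  assumes \<theta>: "norm \<theta> = 1" and \<rho>: "0 \<le> \<rho>"
  shows "measure sphere_measure (sphere 0 1 \<inter> cball \<theta> \<rho>) \<le> CARD('n) * 2 ^ CARD('n) * \<rho> ^ (CARD('n) - 1)"
proof -
  have "emeasure sphere_measure (sphere 0 1 \<inter> cball \<theta> \<rho>)
      = of_nat DIM(real^'n) * emeasure lborel {y \<in> ball 0 1 - {0}. y /\<^sub>R norm y \<in> sphere 0 1 \<inter> cball \<theta> \<rho>}"
    by (rule emeasure_sphere_measure) auto
  also have "\<dots> \<le> of_nat DIM(real^'n) * emeasure lborel {x. \<bar>x \<bullet> \<theta>\<bar> \<le> 1 \<and> norm (x - (x \<bullet> \<theta>) *\<^sub>R \<theta>) \<le> \<rho>}"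
  proof (intro mult_left_mono emeasure_mono subsetI)
    fix y assume "y \<in> {y \<in> ball 0 1 - {0}. y /\<^sub>R norm y \<in> sphere 0 1 \<inter> cball \<theta> \<rho>}"
    then have y: "norm y < 1" "y \<noteq> 0" "norm (y /\<^sub>R norm y - \<theta>) \<le> \<rho>"
      by (auto simp: dist_norm norm_minus_commute)
    define \<xi> where "\<xi> = y /\<^sub>R norm y"
    have y\<xi>: "y = norm y *\<^sub>R \<xi>" using y by (simp add: \<xi>_def)
    have "\<bar>y \<bullet> \<theta>\<bar> \<le> 1"
      using Cauchy_Schwarz_ineq2[of y \<theta>] \<theta> y by simp
    moreover have "y - (y \<bullet> \<theta>) *\<^sub>R \<theta> = norm y *\<^sub>R ((\<xi> - \<theta>) - ((\<xi> - \<theta>) \<bullet> \<theta>) *\<^sub>R \<theta>)"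
      using \<theta> by (subst (1 2) y\<xi>) (simp add: inner_diff_left norm_eq_1 algebra_simps)
    then have "norm (y - (y \<bullet> \<theta>) *\<^sub>R \<theta>) = norm y * norm ((\<xi> - \<theta>) - ((\<xi> - \<theta>) \<bullet> \<theta>) *\<^sub>R \<theta>)" by simp
    moreover have "\<dots> \<le> 1 * \<rho>"
      using norm_perp_le(1)[OF \<theta>, of "\<xi> - \<theta>"] y by (intro mult_mono) (auto simp: \<xi>_def)
    ultimately show "y \<in> {x. \<bar>x \<bullet> \<theta>\<bar> \<le> 1 \<and> norm (x - (x \<bullet> \<theta>) *\<^sub>R \<theta>) \<le> \<rho>}" by simp
  qed auto
  also have "\<dots> \<le> of_nat DIM(real^'n) * ennreal (2 ^ CARD('n) * 1 * \<rho> ^ (CARD('n) - 1))"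
    by (intro mult_left_mono emeasure_tube_le \<theta> \<rho>) auto
  also have "\<dots> = ennreal (CARD('n) * 2 ^ CARD('n) * \<rho> ^ (CARD('n) - 1))"
    using \<rho> by (simp add: ennreal_mult ennreal_of_nat_eq_real_of_nat mult.assoc)
  finally show ?thesis
    using \<rho> by (simp add: measure_def enn2real_leI)
qed

text \<open>The cone over the cap contains a truncated tube of radius \<open>\<rho> / 16\<close>: at
  distance at least 1/4 from the origin, the direction of such a point differs from
  \<open>\<theta>\<close> by at most
  \<open>2 * (\<rho> / 16) / (1 / 4) = \<rho> / 2\<close>.\<close>

lemma cap_measure_ge:
  fixes \<theta> :: "real^'n" and \<rho> :: real
  assumes \<theta>: "norm \<theta> = 1" and \<rho>: "0 < \<rho>" "\<rho> \<le> 1"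
  shows "CARD('n) / 2 * (1 / (8 * CARD('n))) ^ (CARD('n) - 1) * \<rho> ^ (CARD('n) - 1)
    \<le> measure sphere_measure (cap \<theta> \<rho>)"
proof -
  interpret finite_measure "sphere_measure :: (real^'n) measure" by (rule finite_measure_sphere_measure)
  let ?T = "{x. (1 / 4 \<le> x \<bullet> \<theta> \<and> x \<bullet> \<theta> \<le> 3 / 4) \<and> norm (x - (x \<bullet> \<theta>) *\<^sub>R \<theta>) \<le> \<rho> / 16}"
  have sub: "?T \<subseteq> {y \<in> ball 0 1 - {0}. y /\<^sub>R norm y \<in> cap \<theta> \<rho>}"
  proof
    fix y assume y: "y \<in> ?T"
    define t w where "t = y \<bullet> \<theta>" and "w = y - t *\<^sub>R \<theta>"
    have t: "1/4 \<le> t" "t \<le> 3/4" and w: "norm w \<le> \<rho> / 16" using y by (auto simp: t_def w_def)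
    have "norm y \<le> norm (t *\<^sub>R \<theta>) + norm w" using norm_triangle_ineq[of "t *\<^sub>R \<theta>" w] by (simp add: w_def)
    then have n1: "norm y \<le> t + norm w" using t \<theta> by simp
    have n2: "t \<le> norm y" using Cauchy_Schwarz_ineq2[of y \<theta>] \<theta> by (simp add: t_def)
    have n3: "norm y < 1" using n1 t w \<rho> by simp
    have n0: "0 < norm y" using n2 t by linarith
    have "norm (y /\<^sub>R norm y - \<theta>) = norm (y - norm y *\<^sub>R \<theta>) / norm y"
    proof -
      have "y /\<^sub>R norm y - \<theta> = (1 / norm y) *\<^sub>R (y - norm y *\<^sub>R \<theta>)"
        using n0 by (simp add: scaleR_diff_right divide_inverse)
      then show ?thesis using n0 by (simp add: divide_inverse mult.commute)
    qed
    also have "y - norm y *\<^sub>R \<theta> = w + (t - norm y) *\<^sub>R \<theta>"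
      by (simp add: w_def algebra_simps)
    also have "norm (w + (t - norm y) *\<^sub>R \<theta>) \<le> norm w + norm w"
      using norm_triangle_ineq[of w "(t - norm y) *\<^sub>R \<theta>"] n1 n2 \<theta> by simp
    also have "(norm w + norm w) / norm y \<le> (\<rho> / 16 + \<rho> / 16) / (1 / 4)"
      using w n2 t n0 \<rho> by (intro frac_le) auto
    also have "\<dots> < \<rho>" using \<rho> by simp
    finally have "norm (y /\<^sub>R norm y - \<theta>) < \<rho>" using n0 by (simp add: divide_right_mono)
    then show "y \<in> {y \<in> ball 0 1 - {0}. y /\<^sub>R norm y \<in> cap \<theta> \<rho>}"
      using n0 n3 by (auto simp: cap_def dist_norm norm_minus_commute)
  qed
  have "ennreal (CARD('n) / 2 * (1 / (8 * CARD('n))) ^ (CARD('n) - 1) * \<rho> ^ (CARD('n) - 1))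
      = of_nat DIM(real^'n) * ennreal (1 / 2 * (2 * (\<rho> / 16) / CARD('n)) ^ (CARD('n) - 1))"
    using \<rho> by (simp add: ennreal_of_nat_eq_real_of_nat power_divide power_mult_distrib field_simps flip: ennreal_mult)
  also have "\<dots> \<le> of_nat DIM(real^'n) * emeasure lborel ?T"
    using \<rho> by (intro mult_left_mono emeasure_tube_ge \<theta>) auto
  also have "\<dots> \<le> of_nat DIM(real^'n) * emeasure lborel {y \<in> ball 0 1 - {0}. y /\<^sub>R norm y \<in> cap \<theta> \<rho>}"
  proof (intro mult_left_mono emeasure_mono sub)
    have [measurable]: "cap \<theta> \<rho> \<in> sets borel" by (auto simp: cap_def)
    show "{y \<in> ball 0 1 - {0}. y /\<^sub>R norm y \<in> cap \<theta> \<rho>} \<in> sets lborel" by measurable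
  qed auto
  also have "\<dots> = emeasure sphere_measure (cap \<theta> \<rho>)"
    by (rule emeasure_sphere_measure[symmetric]) (auto simp: cap_def)
  also have "\<dots> = ennreal (measure sphere_measure (cap \<theta> \<rho>))"
    by (rule emeasure_eq_measure)
  finally show ?thesis by (simp add: ennreal_le_iff)
qed

subsection \<open>Overlap of tubes through the origin\<close>

text \<open>For a unit vector \<open>\<theta>\<close>, the distance of \<open>x\<close> from the
  line spanned by \<open>\<theta>\<close>; its sublevel sets are the infinite tubes through the
  origin.\<close>

definition perp :: "'a::euclidean_space \<Rightarrow> 'a \<Rightarrow> real" where
  "perp \<theta> x = norm (x - (x \<bullet> \<theta>) *\<^sub>R \<theta>)"

lemma perp_nonneg [simp]: "0 \<le> perp \<theta> x"
  by (simp add: perp_def)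

lemma continuous_perp [continuous_intros]: "continuous_on A (perp \<theta>)"
  unfolding perp_def by (intro continuous_intros)

lemma measurable_perp [measurable]: "perp \<theta> \<in> borel_measurable borel"
  by (intro borel_measurable_continuous_onI continuous_intros)

text \<open>With \<open>c = \<theta> \<bullet> \<xi>\<close> the squared distance to the line is
  \<open>(1 - c) * (1 + c)\<close>, and one of these factors is at least 1. Both signs occur because
  a line does not distinguish its two directions.\<close>

lemma dist_direction_le_perp:
  fixes \<theta> \<xi> :: "'a::euclidean_space"
  assumes "norm \<theta> = 1" "norm \<xi> = 1"
  shows "norm (\<xi> - \<theta>) \<le> 2 * perp \<xi> \<theta> \<or> norm (\<xi> + \<theta>) \<le> 2 * perp \<xi> \<theta>"
proof -
  let ?c = "\<theta> \<bullet> \<xi>"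
  have c: "\<bar>?c\<bar> \<le> 1" using Cauchy_Schwarz_ineq2[of \<theta> \<xi>] assms by simp
  have p: "(perp \<xi> \<theta>)\<^sup>2 = (1 - ?c) * (1 + ?c)"
    using norm_perp_le(2)[OF assms(2), of \<theta>] assms by (simp add: perp_def power2_eq_square algebra_simps)
  have m: "(norm (\<xi> - \<theta>))\<^sup>2 = 2 * (1 - ?c)" "(norm (\<xi> + \<theta>))\<^sup>2 = 2 * (1 + ?c)"
    using assms unfolding power2_norm_eq_inner
    by (simp_all add: inner_diff_left inner_diff_right inner_add_left inner_add_right inner_commute norm_eq_1)
  show ?thesis
  proof (cases "0 \<le> ?c")
    case True
    then have "1 - ?c \<le> (1 - ?c) * (1 + ?c)" using c by (simp add: algebra_simps mult_left_le)
    then have "(norm (\<xi> - \<theta>))\<^sup>2 \<le> (2 * perp \<xi> \<theta>)\<^sup>2"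
      using c unfolding m power_mult_distrib p by simp
    then have "norm (\<xi> - \<theta>) \<le> 2 * perp \<xi> \<theta>" by (rule power2_le_imp_le) simp
    then show ?thesis ..
  next
    case False
    then have "0 \<le> - ?c * (1 + ?c)" using c by (intro mult_nonneg_nonneg) auto
    then have "1 + ?c \<le> (1 - ?c) * (1 + ?c)" by (simp add: algebra_simps)
    then have "(norm (\<xi> + \<theta>))\<^sup>2 \<le> (2 * perp \<xi> \<theta>)\<^sup>2"
      using c unfolding m power_mult_distrib p by simp
    then have "norm (\<xi> + \<theta>) \<le> 2 * perp \<xi> \<theta>" by (rule power2_le_imp_le) simp
    then show ?thesis ..
  qed
qed

lemma perp_scale: "perp \<theta> (c *\<^sub>R x) = \<bar>c\<bar> * perp \<theta> x"
proof -
  have "c *\<^sub>R x - ((c *\<^sub>R x) \<bullet> \<theta>) *\<^sub>R \<theta> = c *\<^sub>R (x - (x \<bullet> \<theta>) *\<^sub>R \<theta>)"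
    by (simp add: scaleR_diff_right)
  then show ?thesis by (simp add: perp_def)
qed

text \<open>The tangent inequality summed with the weights \<open>w\<close>, the point of tangency
  being the weighted mean \<open>U / W\<close>.\<close>

lemma sum_powr_Jensen:
  fixes w y :: "'i \<Rightarrow> real"
  assumes "finite I" "1 \<le> p" "\<And>i. i \<in> I \<Longrightarrow> 0 \<le> w i" "\<And>i. i \<in> I \<Longrightarrow> 0 \<le> y i"
  shows "(\<Sum>i\<in>I. y i * w i) powr p \<le> (\<Sum>i\<in>I. w i) powr (p - 1) * (\<Sum>i\<in>I. y i powr p * w i)"
proof -
  define W U where "W = (\<Sum>i\<in>I. w i)" and "U = (\<Sum>i\<in>I. y i * w i)"
  have W0: "0 \<le> W" and U0: "0 \<le> U" unfolding W_def U_def using assms by (auto intro!: sum_nonneg)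
  show ?thesis
  proof (cases "U = 0")
    case True
    then show ?thesis unfolding U_def[symmetric]
      using assms by (auto intro!: mult_nonneg_nonneg sum_nonneg)
  next
    case False
    have "W \<noteq> 0"
    proof
      assume "W = 0"
      then have "\<forall>i\<in>I. w i = 0" unfolding W_def using assms by (simp add: sum_nonneg_eq_0_iff)
      then have "U = 0" by (simp add: U_def)
      with False show False ..
    qed
    with W0 U0 False have pos: "0 < W" "0 < U" by auto
    let ?m = "U / W"
    have m: "0 < ?m" using pos by simp
    have "p * ?m powr (p - 1) * U = (\<Sum>i\<in>I. (p * ?m powr (p - 1) * y i) * w i)"
      unfolding U_def by (simp add: sum_distrib_left mult.assoc)
    also have "\<dots> \<le> (\<Sum>i\<in>I. (y i powr p + (p - 1) * ?m powr p) * w i)"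
      by (intro sum_mono mult_right_mono powr_tangent_le assms m) auto
    also have "\<dots> = (\<Sum>i\<in>I. y i powr p * w i) + (p - 1) * ?m powr p * W"
      unfolding W_def by (simp add: distrib_right sum.distrib sum_distrib_left)
    also have "?m powr p * W = ?m powr (p - 1) * U"
      using pos powr_add[of ?m "p - 1" 1] by simp
    then have "(p - 1) * ?m powr p * W = (p - 1) * (?m powr (p - 1) * U)" by simp
    finally have "?m powr (p - 1) * U \<le> (\<Sum>i\<in>I. y i powr p * w i)" by (simp add: algebra_simps)
    then have "W powr (p - 1) * (?m powr (p - 1) * U) \<le> W powr (p - 1) * (\<Sum>i\<in>I. y i powr p * w i)"
      by (intro mult_left_mono) auto
    also have "W powr (p - 1) * (?m powr (p - 1) * U) = U powr (p - 1) * U"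
      using pos by (simp add: powr_mult[symmetric] mult.assoc[symmetric])
    also have "\<dots> = U powr p" using pos powr_add[of U "p - 1" 1] by simp
    finally show ?thesis by (simp add: W_def U_def)
  qed
qed

lemma ennreal_double_sum:
  fixes f :: "'i \<Rightarrow> 'j \<Rightarrow> real"
  assumes "\<And>i j. 0 \<le> f i j"
  shows "ennreal (\<Sum>i\<in>A. \<Sum>j\<in>B. f i j) = (\<Sum>i\<in>A. \<Sum>j\<in>B. ennreal (f i j))"
  using assms by (simp add: sum_nonneg)

lemma geometric_le_2:
  fixes z :: real
  assumes "0 \<le> z" "z \<le> 1 / 2"
  shows "(\<Sum>j\<le>m. z ^ j) \<le> 2"
proof -
  have "(\<Sum>j\<le>m. z ^ j) \<le> (\<Sum>j\<le>m. (1 / 2) ^ j)"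
    using assms by (intro sum_mono power_mono) auto
  also have "\<dots> = 2 - (1/2) ^ m"
    by (induction m) auto
  also have "\<dots> \<le> 2" by simp
  finally show ?thesis .
qed

text \<open>A step function comparable, for \<open>perp \<theta> x\<close> up to the order of
  \<open>2 ^ J * D\<close>, to the power \<open>- 2 * n\<close> of
  \<open>1 + perp \<theta> x / D\<close>. This is the square of decay of order n away from the tube
  of radius \<open>D\<close>.\<close>

definition envelope :: "nat \<Rightarrow> real \<Rightarrow> real^'n \<Rightarrow> real^'n \<Rightarrow> real" where
  "envelope J D \<theta> x = (\<Sum>j\<le>J. (1 / 4 ^ CARD('n)) ^ j * indicator {x. perp \<theta> x \<le> 2 ^ j * D} x)"

lemma envelope_nonneg: "0 \<le> envelope J D \<theta> x"
  unfolding envelope_def by (intro sum_nonneg mult_nonneg_nonneg) auto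

text \<open>The scale is \<open>D = \<delta> powr (- 1/2)\<close>.\<close>

locale separated_caps =
  fixes E :: "'i set" and \<theta> :: "'i \<Rightarrow> real^'n" and a D :: real and J :: nat
  assumes finE: "finite E" and unit: "i \<in> E \<Longrightarrow> norm (\<theta> i) = 1"
    and disjoint: "disjoint_family_on (\<lambda>i. cap (\<theta> i) (a / D)) E"
    and a: "0 < a" "a \<le> D" and D: "1 \<le> D" and J: "D \<le> 2 ^ J" "2 ^ J \<le> 2 * D"
    and dim: "2 \<le> CARD('n)"
begin

text \<open>The upper bound for two antipodal caps of radius \<open>(8 + 2 * a) * r\<close>, divided
  by the lower bound for one cap of radius \<open>a / D\<close>, without the factor
  \<open>(r * D) ^ (CARD('n) - 1)\<close>.\<close>

definition overlap_const :: real where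
  "overlap_const = 2 * (CARD('n) * 2 ^ CARD('n)) * (8 + 2 * a) ^ (CARD('n) - 1)
     / (CARD('n) / 2 * (1 / (8 * CARD('n))) ^ (CARD('n) - 1) * a ^ (CARD('n) - 1))"

lemma overlap_const_pos: "0 < overlap_const"
  unfolding overlap_const_def using a by (intro divide_pos_pos mult_pos_pos zero_less_power) auto

text \<open>Packing by volume: the disjoint caps around these directions all lie in two antipodal
  caps of radius \<open>(8 + 2 * a) * r\<close>, because \<open>1 / D \<le> 2 * r\<close> absorbs
  their own radius.\<close>

lemma card_le_of_near:
  assumes I: "I \<subseteq> E" and \<theta>0: "norm \<theta>0 = 1" and r: "0 < r" "1 / D \<le> 2 * r"
    and near: "\<And>i. i \<in> I \<Longrightarrow> norm (\<theta> i - \<theta>0) \<le> 8 * r \<or> norm (\<theta> i + \<theta>0) \<le> 8 * r"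
  shows "real (card I) \<le> overlap_const * (r * D) ^ (CARD('n) - 1)"
proof -
  interpret finite_measure "sphere_measure :: (real^'n) measure" by (rule finite_measure_sphere_measure)
  let ?m = "measure (sphere_measure :: (real^'n) measure)"
  let ?k = "CARD('n) - 1"
  define c0 where "c0 = CARD('n) / 2 * (1 / (8 * CARD('n))) ^ ?k"
  define C0 where "C0 = CARD('n) * (2::real) ^ CARD('n)"
  define \<rho> where "\<rho> = (8 + 2 * a) * r"
  have \<rho>: "0 \<le> \<rho>" using a r by (simp add: \<rho>_def)
  have finI: "finite I" using finE I by (rule finite_subset[rotated])
  have S: "sphere 0 1 \<inter> cball z \<rho> \<in> sets (sphere_measure :: (real^'n) measure)" for z
    by (intro sets_sphere_measure_borel) auto
  have S': "cap z t \<in> sets (sphere_measure :: (real^'n) measure)" for z t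
    unfolding cap_def by (intro sets_sphere_measure_borel) auto
  have aD: "0 < a / D" "a / D \<le> 1" using a D by auto
  have "real (card I) * (c0 * (a / D) ^ ?k) = (\<Sum>i\<in>I. c0 * (a / D) ^ ?k)" by simp
  also have "\<dots> \<le> (\<Sum>i\<in>I. ?m (cap (\<theta> i) (a / D)))"
    using I unit unfolding c0_def by (intro sum_mono cap_measure_ge aD) auto
  also have "\<dots> = ?m (\<Union>i\<in>I. cap (\<theta> i) (a / D))"
    using finI I S' by (intro finite_measure_finite_Union[symmetric] disjoint_family_on_mono[OF _ disjoint]) auto
  also have "\<dots> \<le> ?m ((sphere 0 1 \<inter> cball \<theta>0 \<rho>) \<union> (sphere 0 1 \<inter> cball (- \<theta>0) \<rho>))"
  proof (rule finite_measure_mono)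
    show "(\<Union>i\<in>I. cap (\<theta> i) (a / D)) \<subseteq> (sphere 0 1 \<inter> cball \<theta>0 \<rho>) \<union> (sphere 0 1 \<inter> cball (- \<theta>0) \<rho>)"
    proof (rule subsetI)
      fix x assume "x \<in> (\<Union>i\<in>I. cap (\<theta> i) (a / D))"
      then obtain i where i: "i \<in> I" "norm x = 1" "norm (x - \<theta> i) < a / D"
        by (auto simp: cap_def dist_norm norm_minus_commute)
      have "a / D \<le> a * (2 * r)" using r a by (metis less_imp_le mult_left_mono times_divide_eq_right mult.right_neutral)
      then have \<rho>': "8 * r + a / D \<le> \<rho>" by (simp add: \<rho>_def algebra_simps)
      have t: "norm (x - \<theta>0) \<le> norm (x - \<theta> i) + norm (\<theta> i - \<theta>0)"
        "norm (x + \<theta>0) \<le> norm (x - \<theta> i) + norm (\<theta> i + \<theta>0)"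
        using norm_triangle_ineq[of "x - \<theta> i" "\<theta> i - \<theta>0"] norm_triangle_ineq[of "x - \<theta> i" "\<theta> i + \<theta>0"] by auto
      have d: "dist \<theta>0 x = norm (x - \<theta>0)" "dist (- \<theta>0) x = norm (x + \<theta>0)"
        using norm_minus_commute[of x \<theta>0] norm_minus_commute[of x "- \<theta>0"] by (simp_all add: dist_norm)
      show "x \<in> (sphere 0 1 \<inter> cball \<theta>0 \<rho>) \<union> (sphere 0 1 \<inter> cball (- \<theta>0) \<rho>)"
        using near[OF i(1)] t i \<rho>' by (auto simp: d)
    qed
  qed (use S in auto)
  also have "\<dots> \<le> ?m (sphere 0 1 \<inter> cball \<theta>0 \<rho>) + ?m (sphere 0 1 \<inter> cball (- \<theta>0) \<rho>)"
    by (rule measure_Un_le) (use S in auto)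
  also have "\<dots> \<le> C0 * \<rho> ^ ?k + C0 * \<rho> ^ ?k"
    unfolding C0_def using cap_measure_le[OF _ \<rho>, of \<theta>0] cap_measure_le[OF _ \<rho>, of "- \<theta>0"] \<theta>0 by simp
  also have "\<dots> = 2 * C0 * (8 + 2 * a) ^ ?k * r ^ ?k"
    by (simp add: \<rho>_def power_mult_distrib)
  finally have "real (card I) * (c0 * (a / D) ^ ?k) \<le> 2 * C0 * (8 + 2 * a) ^ ?k * r ^ ?k" .
  moreover have c: "0 < c0 * a ^ ?k" unfolding c0_def using a by (intro mult_pos_pos zero_less_power) auto
  moreover have Dk: "0 < D ^ ?k" using D by auto
  ultimately have "real (card I) * (c0 * a ^ ?k) \<le> 2 * C0 * (8 + 2 * a) ^ ?k * r ^ ?k * D ^ ?k"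
    by (simp add: power_divide divide_le_eq)
  then have "real (card I) \<le> 2 * C0 * (8 + 2 * a) ^ ?k * r ^ ?k * D ^ ?k / (c0 * a ^ ?k)"
    using c by (simp add: pos_le_divide_eq)
  then show ?thesis unfolding overlap_const_def c0_def C0_def
    by (simp add: power_mult_distrib mult.assoc)
qed

text \<open>A tube of radius \<open>2 ^ j * D\<close> through the origin that contains a point at
  distance about \<open>2 ^ k * D\<close> must point, up to sign, towards that point within an angle
  of order \<open>2 ^ j / 2 ^ k\<close>.\<close>

lemma card_perp_le:
  assumes k: "k \<le> J" "norm x \<le> 2 ^ k * D" "k \<noteq> 0 \<Longrightarrow> 2 ^ (k - 1) * D < norm x"
  shows "real (card {i\<in>E. perp (\<theta> i) x \<le> 2 ^ j * D}) \<le> overlap_const * (2 ^ j / 2 ^ k * D) ^ (CARD('n) - 1)"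
proof -
  let ?I = "{i\<in>E. perp (\<theta> i) x \<le> 2 ^ j * D}"
  have two: "(1::real) \<le> 2 ^ j" by simp
  \<comment> \<open>Here \<open>k \<le> J\<close> enters: the angle \<open>2 ^ j / 2 ^ k\<close>
    must not fall below the order \<open>1 / D\<close> of the separation of the directions.\<close>
  have "(2::real) ^ k \<le> 2 ^ J" using k(1) by (rule power_increasing) simp
  then have kD: "2 ^ k \<le> 2 * D" using J by linarith
  have "1 / D \<le> 2 / 2 ^ k" using kD D by (simp add: field_simps)
  also have "\<dots> \<le> 2 * (2 ^ j / 2 ^ k)" using two by (simp add: divide_right_mono)
  finally have r: "0 < (2::real) ^ j / 2 ^ k" "1 / D \<le> 2 * (2 ^ j / 2 ^ k)" by auto
  show ?thesis
  proof (cases "k = 0")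
    case True
    \<comment> \<open>The innermost shell has no lower bound on \<open>norm x\<close>, and all
      directions are counted. Since \<open>2 ^ j \<ge> 1\<close>, they lie within the permitted
      distance of any unit vector.\<close>
    define e :: "real^'n" where "e = axis undefined 1"
    have e: "norm e = 1" by (simp add: e_def)
    show ?thesis
    proof (rule card_le_of_near[OF _ e r])
      fix i assume "i \<in> ?I"
      then have "norm (\<theta> i - e) \<le> 2"
        using norm_triangle_ineq4[of "\<theta> i" e] unit[of i] e by simp
      also have "2 \<le> 8 * ((2::real) ^ j / 2 ^ k)" unfolding True using two by (simp only: power_0 div_by_1)
      finally show "norm (\<theta> i - e) \<le> 8 * (2 ^ j / 2 ^ k) \<or> norm (\<theta> i + e) \<le> 8 * (2 ^ j / 2 ^ k)" ..
    qed auto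
  next
    case False
    define \<theta>0 where "\<theta>0 = x /\<^sub>R norm x"
    have x: "2 ^ (k - 1) * D < norm x" using k(3)[OF False] .
    have "0 < 2 ^ (k - 1) * D" using D by simp
    with x have x0: "0 < norm x" by linarith
    have \<theta>0: "norm \<theta>0 = 1" using x0 by (simp add: \<theta>0_def)
    have p: "2 * perp (\<theta> i) \<theta>0 \<le> 8 * (2 ^ j / 2 ^ k)" if "i \<in> ?I" for i
    proof -
      have "perp (\<theta> i) \<theta>0 = perp (\<theta> i) x / norm x"
        unfolding \<theta>0_def perp_scale by (simp add: divide_inverse mult.commute)
      also have "\<dots> \<le> (2 ^ j * D) / (2 ^ (k - 1) * D)"
        using that x D by (intro frac_le) auto
      also have "\<dots> = 2 * (2 ^ j / 2 ^ k)"
        using False D by (cases k) auto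
      finally show ?thesis using r(1) by linarith
    qed
    show ?thesis
    proof (rule card_le_of_near[OF _ \<theta>0 r])
      fix i assume "i \<in> ?I"
      then show "norm (\<theta> i - \<theta>0) \<le> 8 * (2 ^ j / 2 ^ k) \<or> norm (\<theta> i + \<theta>0) \<le> 8 * (2 ^ j / 2 ^ k)"
        using dist_direction_le_perp[OF \<theta>0, of "\<theta> i"] p[of i] unit[of i] by fastforce
    qed auto
  qed
qed

text \<open>The ratio of both geometric series in \<open>j\<close>: the weights of the envelope
  shrink by \<open>4 ^ CARD('n')\<close> per step, while the overlap count and the cross-section of
  a tube each grow by \<open>2 ^ (CARD('n) - 1)\<close>.\<close>

lemma quarter_power_le: "(1 / 4 ^ CARD('n)) * 2 ^ (CARD('n) - 1) \<le> (1 / 2 :: real)"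
proof -
  have "(2::real) ^ (CARD('n) - 1) \<le> 2 ^ CARD('n)" by (intro power_increasing) auto
  also have "\<dots> * 2 \<le> 4 ^ CARD('n)"
    using dim power_increasing[of 1 "CARD('n)" "2::real"] power_mult_distrib[of "2::real" 2 "CARD('n)"] by simp
  finally show ?thesis by (simp add: field_simps)
qed

lemma sum_envelope_le:
  assumes "k \<le> J" "norm x \<le> 2 ^ k * D" "k \<noteq> 0 \<Longrightarrow> 2 ^ (k - 1) * D < norm x"
  shows "(\<Sum>i\<in>E. envelope J D (\<theta> i) x) \<le> 2 * overlap_const * (D / 2 ^ k) ^ (CARD('n) - 1)"
proof -
  let ?z = "1 / 4 ^ CARD('n) :: real"
  have "(\<Sum>i\<in>E. envelope J D (\<theta> i) x) = (\<Sum>j\<le>J. ?z ^ j * (\<Sum>i\<in>E. indicator {x. perp (\<theta> i) x \<le> 2 ^ j * D} x))"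
    unfolding envelope_def by (subst sum.swap) (simp add: sum_distrib_left)
  also have "\<dots> = (\<Sum>j\<le>J. ?z ^ j * real (card {i\<in>E. perp (\<theta> i) x \<le> 2 ^ j * D}))"
  proof (intro sum.cong refl arg_cong2[where f = "(*)"])
    fix j
    have "(\<Sum>i\<in>E. indicator {x. perp (\<theta> i) x \<le> 2 ^ j * D} x :: real) = (\<Sum>i\<in>E. if perp (\<theta> i) x \<le> 2 ^ j * D then 1 else 0)"
      by (intro sum.cong) (auto simp: indicator_def)
    also have "\<dots> = real (card {i\<in>E. perp (\<theta> i) x \<le> 2 ^ j * D})"
      using finE by (simp add: sum.If_cases Int_def)
    finally show "(\<Sum>i\<in>E. indicator {x. perp (\<theta> i) x \<le> 2 ^ j * D} x) = real (card {i\<in>E. perp (\<theta> i) x \<le> 2 ^ j * D})" .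
  qed
  also have "\<dots> \<le> (\<Sum>j\<le>J. ?z ^ j * (overlap_const * (2 ^ j / 2 ^ k * D) ^ (CARD('n) - 1)))"
    using assms by (intro sum_mono mult_left_mono card_perp_le) auto
  also have "\<dots> = (\<Sum>j\<le>J. (?z * 2 ^ (CARD('n) - 1)) ^ j) * (overlap_const * (D / 2 ^ k) ^ (CARD('n) - 1))"
    unfolding sum_distrib_right
  proof (intro sum.cong refl)
    fix j
    have "((2::real) ^ j) ^ (CARD('n) - 1) = (2 ^ (CARD('n) - 1)) ^ j"
      by (simp add: power_mult[symmetric] mult.commute)
    then show "?z ^ j * (overlap_const * (2 ^ j / 2 ^ k * D) ^ (CARD('n) - 1))
        = (?z * 2 ^ (CARD('n) - 1)) ^ j * (overlap_const * (D / 2 ^ k) ^ (CARD('n) - 1))"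
      by (simp add: power_mult_distrib power_divide)
  qed
  also have "\<dots> \<le> 2 * (overlap_const * (D / 2 ^ k) ^ (CARD('n) - 1))"
    using quarter_power_le overlap_const_pos D by (intro mult_right_mono geometric_le_2) auto
  finally show ?thesis by simp
qed

definition envelope_const :: real where
  "envelope_const = (2 * overlap_const) powr (1 / (real CARD('n) - 1)) * 2 ^ (CARD('n) + 1)"

lemma measurable_envelope [measurable]: "envelope J D t \<in> borel_measurable borel"
  unfolding envelope_def by measurable

text \<open>Inside the ball only a piece of half-length \<open>2 ^ k * D\<close> of each tube
  counts, and the series over the radii \<open>2 ^ j * D\<close> is at most twice its first
  term.\<close>

lemma envelope_ball_integral_le:
  assumes i: "i \<in> E"
  shows "(\<integral>\<^sup>+x. ennreal (envelope J D (\<theta> i) x * indicator (cball 0 (2 ^ k * D)) x) \<partial>lborel)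
    \<le> ennreal (2 ^ (CARD('n) + 1) * 2 ^ k * D ^ CARD('n))"
proof -
  let ?z = "1 / 4 ^ CARD('n) :: real"
  let ?T = "\<lambda>j. {x. \<bar>x \<bullet> \<theta> i\<bar> \<le> 2 ^ k * D \<and> norm (x - (x \<bullet> \<theta> i) *\<^sub>R \<theta> i) \<le> 2 ^ j * D}"
  have Tm [measurable]: "?T j \<in> sets borel" for j by measurable
  have "(\<integral>\<^sup>+x. ennreal (envelope J D (\<theta> i) x * indicator (cball 0 (2 ^ k * D)) x) \<partial>lborel)
      \<le> (\<integral>\<^sup>+x. (\<Sum>j\<le>J. ennreal (?z ^ j) * indicator (?T j) x) \<partial>lborel)"
  proof (intro nn_integral_mono)
    fix x :: "real^'n"
    have "\<bar>x \<bullet> \<theta> i\<bar> \<le> norm x" using Cauchy_Schwarz_ineq2[of x "\<theta> i"] unit[OF i] by simp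
    then have "envelope J D (\<theta> i) x * indicator (cball 0 (2 ^ k * D)) x \<le> (\<Sum>j\<le>J. ?z ^ j * indicator (?T j) x)"
      unfolding envelope_def sum_distrib_right
      by (intro sum_mono) (auto simp: indicator_def perp_def)
    then have "ennreal (envelope J D (\<theta> i) x * indicator (cball 0 (2 ^ k * D)) x)
        \<le> ennreal (\<Sum>j\<le>J. ?z ^ j * indicator (?T j) x)"
      by (rule ennreal_leI)
    also have "\<dots> = (\<Sum>j\<le>J. ennreal (?z ^ j) * indicator (?T j) x)"
      by (subst sum_ennreal[symmetric]) (auto simp: indicator_def intro!: sum.cong)
    finally show "ennreal (envelope J D (\<theta> i) x * indicator (cball 0 (2 ^ k * D)) x)
        \<le> (\<Sum>j\<le>J. ennreal (?z ^ j) * indicator (?T j) x)" .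
  qed
  also have "\<dots> = (\<Sum>j\<le>J. ennreal (?z ^ j) * emeasure lborel (?T j))"
    by (subst nn_integral_sum) (auto intro!: sum.cong nn_integral_cmult_indicator)
  also have "\<dots> \<le> (\<Sum>j\<le>J. ennreal (?z ^ j) * ennreal (2 ^ CARD('n) * (2 ^ k * D) * (2 ^ j * D) ^ (CARD('n) - 1)))"
    using D by (intro sum_mono mult_left_mono emeasure_tube_le unit i) auto
  also have "\<dots> = ennreal (\<Sum>j\<le>J. ?z ^ j * (2 ^ CARD('n) * (2 ^ k * D) * (2 ^ j * D) ^ (CARD('n) - 1)))"
    using D by (subst sum_ennreal[symmetric]) (auto simp: ennreal_mult)
  also have "(\<Sum>j\<le>J. ?z ^ j * (2 ^ CARD('n) * (2 ^ k * D) * (2 ^ j * D) ^ (CARD('n) - 1)))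
      = (\<Sum>j\<le>J. (?z * 2 ^ (CARD('n) - 1)) ^ j) * (2 ^ CARD('n) * 2 ^ k * D ^ CARD('n))"
    unfolding sum_distrib_right
  proof (intro sum.cong refl)
    fix j
    have "((2::real) ^ j) ^ (CARD('n) - 1) = (2 ^ (CARD('n) - 1)) ^ j"
      by (simp add: power_mult[symmetric] mult.commute)
    moreover have "D ^ CARD('n) = D * D ^ (CARD('n) - 1)"
      using dim by (cases "CARD('n)") auto
    ultimately show "?z ^ j * (2 ^ CARD('n) * (2 ^ k * D) * (2 ^ j * D) ^ (CARD('n) - 1))
        = (?z * 2 ^ (CARD('n) - 1)) ^ j * (2 ^ CARD('n) * 2 ^ k * D ^ CARD('n))"
      by (simp add: power_mult_distrib power_divide mult_ac)
  qed
  also have "\<dots> \<le> 2 * (2 ^ CARD('n) * 2 ^ k * D ^ CARD('n))"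
    using quarter_power_le D by (intro mult_right_mono geometric_le_2) auto
  finally show ?thesis by (simp add: mult.assoc ennreal_leI order_trans[OF _ ennreal_leI])
qed

text \<open>Jensen's inequality with the envelopes as weights. Their total is at most a constant
  times \<open>(D / 2 ^ k) ^ (CARD('n) - 1)\<close>, and the exponent
  \<open>p - 1 = 1 / (n - 1)\<close> makes this linear in \<open>D / 2 ^ k\<close>.\<close>

lemma sum_envelope_powr_le:
  assumes p: "p = real CARD('n) / (real CARD('n) - 1)" and x: "norm x \<le> D\<^sup>2"
    and y: "\<And>i. i \<in> E \<Longrightarrow> 0 \<le> y i"
  shows "(\<Sum>i\<in>E. y i * envelope J D (\<theta> i) x) powr p
    \<le> (\<Sum>k\<le>J. \<Sum>i\<in>E. (2 * overlap_const) powr (1 / (real CARD('n) - 1)) * (D / 2 ^ k) * y i powr p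
        * (envelope J D (\<theta> i) x * indicator (cball 0 (2 ^ k * D)) x))"
proof -
  let ?B = "(2 * overlap_const) powr (1 / (real CARD('n) - 1))"
  have n1: "real CARD('n) - 1 > 0" using dim by simp
  have p1: "1 \<le> p" "p - 1 = 1 / (real CARD('n) - 1)" using n1 unfolding p by (auto simp: field_simps)
  have "norm x \<le> 2 ^ J * D"
  proof -
    have "D\<^sup>2 \<le> 2 ^ J * D"
      unfolding power2_eq_square using J(1) D by (intro mult_right_mono) auto
    with x show ?thesis by linarith
  qed
  then have ex: "norm x \<le> 2 ^ J * D" .
  define k where "k = (LEAST k. norm x \<le> 2 ^ k * D)"
  have k: "norm x \<le> 2 ^ k * D" "k \<le> J"
    unfolding k_def using ex by (rule LeastI, rule Least_le)
  have k': "2 ^ (k - 1) * D < norm x" if "k \<noteq> 0"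
    using not_less_Least[of "k - 1" "\<lambda>k. norm x \<le> 2 ^ k * D"] that unfolding k_def[symmetric] by (simp add: not_le)
  let ?f = "\<lambda>k i. ?B * (D / 2 ^ k) * y i powr p * (envelope J D (\<theta> i) x * indicator (cball 0 (2 ^ k * D)) x)"
  have f0: "0 \<le> ?f k i" if "i \<in> E" for k i
    using D envelope_nonneg[of J D "\<theta> i" x] by (auto simp: indicator_def)
  have "(\<Sum>i\<in>E. y i * envelope J D (\<theta> i) x) powr p
      \<le> (\<Sum>i\<in>E. envelope J D (\<theta> i) x) powr (p - 1) * (\<Sum>i\<in>E. y i powr p * envelope J D (\<theta> i) x)"
    by (intro sum_powr_Jensen finE p1 envelope_nonneg y)
  also have "\<dots> \<le> (2 * overlap_const * (D / 2 ^ k) ^ (CARD('n) - 1)) powr (p - 1) * (\<Sum>i\<in>E. y i powr p * envelope J D (\<theta> i) x)"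
    using sum_envelope_le[OF k(2,1) k'] p1
    by (intro mult_right_mono powr_mono2 sum_nonneg) (auto intro!: sum_nonneg mult_nonneg_nonneg envelope_nonneg)
  also have "(2 * overlap_const * (D / 2 ^ k) ^ (CARD('n) - 1)) powr (p - 1) = ?B * (D / 2 ^ k)"
  proof -
    have "((D / 2 ^ k) ^ (CARD('n) - 1)) powr (p - 1) = D / 2 ^ k"
      using D dim n1 unfolding p1(2) by (simp add: powr_realpow[symmetric] powr_powr of_nat_diff)
    then show ?thesis
      using overlap_const_pos D by (simp only: powr_mult p1(2))
  qed
  also have "?B * (D / 2 ^ k) * (\<Sum>i\<in>E. y i powr p * envelope J D (\<theta> i) x) = (\<Sum>i\<in>E. ?f k i)"
    using k(1) by (simp add: sum_distrib_left mult.assoc)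
  \<comment> \<open>The shell index depends on \<open>x\<close>. Adding the nonnegative terms of all
    other indices removes this dependence, and the bound can be integrated term by term.\<close>
  also have "\<dots> \<le> (\<Sum>k\<le>J. \<Sum>i\<in>E. ?f k i)"
    using k(2) f0 by (intro member_le_sum[where f = "\<lambda>k. \<Sum>i\<in>E. ?f k i"] sum_nonneg) auto
  finally show ?thesis .
qed

lemma envelope_integral_le:
  assumes p: "p = real CARD('n) / (real CARD('n) - 1)" and y: "\<And>i. i \<in> E \<Longrightarrow> 0 \<le> y i"
  shows "(\<integral>\<^sup>+x\<in>ball 0 (D\<^sup>2). ennreal ((\<Sum>i\<in>E. y i * envelope J D (\<theta> i) x) powr p) \<partial>lborel)
    \<le> ennreal (envelope_const * D ^ (CARD('n) + 1) * (real J + 1) * (\<Sum>i\<in>E. y i powr p))"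
proof -
  let ?B = "(2 * overlap_const) powr (1 / (real CARD('n) - 1))"
  let ?g = "\<lambda>k i x. envelope J D (\<theta> i) x * indicator (cball 0 (2 ^ k * D)) x :: real"
  let ?c = "\<lambda>k i. ?B * (D / 2 ^ k) * y i powr p"
  have c0: "0 \<le> ?c k i" for k i using D by auto
  have g0: "0 \<le> ?g k i x" for k i x using envelope_nonneg[of J D "\<theta> i" x] by (auto simp: indicator_def)
  have "(\<integral>\<^sup>+x\<in>ball 0 (D\<^sup>2). ennreal ((\<Sum>i\<in>E. y i * envelope J D (\<theta> i) x) powr p) \<partial>lborel)
      \<le> (\<integral>\<^sup>+x. (\<Sum>k\<le>J. \<Sum>i\<in>E. ennreal (?c k i) * ennreal (?g k i x)) \<partial>lborel)"
  proof (intro nn_integral_mono)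
    fix x :: "real^'n"
    have "ennreal ((\<Sum>i\<in>E. y i * envelope J D (\<theta> i) x) powr p) * indicator (ball 0 (D\<^sup>2)) x
        \<le> ennreal (\<Sum>k\<le>J. \<Sum>i\<in>E. ?c k i * ?g k i x)"
    proof (cases "x \<in> ball 0 (D\<^sup>2)")
      case True
      then show ?thesis
        using sum_envelope_powr_le[OF p _ y, of x] by (auto intro: ennreal_leI)
    qed simp
    also have "\<dots> = (\<Sum>k\<le>J. \<Sum>i\<in>E. ennreal (?c k i) * ennreal (?g k i x))"
      unfolding ennreal_mult[OF c0 g0, symmetric]
      by (rule ennreal_double_sum) (intro mult_nonneg_nonneg c0 g0)
    finally show "ennreal ((\<Sum>i\<in>E. y i * envelope J D (\<theta> i) x) powr p) * indicator (ball 0 (D\<^sup>2)) x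
        \<le> (\<Sum>k\<le>J. \<Sum>i\<in>E. ennreal (?c k i) * ennreal (?g k i x))" .
  qed
  also have "\<dots> = (\<Sum>k\<le>J. \<Sum>i\<in>E. ennreal (?c k i) * (\<integral>\<^sup>+x. ennreal (?g k i x) \<partial>lborel))"
  proof -
    have m [measurable]: "(\<lambda>x. ennreal (?g k i x)) \<in> borel_measurable lborel" for k i
      by (intro measurable_compose[OF _ measurable_ennreal] borel_measurable_times borel_measurable_indicator) auto
    show ?thesis
      by (subst nn_integral_sum, measurable, intro sum.cong refl, subst nn_integral_sum, measurable,
          intro sum.cong refl nn_integral_cmult m)
  qed
  also have "\<dots> \<le> (\<Sum>k\<le>J. \<Sum>i\<in>E. ennreal (?c k i) * ennreal (2 ^ (CARD('n) + 1) * 2 ^ k * D ^ CARD('n)))"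
    by (intro sum_mono mult_left_mono envelope_ball_integral_le) auto
  also have "\<dots> = ennreal (\<Sum>k\<le>J. \<Sum>i\<in>E. ?c k i * (2 ^ (CARD('n) + 1) * 2 ^ k * D ^ CARD('n)))"
  proof -
    have d0: "0 \<le> 2 ^ (CARD('n) + 1) * 2 ^ k * D ^ CARD('n)" for k :: nat using D by simp
    show ?thesis
      unfolding ennreal_mult[OF c0 d0, symmetric]
      by (rule ennreal_double_sum[symmetric]) (intro mult_nonneg_nonneg c0 d0)
  qed
  \<comment> \<open>The factor \<open>2 ^ k\<close> from the length of the tubes cancels against
    \<open>D / 2 ^ k\<close> from the overlap, so all \<open>J + 1\<close> terms are equal.\<close>
  also have "(\<Sum>k\<le>J. \<Sum>i\<in>E. ?c k i * (2 ^ (CARD('n) + 1) * 2 ^ k * D ^ CARD('n)))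
      = (\<Sum>k\<le>J. envelope_const * D ^ (CARD('n) + 1) * (\<Sum>i\<in>E. y i powr p))"
    unfolding sum_distrib_left envelope_const_def
    by (intro sum.cong refl) (simp add: mult_ac)
  also have "\<dots> = envelope_const * D ^ (CARD('n) + 1) * (real J + 1) * (\<Sum>i\<in>E. y i powr p)"
    by (simp add: mult_ac distrib_left)
  finally show ?thesis .
qed

end

subsection \<open>The square function estimate\<close>

text \<open>The normalised transverse component serves as \<open>v\<close>. For a point on the axis
  its coefficient is zero and any unit vector orthogonal to \<open>\<theta>\<close> does, which
  exists in dimension at least two.\<close>

lemma unit_decomposition:
  fixes \<theta> x :: "'a::euclidean_space"
  assumes \<theta>: "norm \<theta> = 1" and dim: "2 \<le> DIM('a)"
  obtains v where "orthonormal_pair \<theta> v" "x = (x \<bullet> \<theta>) *\<^sub>R \<theta> + perp \<theta> x *\<^sub>R v"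
proof (cases "perp \<theta> x = 0")
  case True
  obtain y where y: "y \<noteq> 0" "orthogonal \<theta> y"
    using orthogonal_to_vector_exists[OF dim, of \<theta>] by blast
  show ?thesis
  proof (rule that[of "y /\<^sub>R norm y"])
    show "orthonormal_pair \<theta> (y /\<^sub>R norm y)"
      using y \<theta> by (simp add: orthonormal_pair_def orthogonal_def norm_eq_1 power2_norm_eq_inner[symmetric] power2_eq_square)
    show "x = (x \<bullet> \<theta>) *\<^sub>R \<theta> + perp \<theta> x *\<^sub>R (y /\<^sub>R norm y)"
      using True by (simp add: perp_def)
  qed
next
  case False
  let ?w = "x - (x \<bullet> \<theta>) *\<^sub>R \<theta>"
  have w: "norm ?w = perp \<theta> x" by (simp add: perp_def)
  have "\<theta> \<bullet> ?w = 0" using \<theta> by (simp add: inner_diff_right inner_commute norm_eq_1)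
  moreover have "(?w /\<^sub>R norm ?w) \<bullet> (?w /\<^sub>R norm ?w) = 1"
    using False w unfolding norm_eq_1[symmetric] by simp
  ultimately show ?thesis
    using \<theta> False w by (intro that[of "?w /\<^sub>R norm ?w"]) (simp_all add: orthonormal_pair_def norm_eq_1)
qed

lemma bump_extension_decay:
  fixes K :: "nat \<Rightarrow> real" and b :: real
  assumes b: "0 \<le> b" and dim: "2 \<le> CARD('n)"
  shows "\<exists>C\<ge>0. \<forall>\<delta> F (\<theta>::real^'n) x. 0 < \<delta> \<longrightarrow> \<delta> \<le> 1 \<longrightarrow> smooth F \<longrightarrow>
      (\<forall>is x. \<bar>iter_partial is F x\<bar> \<le> K (length is) * \<delta> powr (- real (length is) / 2)) \<longrightarrow>
      (\<forall>\<xi>. norm \<xi> = 1 \<longrightarrow> b * sqrt \<delta> < norm (\<xi> - \<theta>) \<longrightarrow> F \<xi> = 0) \<longrightarrow>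
      norm \<theta> = 1 \<longrightarrow> norm x \<le> 1 / \<delta> \<longrightarrow>
      (sqrt \<delta> * perp \<theta> x) ^ k * norm (extension (\<lambda>\<xi>. of_real (F \<xi>)) x) \<le> C * sqrt \<delta> ^ (CARD('n) - 1)"
proof -
  \<comment> \<open>The parameter set consists of all admissible tuples at once; the constant
    supplied by \<open>bump_decay\<close> is then uniform in each component.\<close>
  define S where "S = {(\<delta>, F, \<theta>, v, s, \<tau>). 0 < \<delta> \<and> \<delta> \<le> 1 \<and> smooth F \<and>
      (\<forall>is x. \<bar>iter_partial is F x\<bar> \<le> K (length is) * \<delta> powr (- real (length is) / 2)) \<and>
      (\<forall>\<xi>. norm \<xi> = 1 \<longrightarrow> b * sqrt \<delta> < norm (\<xi> - \<theta>) \<longrightarrow> F \<xi> = 0) \<and>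
      orthonormal_pair (\<theta>::real^'n) v \<and> \<bar>s\<bar> \<le> 1 / \<delta> \<and> \<bar>\<tau>\<bar> \<le> 1 / \<delta>}"
  interpret bump_family S "\<lambda>(\<delta>, F, \<theta>, v, s, \<tau>). \<delta>" "\<lambda>(\<delta>, F, \<theta>, v, s, \<tau>). F"
    "\<lambda>(\<delta>, F, \<theta>, v, s, \<tau>). \<theta>" "\<lambda>(\<delta>, F, \<theta>, v, s, \<tau>). v" "\<lambda>(\<delta>, F, \<theta>, v, s, \<tau>). s" "\<lambda>(\<delta>, F, \<theta>, v, s, \<tau>). \<tau>" b K
    by unfold_locales (auto simp: S_def b)
  obtain C where C: "0 \<le> C" "\<And>\<delta> F \<theta> v s \<tau>. (\<delta>, F, \<theta>, v, s, \<tau>) \<in> S \<Longrightarrow>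
      (sqrt \<delta> * \<bar>s\<bar>) ^ k * norm (extension (\<lambda>\<xi>. of_real (F \<xi>)) (\<tau> *\<^sub>R \<theta> + s *\<^sub>R v))
      \<le> C * measure sphere_measure (sphere 0 1 \<inter> cball \<theta> (b * sqrt \<delta>))"
    using bump_decay[of k] by fastforce
  define C' where "C' = C * (CARD('n) * 2 ^ CARD('n) * b ^ (CARD('n) - 1))"
  show ?thesis
  proof (intro exI[of _ C'] conjI allI impI)
    show "0 \<le> C'" using C b by (simp add: C'_def)
    fix \<delta> F and \<theta> x :: "real^'n"
    assume *: "0 < \<delta>" "\<delta> \<le> 1" "smooth F"
      "\<forall>is x. \<bar>iter_partial is F x\<bar> \<le> K (length is) * \<delta> powr (- real (length is) / 2)"
      "\<forall>\<xi>. norm \<xi> = 1 \<longrightarrow> b * sqrt \<delta> < norm (\<xi> - \<theta>) \<longrightarrow> F \<xi> = 0"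
      and \<theta>: "norm \<theta> = 1" and x: "norm x \<le> 1 / \<delta>"
    have "2 \<le> DIM(real^'n)" using dim by simp
    then obtain v where v: "orthonormal_pair \<theta> v" "x = (x \<bullet> \<theta>) *\<^sub>R \<theta> + perp \<theta> x *\<^sub>R v"
      using unit_decomposition[OF \<theta>, of x] by blast
    have "\<bar>x \<bullet> \<theta>\<bar> \<le> 1 / \<delta>" "\<bar>perp \<theta> x\<bar> \<le> 1 / \<delta>"
      using Cauchy_Schwarz_ineq2[of x \<theta>] norm_perp_le(1)[OF \<theta>, of x] \<theta> x by (auto simp: perp_def)
    then have "(\<delta>, F, \<theta>, v, perp \<theta> x, x \<bullet> \<theta>) \<in> S"
      using * v(1) by (simp add: S_def)
    from C(2)[OF this]
    have "(sqrt \<delta> * perp \<theta> x) ^ k * norm (extension (\<lambda>\<xi>. of_real (F \<xi>)) x)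
      \<le> C * measure sphere_measure (sphere 0 1 \<inter> cball \<theta> (b * sqrt \<delta>))"
      by (simp add: v(2)[symmetric])
    also have "\<dots> \<le> C * (CARD('n) * 2 ^ CARD('n) * (b * sqrt \<delta>) ^ (CARD('n) - 1))"
      using C b * by (intro mult_left_mono cap_measure_le \<theta>) auto
    also have "\<dots> = C' * sqrt \<delta> ^ (CARD('n) - 1)"
      by (simp add: C'_def power_mult_distrib)
    finally show "(sqrt \<delta> * perp \<theta> x) ^ k * norm (extension (\<lambda>\<xi>. of_real (F \<xi>)) x) \<le> C' * sqrt \<delta> ^ (CARD('n) - 1)" .
  qed
qed

lemma extension_cong:
  assumes "\<And>\<xi>. norm \<xi> = 1 \<Longrightarrow> g \<xi> = h \<xi>"
  shows "extension g = extension h"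
  unfolding extension_eq fun_eq_iff using assms by (auto intro!: Bochner_Integration.integral_cong)

text \<open>Decay of order zero settles the core tube \<open>j = 0\<close>, decay of order n all
  wider ones. Squaring the latter produces the weights \<open>4 ^ (- n * j)\<close> of the
  envelope.\<close>

lemma bump_envelope_bound:
  fixes K :: "nat \<Rightarrow> real" and a b :: real
  assumes b: "0 \<le> b" and dim: "2 \<le> CARD('n)"
  shows "\<exists>C>0. \<forall>\<delta> A \<phi> (\<theta>::real^'n) x J. 0 < \<delta> \<longrightarrow> \<delta> \<le> 1 \<longrightarrow> cell_bump a K \<delta> A \<phi> \<longrightarrow>
      A \<subseteq> cap \<theta> (b * sqrt \<delta>) \<longrightarrow> norm \<theta> = 1 \<longrightarrow> norm x \<le> 1 / \<delta> \<longrightarrow> 1 / sqrt \<delta> \<le> 2 ^ J \<longrightarrow>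
      (norm (extension (\<lambda>\<xi>. of_real (\<phi> \<xi>)) x))\<^sup>2 \<le> C * \<delta> ^ (CARD('n) - 1) * envelope J (1 / sqrt \<delta>) \<theta> x"
proof -
  obtain C0 where C0: "0 \<le> C0" "\<And>\<delta> F (\<theta>::real^'n) x. 0 < \<delta> \<Longrightarrow> \<delta> \<le> 1 \<Longrightarrow> smooth F \<Longrightarrow>
      (\<forall>is x. \<bar>iter_partial is F x\<bar> \<le> K (length is) * \<delta> powr (- real (length is) / 2)) \<Longrightarrow>
      (\<forall>\<xi>. norm \<xi> = 1 \<longrightarrow> b * sqrt \<delta> < norm (\<xi> - \<theta>) \<longrightarrow> F \<xi> = 0) \<Longrightarrow>
      norm \<theta> = 1 \<Longrightarrow> norm x \<le> 1 / \<delta> \<Longrightarrow>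
      norm (extension (\<lambda>\<xi>. of_real (F \<xi>)) x) \<le> C0 * sqrt \<delta> ^ (CARD('n) - 1)"
    using bump_extension_decay[OF b dim, of K 0] by auto
  obtain C1 where C1: "0 \<le> C1" "\<And>\<delta> F (\<theta>::real^'n) x. 0 < \<delta> \<Longrightarrow> \<delta> \<le> 1 \<Longrightarrow> smooth F \<Longrightarrow>
      (\<forall>is x. \<bar>iter_partial is F x\<bar> \<le> K (length is) * \<delta> powr (- real (length is) / 2)) \<Longrightarrow>
      (\<forall>\<xi>. norm \<xi> = 1 \<longrightarrow> b * sqrt \<delta> < norm (\<xi> - \<theta>) \<longrightarrow> F \<xi> = 0) \<Longrightarrow>
      norm \<theta> = 1 \<Longrightarrow> norm x \<le> 1 / \<delta> \<Longrightarrow>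
      (sqrt \<delta> * perp \<theta> x) ^ CARD('n) * norm (extension (\<lambda>\<xi>. of_real (F \<xi>)) x) \<le> C1 * sqrt \<delta> ^ (CARD('n) - 1)"
    using bump_extension_decay[OF b dim, of K "CARD('n)"] by auto
  define C where "C = 1 + C0\<^sup>2 + 4 ^ CARD('n) * C1\<^sup>2"
  have "C > 0" unfolding C_def using zero_le_power2[of C0] zero_le_power2[of C1]
    by (simp add: add_pos_nonneg)
  moreover have "(norm (extension (\<lambda>\<xi>. of_real (\<phi> \<xi>)) x))\<^sup>2 \<le> C * \<delta> ^ (CARD('n) - 1) * envelope J (1 / sqrt \<delta>) \<theta> x"
    if \<delta>: "0 < \<delta>" "\<delta> \<le> 1" and bump: "cell_bump a K \<delta> A \<phi>" and A: "A \<subseteq> cap \<theta> (b * sqrt \<delta>)"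
      and \<theta>: "norm \<theta> = 1" and x: "norm x \<le> 1 / \<delta>" and J: "1 / sqrt \<delta> \<le> 2 ^ J"
    for \<delta> A \<phi> J and \<theta> x :: "real^'n"
  proof -
    let ?N = "CARD('n)" and ?D = "1 / sqrt \<delta>"
    let ?z = "1 / 4 ^ ?N :: real"
    obtain F where F: "smooth F" "\<And>\<xi>. norm \<xi> = 1 \<Longrightarrow> F \<xi> = \<phi> \<xi>"
      "\<forall>is x. \<bar>iter_partial is F x\<bar> \<le> K (length is) * \<delta> powr (- real (length is) / 2)"
      and \<phi>0: "\<And>\<xi>. norm \<xi> = 1 \<Longrightarrow> \<xi> \<notin> A \<Longrightarrow> \<phi> \<xi> = 0"
      using bump unfolding cell_bump_def by auto
    have supp: "\<forall>\<xi>. norm \<xi> = 1 \<longrightarrow> b * sqrt \<delta> < norm (\<xi> - \<theta>) \<longrightarrow> F \<xi> = 0"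
    proof (intro allI impI)
      fix \<xi> :: "real^'n" assume \<xi>: "norm \<xi> = 1" "b * sqrt \<delta> < norm (\<xi> - \<theta>)"
      then have "\<xi> \<notin> A" using A by (auto simp: cap_def dist_norm norm_minus_commute)
      then show "F \<xi> = 0" using F(2) \<phi>0 \<xi> by simp
    qed
    have e: "extension (\<lambda>\<xi>. of_real (\<phi> \<xi>)) x = extension (\<lambda>\<xi>. of_real (F \<xi>)) x"
      by (rule fun_cong[OF extension_cong]) (simp add: F)
    let ?X = "norm (extension (\<lambda>\<xi>. of_real (\<phi> \<xi>)) x)"
    have d0: "?X \<le> C0 * sqrt \<delta> ^ (?N - 1)"
      unfolding e using C0(2)[OF \<delta> F(1,3) supp \<theta> x] .
    have d1: "(sqrt \<delta> * perp \<theta> x) ^ ?N * ?X \<le> C1 * sqrt \<delta> ^ (?N - 1)"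
      unfolding e using C1(2)[OF \<delta> F(1,3) supp \<theta> x] .
    have sq: "(sqrt \<delta> ^ (?N - 1))\<^sup>2 = \<delta> ^ (?N - 1)"
      using \<delta> by (simp add: power_mult[symmetric] mult.commute[of _ 2]) (simp add: power_mult)
    \<comment> \<open>On the ball of radius \<open>1 / \<delta> = ?D * ?D\<close> the widest tube of
      the envelope, of radius \<open>2 ^ J * ?D\<close>, contains every point.\<close>
    have "perp \<theta> x \<le> norm x" unfolding perp_def by (rule norm_perp_le(1)[OF \<theta>])
    also have "\<dots> \<le> ?D * ?D" using x \<delta> by (simp add: field_simps)
    also have "\<dots> \<le> 2 ^ J * ?D" using J \<delta> by (intro mult_right_mono) auto
    finally have ex: "perp \<theta> x \<le> 2 ^ J * ?D" .
    define j where "j = (LEAST j. perp \<theta> x \<le> 2 ^ j * ?D)"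
    have j: "perp \<theta> x \<le> 2 ^ j * ?D" "j \<le> J"
      unfolding j_def using ex by (rule LeastI, rule Least_le)
    have j': "2 ^ (j - 1) * ?D < perp \<theta> x" if "j \<noteq> 0"
      using not_less_Least[of "j - 1" "\<lambda>j. perp \<theta> x \<le> 2 ^ j * ?D"] that unfolding j_def[symmetric] by (simp add: not_le)
    have env: "?z ^ j \<le> envelope J ?D \<theta> x"
    proof -
      have "?z ^ j = ?z ^ j * indicator {x. perp \<theta> x \<le> 2 ^ j * ?D} x" using j by simp
      also have "\<dots> \<le> envelope J ?D \<theta> x"
        unfolding envelope_def using j(2) by (intro member_le_sum) auto
      finally show ?thesis .
    qed
    have "?X\<^sup>2 \<le> C * \<delta> ^ (?N - 1) * ?z ^ j"
    proof (cases "j = 0")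
      case True
      have "?X\<^sup>2 \<le> (C0 * sqrt \<delta> ^ (?N - 1))\<^sup>2" using d0 by (intro power_mono) auto
      also have "\<dots> = C0\<^sup>2 * \<delta> ^ (?N - 1)" by (simp only: power_mult_distrib sq)
      also have "\<dots> \<le> C * \<delta> ^ (?N - 1)" using \<delta> by (intro mult_right_mono) (auto simp: C_def)
      finally show ?thesis using True by simp
    next
      case False
      have "2 ^ (j - 1) \<le> sqrt \<delta> * perp \<theta> x"
        using j'[OF False] \<delta> by (simp add: field_simps)
      then have "(2 ^ (j - 1)) ^ ?N * ?X \<le> (sqrt \<delta> * perp \<theta> x) ^ ?N * ?X"
        by (intro mult_right_mono power_mono) auto
      also note d1
      finally have "((2 ^ (j - 1)) ^ ?N * ?X)\<^sup>2 \<le> (C1 * sqrt \<delta> ^ (?N - 1))\<^sup>2"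
        by (intro power_mono) auto
      also have "\<dots> = C1\<^sup>2 * \<delta> ^ (?N - 1)" by (simp only: power_mult_distrib sq)
      also have "((2 ^ (j - 1)) ^ ?N * ?X)\<^sup>2 = (4 ^ ?N) ^ (j - 1) * ?X\<^sup>2"
      proof -
        have "(((2::real) ^ (j - 1)) ^ ?N)\<^sup>2 = ((2\<^sup>2) ^ ?N) ^ (j - 1)"
          by (simp only: power_mult[symmetric] mult_ac)
        then show ?thesis by (simp add: power_mult_distrib)
      qed
      \<comment> \<open>The factor \<open>4 ^ ?N\<close> restores one step, since minimality of
        \<open>j\<close> only gives \<open>perp \<theta> x > 2 ^ (j - 1) * ?D\<close>.\<close>
      finally have "4 ^ ?N * ((4 ^ ?N) ^ (j - 1) * ?X\<^sup>2) \<le> 4 ^ ?N * (C1\<^sup>2 * \<delta> ^ (?N - 1))"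
        by (intro mult_left_mono) auto
      also have "4 ^ ?N * ((4 ^ ?N) ^ (j - 1) * ?X\<^sup>2) = (4 ^ ?N) ^ j * ?X\<^sup>2"
        using False by (cases j) auto
      also have "4 ^ ?N * (C1\<^sup>2 * \<delta> ^ (?N - 1)) \<le> C * \<delta> ^ (?N - 1)"
        using \<delta> unfolding C_def mult.assoc[symmetric] by (intro mult_right_mono) auto
      finally show ?thesis by (simp add: power_one_over field_simps)
    qed
    also have "\<dots> \<le> C * \<delta> ^ (?N - 1) * envelope J ?D \<theta> x"
      using env \<open>C > 0\<close> \<delta> by (intro mult_left_mono) auto
    finally show ?thesis .
  qed
  ultimately show ?thesis by blast
qed

lemma extension_cmult: "extension (\<lambda>\<xi>. c * g \<xi>) x = c * extension g x"
  unfolding extension_eq mult.assoc by (rule integral_mult_right_zero)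

text \<open>On a cell only its own bump survives, so every piece of the square function is a
  coefficient times the extension of one bump. The envelope estimate applies with \<open>y A\<close>
  equal to the square of \<open>norm (c A)\<close>.\<close>

lemma square_function_bound:
  fixes K :: "nat \<Rightarrow> real" and a b p :: real
  assumes a: "0 < a" and b: "0 \<le> b" and dim: "2 \<le> CARD('n)"
    and p: "p = real CARD('n) / (real CARD('n) - 1)"
  shows "\<exists>C>0. \<forall>\<delta> (\<E> :: (real^'n) set set) \<phi> c J. 0 < \<delta> \<longrightarrow> \<delta> \<le> 1 \<longrightarrow> a * sqrt \<delta> \<le> 1 \<longrightarrow>
      cap_decomposition a b \<delta> \<E> \<longrightarrow> (\<forall>A\<in>\<E>. cell_bump a K \<delta> A (\<phi> A)) \<longrightarrow>
      1 / sqrt \<delta> \<le> 2 ^ J \<longrightarrow> 2 ^ J \<le> 2 / sqrt \<delta> \<longrightarrow>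
      (\<integral>\<^sup>+x\<in>ball 0 (1 / \<delta>). ennreal (square_function \<E> (\<lambda>\<xi>. \<Sum>A\<in>\<E>. c A * of_real (\<phi> A \<xi>)) x powr (2 * p)) \<partial>lborel)
      \<le> ennreal (C * sqrt \<delta> ^ (CARD('n) - 1) * (real J + 1) * (\<Sum>A\<in>\<E>. norm (c A) powr (2 * p)))"
proof -
  obtain C where C: "0 < C" "\<And>\<delta> A \<phi> (\<theta>::real^'n) x J. 0 < \<delta> \<Longrightarrow> \<delta> \<le> 1 \<Longrightarrow> cell_bump a K \<delta> A \<phi> \<Longrightarrow>
      A \<subseteq> cap \<theta> (b * sqrt \<delta>) \<Longrightarrow> norm \<theta> = 1 \<Longrightarrow> norm x \<le> 1 / \<delta> \<Longrightarrow> 1 / sqrt \<delta> \<le> 2 ^ J \<Longrightarrow>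
      (norm (extension (\<lambda>\<xi>. of_real (\<phi> \<xi>)) x))\<^sup>2 \<le> C * \<delta> ^ (CARD('n) - 1) * envelope J (1 / sqrt \<delta>) \<theta> x"
    using bump_envelope_bound[OF b dim, of a K] by blast
  have p0: "1 \<le> p" using dim unfolding p by (simp add: field_simps)
  \<comment> \<open>The envelope constant depends on the dimension and on \<open>a\<close>, but not
    on \<open>D\<close> or \<open>J\<close>, so it can be fixed before \<open>\<delta>\<close>. The
    maximum with 1 makes it positive.\<close>
  define ec where "ec = max 1 (separated_caps.envelope_const TYPE('n) a)"
  have bound: "(\<integral>\<^sup>+x\<in>ball 0 (1 / \<delta>). ennreal (square_function \<E> (\<lambda>\<xi>. \<Sum>A\<in>\<E>. c A * of_real (\<phi> A \<xi>)) x powr (2 * p)) \<partial>lborel)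
      \<le> ennreal (C powr p * ec * sqrt \<delta> ^ (CARD('n) - 1) * (real J + 1) * (\<Sum>A\<in>\<E>. norm (c A) powr (2 * p)))"
    if \<delta>: "0 < \<delta>" "\<delta> \<le> 1" and a\<delta>: "a * sqrt \<delta> \<le> 1" and dec: "cap_decomposition a b \<delta> \<E>"
      and bump: "\<forall>A\<in>\<E>. cell_bump a K \<delta> A (\<phi> A)" and Jle: "1 / sqrt \<delta> \<le> 2 ^ J" "2 ^ J \<le> 2 / sqrt \<delta>"
    for \<delta> \<phi> c J and \<E> :: "(real^'n) set set"
  proof -
    let ?N = "CARD('n)"
    define D where "D = 1 / sqrt \<delta>"
    have D_props: "1 \<le> D" "D\<^sup>2 = 1 / \<delta>" using \<delta> by (auto simp: D_def power_divide)
    have fin: "finite \<E>" and part: "partition_on (sphere 0 1) \<E>"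
      and "\<forall>A\<in>\<E>. \<exists>\<xi>\<in>sphere 0 1. cap \<xi> (a * sqrt \<delta>) \<subseteq> A \<and> A \<subseteq> cap \<xi> (b * sqrt \<delta>)"
      using dec by (auto simp: cap_decomposition_def)
    then obtain \<theta> where \<theta>: "\<And>A. A \<in> \<E> \<Longrightarrow> norm (\<theta> A) = 1"
      "\<And>A. A \<in> \<E> \<Longrightarrow> cap (\<theta> A) (a * sqrt \<delta>) \<subseteq> A" "\<And>A. A \<in> \<E> \<Longrightarrow> A \<subseteq> cap (\<theta> A) (b * sqrt \<delta>)"
      unfolding Bex_def bchoice_iff by (metis mem_sphere_0 dist_0_norm mem_sphere)
    have disj: "A \<inter> B = {}" if "A \<in> \<E>" "B \<in> \<E>" "A \<noteq> B" for A B
      using part that by (auto simp: partition_on_def disjoint_def)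
    have aD: "a / D = a * sqrt \<delta>" by (simp add: D_def)
    interpret separated_caps \<E> \<theta> a D J
    proof
      show "disjoint_family_on (\<lambda>A. cap (\<theta> A) (a / D)) \<E>"
        unfolding disjoint_family_on_def aD using \<theta>(2) disj by blast
      show "a \<le> D" using a\<delta> \<delta> by (simp add: D_def field_simps)
    qed (use fin \<theta>(1) a D_props(1) Jle dim in \<open>auto simp: D_def\<close>)
    have \<phi>0: "\<phi> A \<xi> = 0" if "A \<in> \<E>" "norm \<xi> = 1" "\<xi> \<notin> A" for A \<xi>
      using bump that by (auto simp: cell_bump_def)
    let ?g = "\<lambda>\<xi>. \<Sum>A\<in>\<E>. c A * complex_of_real (\<phi> A \<xi>)"
    have piece: "extension (\<lambda>\<xi>. ?g \<xi> * indicator A \<xi>) x = c A * extension (\<lambda>\<xi>. of_real (\<phi> A \<xi>)) x"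
      if A: "A \<in> \<E>" for A x
    proof -
      have "extension (\<lambda>\<xi>. ?g \<xi> * indicator A \<xi>) = extension (\<lambda>\<xi>. c A * of_real (\<phi> A \<xi>))"
      proof (rule extension_cong)
        fix \<xi> :: "real^'n" assume \<xi>: "norm \<xi> = 1"
        show "?g \<xi> * indicator A \<xi> = c A * of_real (\<phi> A \<xi>)"
        proof (cases "\<xi> \<in> A")
          case True
          have "\<phi> B \<xi> = 0" if "B \<in> \<E> - {A}" for B
            using \<phi>0[of B \<xi>] disj[of A B] that A True \<xi> by blast
          then show ?thesis using True A fin by (simp add: sum.remove[of _ A])
        next
          case False
          then show ?thesis using \<phi>0[OF A \<xi>] by simp
        qed
      qed
      then show ?thesis by (simp add: extension_cmult)
    qed
    let ?w = "\<lambda>x. \<Sum>A\<in>\<E>. (norm (c A))\<^sup>2 * envelope J D (\<theta> A) x"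
    have pt: "square_function \<E> ?g x powr (2 * p) \<le> C powr p * \<delta> ^ ?N * ?w x powr p" if x: "norm x \<le> 1 / \<delta>" for x
    proof -
      have "(square_function \<E> ?g x)\<^sup>2 = (\<Sum>A\<in>\<E>. (norm (c A))\<^sup>2 * (norm (extension (\<lambda>\<xi>. of_real (\<phi> A \<xi>)) x))\<^sup>2)"
        unfolding square_function_def by (simp add: piece norm_mult power_mult_distrib sum_nonneg)
      also have "\<dots> \<le> (\<Sum>A\<in>\<E>. (norm (c A))\<^sup>2 * (C * \<delta> ^ (?N - 1) * envelope J D (\<theta> A) x))"
      proof (intro sum_mono mult_left_mono)
        fix A assume A: "A \<in> \<E>"
        show "(norm (extension (\<lambda>\<xi>. of_real (\<phi> A \<xi>)) x))\<^sup>2 \<le> C * \<delta> ^ (?N - 1) * envelope J D (\<theta> A) x"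
          unfolding D_def using bump A by (intro C(2)[OF \<delta> _ \<theta>(3,1) x Jle(1)]) auto
      qed auto
      also have "\<dots> = C * \<delta> ^ (?N - 1) * ?w x" by (simp add: sum_distrib_left mult_ac)
      finally have "(square_function \<E> ?g x)\<^sup>2 powr p \<le> (C * \<delta> ^ (?N - 1) * ?w x) powr p"
        using p0 by (intro powr_mono2) auto
      moreover have "(square_function \<E> ?g x)\<^sup>2 powr p = square_function \<E> ?g x powr (2 * p)"
        by (simp add: square_function_def powr_powr[symmetric] sum_nonneg)
      moreover have "(\<delta> ^ (?N - 1)) powr p = \<delta> ^ ?N"
        using \<delta> dim unfolding p by (simp add: powr_realpow[symmetric] powr_powr of_nat_diff)
      ultimately show ?thesis by (simp add: powr_mult)
    qed
    have "(\<integral>\<^sup>+x\<in>ball 0 (1 / \<delta>). ennreal (square_function \<E> ?g x powr (2 * p)) \<partial>lborel)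
        \<le> (\<integral>\<^sup>+x\<in>ball 0 (1 / \<delta>). ennreal (C powr p * \<delta> ^ ?N) * ennreal (?w x powr p) \<partial>lborel)"
      using pt \<delta> by (intro nn_integral_mono) (auto simp: indicator_def ennreal_mult[symmetric] intro!: ennreal_leI)
    also have "\<dots> = ennreal (C powr p * \<delta> ^ ?N) * (\<integral>\<^sup>+x\<in>ball 0 (D\<^sup>2). ennreal (?w x powr p) \<partial>lborel)"
    proof -
      have w: "?w \<in> borel_measurable borel"
        by (intro borel_measurable_sum borel_measurable_times measurable_envelope) auto
      have "(\<lambda>x. ennreal (?w x powr p) * indicator (ball 0 (1 / \<delta>)) x) \<in> borel_measurable lborel"
        using borel_open[OF open_ball, of "0::real^'n" "1 / \<delta>"]
          measurable_compose[OF powr_real_measurable[OF w borel_measurable_const] measurable_ennreal]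
        by measurable
      then show ?thesis unfolding D_props(2) mult.assoc by (rule nn_integral_cmult)
    qed
    also have "\<dots> \<le> ennreal (C powr p * \<delta> ^ ?N) *
        ennreal (envelope_const * D ^ (?N + 1) * (real J + 1) * (\<Sum>A\<in>\<E>. (norm (c A))\<^sup>2 powr p))"
      by (intro mult_left_mono envelope_integral_le p) auto
    also have "\<dots> = ennreal (C powr p * \<delta> ^ ?N * (envelope_const * D ^ (?N + 1) * (real J + 1) * (\<Sum>A\<in>\<E>. (norm (c A))\<^sup>2 powr p)))"
      using \<delta> by (subst ennreal_mult') auto
    also have "\<dots> \<le> ennreal (C powr p * \<delta> ^ ?N * (ec * D ^ (?N + 1) * (real J + 1) * (\<Sum>A\<in>\<E>. (norm (c A))\<^sup>2 powr p)))"
      using \<delta> D_props(1) unfolding ec_def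
      by (intro ennreal_leI mult_left_mono mult_right_mono) (auto intro!: sum_nonneg)
    also have "(\<Sum>A\<in>\<E>. (norm (c A))\<^sup>2 powr p) = (\<Sum>A\<in>\<E>. norm (c A) powr (2 * p))"
      by (simp add: powr_powr[symmetric])
    also have "C powr p * \<delta> ^ ?N * (ec * D ^ (?N + 1) * (real J + 1) * (\<Sum>A\<in>\<E>. norm (c A) powr (2 * p)))
        = C powr p * ec * (\<delta> ^ ?N * D ^ (?N + 1)) * (real J + 1) * (\<Sum>A\<in>\<E>. norm (c A) powr (2 * p))"
      by (simp only: mult_ac)
    \<comment> \<open>In powers of \<open>sqrt \<delta>\<close> the exponents are
      \<open>2 * n - (n + 1) = n - 1\<close>: what remains is the order of magnitude of the measure
      of a cell.\<close>
    also have "\<delta> ^ ?N * D ^ (?N + 1) = sqrt \<delta> ^ (?N - 1)"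
    proof -
      define r where "r = sqrt \<delta>"
      have r: "0 < r" "\<delta> = r * r" "D = 1 / r" using \<delta> by (auto simp: r_def D_def)
      obtain m where m: "?N = Suc m" using dim by (cases ?N) auto
      show ?thesis unfolding r_def[symmetric] unfolding r(2,3) m
        using r(1) by (simp add: power_mult_distrib power_divide field_simps)
    qed
    finally show ?thesis .
  qed
  have "0 < C powr p * ec" using C(1) by (simp add: ec_def)
  with bound show ?thesis by blast
qed

subsection \<open>Restriction bounds and Taylor expansion\<close>

text \<open>Stated for q-th powers, in which contributions of different pieces add up.
  \<open>B\<close> is the q-th power of a bound for the operator norm, and it refers to one fixed
  radius \<open>R\<close>.\<close>

definition restriction_bound :: "'n::finite itself \<Rightarrow> real \<Rightarrow> real \<Rightarrow> real \<Rightarrow> bool" where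
  "restriction_bound (_ :: 'n::finite itself) q R B \<longleftrightarrow> (\<forall>g :: real^'n \<Rightarrow> complex. g \<in> borel_measurable sphere_measure \<longrightarrow>
    (\<integral>\<^sup>+x\<in>ball 0 R. ennreal (norm (extension g x) powr q) \<partial>lborel)
    \<le> ennreal B * (\<integral>\<^sup>+\<xi>. ennreal (norm (g \<xi>) powr q) \<partial>sphere_measure))"

lemma measurable_ident_sphere [measurable]: "(\<lambda>x. x) \<in> sphere_measure \<rightarrow>\<^sub>M borel"
  by (rule measurable_sphere_measure) simp

lemma measurable_extension:
  fixes g :: "'a::euclidean_space \<Rightarrow> complex"
  assumes g [measurable]: "g \<in> borel_measurable sphere_measure"
  shows "extension g \<in> borel_measurable borel"
proof -
  interpret finite_measure "sphere_measure :: 'a measure" by (rule finite_measure_sphere_measure)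
  have [measurable]: "snd \<in> borel \<Otimes>\<^sub>M (sphere_measure :: 'a measure) \<rightarrow>\<^sub>M borel"
    using measurable_compose[OF measurable_snd measurable_ident_sphere] by simp
  have "(\<lambda>(x, \<xi>). g \<xi> * character x \<xi>) \<in> borel_measurable (borel \<Otimes>\<^sub>M sphere_measure)"
    unfolding character_def case_prod_beta by measurable
  then show ?thesis
    unfolding extension_eq[abs_def] by (rule borel_measurable_lebesgue_integral)
qed

lemma measurable_character: "character x \<in> borel_measurable sphere_measure"
  by (intro continuous_measurable_sphere continuous_intros)

lemma integrable_times_character:
  "integrable sphere_measure g \<Longrightarrow> integrable sphere_measure (\<lambda>\<xi>. g \<xi> * character x \<xi>)"
  by (rule Bochner_Integration.integrable_bound[of _ g])
     (auto simp: norm_mult intro: borel_measurable_times measurable_character borel_measurable_integrable)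

lemma norm_extension_le:
  "integrable sphere_measure g \<Longrightarrow> norm (extension g x) \<le> (\<integral>\<xi>. norm (g \<xi>) \<partial>sphere_measure)"
  unfolding extension_eq
  using integral_norm_bound[of sphere_measure "\<lambda>\<xi>. g \<xi> * character x \<xi>"] by (simp add: norm_mult)

text \<open>Jensen's inequality with weights of total mass at most 1: each term pays the power of
  its own weight, and the loss does not depend on the number of terms.\<close>

lemma norm_powr_sum_le:
  fixes t :: "'i \<Rightarrow> complex"
  assumes "finite I" "1 \<le> q" "\<And>i. i \<in> I \<Longrightarrow> 0 < w i" "(\<Sum>i\<in>I. w i) \<le> 1"
  shows "norm (\<Sum>i\<in>I. t i) powr q \<le> (\<Sum>i\<in>I. (norm (t i) / w i) powr q)"
proof -
  have w1: "w i \<le> 1" if "i \<in> I" for i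
    using member_le_sum[of i I w] assms that by (force intro: less_imp_le)
  have "norm (\<Sum>i\<in>I. t i) powr q \<le> (\<Sum>i\<in>I. norm (t i)) powr q"
    using assms(2) by (intro powr_mono2 norm_sum) auto
  also have "(\<Sum>i\<in>I. norm (t i)) = (\<Sum>i\<in>I. (norm (t i) / w i) * w i)"
    using assms(3) by (intro sum.cong) (auto simp: less_imp_neq[symmetric])
  also have "\<dots> powr q \<le> (\<Sum>i\<in>I. w i) powr (q - 1) * (\<Sum>i\<in>I. (norm (t i) / w i) powr q * w i)"
    using assms by (intro sum_powr_Jensen) (auto intro: less_imp_le divide_nonneg_pos)
  also have "\<dots> \<le> 1 * (\<Sum>i\<in>I. (norm (t i) / w i) powr q * 1)"
  proof (rule mult_mono)
    show "(\<Sum>i\<in>I. w i) powr (q - 1) \<le> 1"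
      using powr_mono2[of "q - 1" "\<Sum>i\<in>I. w i" 1] assms by (simp add: sum_nonneg less_imp_le)
    show "(\<Sum>i\<in>I. (norm (t i) / w i) powr q * w i) \<le> (\<Sum>i\<in>I. (norm (t i) / w i) powr q * 1)"
      using w1 by (intro sum_mono mult_left_mono) auto
  qed (auto intro!: sum_nonneg mult_nonneg_nonneg assms(3)[THEN less_imp_le])
  finally show ?thesis by simp
qed

lemma norm_powr_add3_le:
  fixes u v w :: complex
  assumes "1 \<le> q"
  shows "norm (u + v + w) powr q \<le> 3 powr q * (norm u powr q + norm v powr q + norm w powr q)"
proof -
  define t where "t = (\<lambda>i::nat. if i = 0 then u else if i = 1 then v else w)"
  have "norm (\<Sum>i<3. t i) powr q \<le> (\<Sum>i<3. (norm (t i) / (1/3)) powr q)"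
    by (rule norm_powr_sum_le) (use assms in auto)
  then show ?thesis
    by (simp add: t_def numeral_3_eq_3 powr_mult distrib_left mult.commute)
qed

section \<open>Monomials indexed by words and the Taylor polynomial of the character\<close>

text \<open>Words, that is ordered lists of indices, replace multi-indices. The powers of an inner
  product then expand without multinomial coefficients.\<close>

primrec mon :: "real^'n \<Rightarrow> 'n list \<Rightarrow> real" where
  "mon x [] = 1"
| "mon x (i # w) = x $ i * mon x w"

lemma abs_mon_le: "\<bar>mon x w\<bar> \<le> norm x ^ length w"
  by (induction w) (auto simp: abs_mult intro!: mult_mono component_le_norm_cart)

lemma continuous_mon: "continuous_on S (\<lambda>x. mon x w)"
  by (induction w) (auto intro!: continuous_intros)

lemma finite_words: "finite {w :: 'n::finite list. length w = k}"
  using finite_lists_length_eq[of "UNIV :: 'n set" k] by simp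

lemma card_words: "card {w :: 'n::finite list. length w = k} = CARD('n) ^ k"
  using card_lists_length_eq[of "UNIV :: 'n set" k] by simp

lemma inner_power_eq: "(x \<bullet> z) ^ k = (\<Sum>w | length w = k. mon x w * mon z w)"
  for x z :: "real^'n"
proof (induction k)
  case 0
  have "{w :: 'n list. length w = 0} = {[]}" by auto
  then show ?case by simp
next
  case (Suc k)
  have img: "{w :: 'n list. length w = Suc k} = (\<lambda>(i, w). i # w) ` (UNIV \<times> {w. length w = k})"
    by (auto simp: length_Suc_conv image_iff)
  have "(\<Sum>w | length w = Suc k. mon x w * mon z w)
      = (\<Sum>(i, w)\<in>UNIV \<times> {w. length w = k}. (x $ i * z $ i) * (mon x w * mon z w))"
    unfolding img by (subst sum.reindex) (auto simp: inj_on_def intro!: sum.cong)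
  also have "\<dots> = (\<Sum>i\<in>UNIV. x $ i * z $ i) * (\<Sum>w | length w = k. mon x w * mon z w)"
    by (simp add: sum_product sum.cartesian_product)
  finally show ?case unfolding power_Suc Suc by (simp add: inner_vec_def)
qed

lemma measurable_mon [measurable]: "(\<lambda>x. mon x w) \<in> borel_measurable borel"
  by (intro borel_measurable_continuous_onI continuous_mon)

text \<open>The empty word is left out: the constant term of the expansion is what the approximation
  by bumps reproduces.\<close>

definition words :: "nat \<Rightarrow> 'n::finite list set" where
  "words m = (\<Union>k\<in>{1..m}. {w. length w = k})"

lemma sum_words: "(\<Sum>w\<in>words m. f w) = (\<Sum>k=1..m. \<Sum>w | length w = k. f w)"
  unfolding words_def by (rule sum.UNION_disjoint) (auto simp: finite_words)

lemma finite_words_le: "finite (words m)"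
  by (simp add: words_def finite_words)

text \<open>Taylor polynomial of \<open>exp (- 2 \<pi> \<i> x \<bullet> z) - 1\<close>, in which \<open>x\<close> and \<open>z\<close> separate.\<close>

definition taylor_coeff :: "real^'n \<Rightarrow> 'n list \<Rightarrow> complex" where
  "taylor_coeff x w = (- 2 * of_real pi * \<i>) ^ length w / fact (length w) * of_real (mon x w)"

definition taylor :: "nat \<Rightarrow> real^'n \<Rightarrow> real^'n \<Rightarrow> complex" where
  "taylor m x z = (\<Sum>w\<in>words m. taylor_coeff x w * of_real (mon z w))"

lemma taylor_eq: "taylor m x z = (\<Sum>k=1..m. (- 2 * of_real pi * \<i> * of_real (x \<bullet> z)) ^ k / fact k)"
  unfolding taylor_def taylor_coeff_def sum_words power_mult_distrib of_real_power[symmetric] inner_power_eq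
  by (simp add: sum_distrib_left sum_divide_distrib mult_ac)

lemma norm_taylor_coeff_le: "norm (taylor_coeff x w) \<le> (2 * pi * norm x) ^ length w"
proof -
  have "norm (taylor_coeff x w) = (2 * pi) ^ length w * \<bar>mon x w\<bar> / fact (length w)"
    by (simp add: taylor_coeff_def norm_mult norm_divide norm_power)
  also have "\<dots> \<le> (2 * pi) ^ length w * \<bar>mon x w\<bar> / 1"
    by (intro divide_left_mono fact_ge_1) auto
  also have "\<dots> \<le> (2 * pi * norm x) ^ length w"
    using abs_mon_le[of x w] by (simp add: power_mult_distrib mult_left_mono)
  finally show ?thesis .
qed

lemma taylor_remainder:
  assumes "2 * pi * \<bar>x \<bullet> z\<bar> \<le> 1"
  shows "norm (character x z - 1 - taylor m x z) \<le> 1 / fact m"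
proof -
  let ?s = "- 2 * of_real pi * \<i> * of_real (x \<bullet> z) :: complex"
  have "(\<Sum>k\<le>m. ?s ^ k / fact k) = 1 + taylor m x z"
    unfolding taylor_eq atMost_atLeast0 by (subst sum.atLeast_Suc_atMost) auto
  then have "norm (character x z - 1 - taylor m x z) = norm (exp ?s - (\<Sum>k\<le>m. ?s ^ k / fact k))"
    by (simp add: character_def algebra_simps)
  \<comment> \<open>The exponent is purely imaginary, so the exponential factor in the remainder
    equals 1.\<close>
  also have "\<dots> \<le> exp \<bar>Re ?s\<bar> * norm ?s ^ Suc m / fact m"
    using Taylor_exp[of ?s m] by simp
  also have "\<dots> = (2 * pi * \<bar>x \<bullet> z\<bar>) ^ Suc m / fact m"
    by (simp add: norm_mult norm_power)
  also have "\<dots> \<le> 1 / fact m"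
    by (intro divide_right_mono power_le_one assms) auto
  finally show ?thesis .
qed

lemma continuous_taylor: "continuous_on S (\<lambda>z. taylor m x z)"
  unfolding taylor_def by (intro continuous_intros continuous_mon)

text \<open>The extension is bounded by the integral of \<open>norm (g \<xi>)\<close>, which the
  power mean inequality controls, and the ball has finite volume. The bound may depend badly on
  \<open>R\<close>: it only starts the iteration.\<close>

lemma restriction_bound_trivial:
  assumes q: "1 \<le> q"
  shows "\<exists>B>0. restriction_bound TYPE('n::finite) q R B"
proof -
  interpret finite_measure "sphere_measure :: (real^'n) measure" by (rule finite_measure_sphere_measure)
  define s where "s = measure (sphere_measure :: (real^'n) measure) (sphere 0 1)"
  define b where "b = measure lborel (ball (0::real^'n) R)"
  have b: "emeasure lborel (ball (0::real^'n) R) = ennreal b"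
    unfolding b_def using emeasure_bounded_finite[of "ball (0::real^'n) R"] by (intro emeasure_eq_ennreal_measure) auto
  define B where "B = 1 + b * s powr (q - 1)"
  have B: "0 < B" unfolding B_def b_def by (intro add_pos_nonneg mult_nonneg_nonneg) auto
  have "(\<integral>\<^sup>+x\<in>ball 0 R. ennreal (norm (extension g x) powr q) \<partial>lborel)
    \<le> ennreal B * (\<integral>\<^sup>+\<xi>. ennreal (norm (g \<xi>) powr q) \<partial>sphere_measure)"
    if g: "g \<in> borel_measurable sphere_measure" for g :: "real^'n \<Rightarrow> complex"
  proof (cases "(\<integral>\<^sup>+\<xi>. ennreal (norm (g \<xi>) powr q) \<partial>sphere_measure)")
    case top
    then show ?thesis using B by (simp add: ennreal_mult_top)
  next
    case (real I)
    have sp: "(\<integral>\<^sup>+\<xi>\<in>sphere 0 1. h \<xi> \<partial>sphere_measure) = (\<integral>\<^sup>+\<xi>. h \<xi> \<partial>sphere_measure)" for h :: "real^'n \<Rightarrow> ennreal"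
      by (intro nn_integral_cong) auto
    obtain U where U: "0 \<le> U" "(\<integral>\<^sup>+\<xi>\<in>sphere 0 1. ennreal (norm (g \<xi>)) \<partial>sphere_measure) = ennreal U"
      "U powr q \<le> s powr (q - 1) * I"
      unfolding s_def
    proof (rule nn_integral_power_mean[OF q])
      show "(\<lambda>\<xi>. norm (g \<xi>)) \<in> borel_measurable sphere_measure" using g by measurable
      show "(\<integral>\<^sup>+\<xi>\<in>sphere 0 1. ennreal (norm (g \<xi>) powr q) \<partial>sphere_measure) = ennreal I"
        unfolding sp using real by simp
      show "sphere 0 1 \<in> sets (sphere_measure :: (real^'n) measure)"
        using sets.top[of "sphere_measure :: (real^'n) measure"] by simp
    qed (use real in \<open>auto simp: less_top[symmetric]\<close>)
    have int: "integrable sphere_measure g"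
      using g U(2) unfolding sp by (intro integrableI_bounded) auto
    have "(\<integral>\<xi>. norm (g \<xi>) \<partial>sphere_measure) = U"
      using U unfolding sp by (intro integral_eq_nn_integral[THEN trans]) (use g in auto)
    then have le: "norm (extension g x) powr q \<le> s powr (q - 1) * I" for x
      using norm_extension_le[OF int, of x] U(3) q powr_mono2[of q "norm (extension g x)" U] by simp
    have "(\<integral>\<^sup>+x\<in>ball 0 R. ennreal (norm (extension g x) powr q) \<partial>lborel)
        \<le> (\<integral>\<^sup>+x. ennreal (s powr (q - 1) * I) * indicator (ball 0 R) x \<partial>(lborel :: (real^'n) measure))"
      using le by (intro nn_integral_mono mult_right_mono ennreal_leI) auto
    also have "\<dots> = ennreal (s powr (q - 1) * I) * ennreal b"
      by (subst nn_integral_cmult_indicator) (auto simp: b)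
    also have "\<dots> \<le> ennreal (B * I)"
    proof -
      have "s powr (q - 1) * I * b \<le> B * I"
        using real(1) by (simp add: B_def algebra_simps)
      then show ?thesis using real(1) by (simp add: ennreal_mult'[symmetric] b_def ennreal_leI)
    qed
    also have "\<dots> = ennreal B * ennreal I" using B real(1) by (simp add: ennreal_mult)
    finally show ?thesis using real by simp
  qed
  with B show ?thesis unfolding restriction_bound_def by blast
qed

subsection \<open>Absorbing the error of a cell approximation\<close>

text \<open>\<open>V\<close> stands for \<open>\<delta> powr ((n-1)/2)\<close>, the order of magnitude of the measure of every cell.\<close>

locale bump_cells =
  fixes E :: "(real^'n) set set" and \<phi> :: "(real^'n) set \<Rightarrow> real^'n \<Rightarrow> real"
    and V d R q c0 C0 M :: real
  assumes fin: "finite E" and part: "partition_on (sphere 0 1) E"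
    and sets_cell [measurable]: "A \<in> E \<Longrightarrow> A \<in> sets sphere_measure"
    and diam: "A \<in> E \<Longrightarrow> \<xi> \<in> A \<Longrightarrow> \<eta> \<in> A \<Longrightarrow> norm (\<xi> - \<eta>) \<le> d"
    and pos: "0 < V" "0 < c0" "0 < C0" "0 \<le> M" "0 < R" "0 \<le> d" and q: "1 \<le> q"
    and vol: "A \<in> E \<Longrightarrow> measure sphere_measure A \<le> C0 * V"
    and bump_measurable [measurable]: "A \<in> E \<Longrightarrow> \<phi> A \<in> borel_measurable sphere_measure"
    and bump_range: "A \<in> E \<Longrightarrow> norm \<xi> = 1 \<Longrightarrow> 0 \<le> \<phi> A \<xi> \<and> \<phi> A \<xi> \<le> 1"
    and bump_support: "A \<in> E \<Longrightarrow> norm \<xi> = 1 \<Longrightarrow> \<xi> \<notin> A \<Longrightarrow> \<phi> A \<xi> = 0"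
    and mass: "A \<in> E \<Longrightarrow> c0 * V \<le> (\<integral>\<xi>. \<phi> A \<xi> \<partial>sphere_measure)"
    and combination_bound: "(\<integral>\<^sup>+x\<in>ball 0 R. ennreal (norm (extension (\<lambda>\<xi>. \<Sum>A\<in>E. c A * of_real (\<phi> A \<xi>)) x) powr q) \<partial>lborel)
      \<le> ennreal (M * V * (\<Sum>A\<in>E. norm (c A) powr q))"
    and small: "2 * pi * (R * d) \<le> 1"
begin

lemma disjoint_cells: "A \<in> E \<Longrightarrow> B \<in> E \<Longrightarrow> \<xi> \<in> A \<Longrightarrow> \<xi> \<in> B \<Longrightarrow> A = B"
  using partition_onD2[OF part] unfolding disjoint_def by blast

lemma cell_on_sphere: "A \<in> E \<Longrightarrow> \<xi> \<in> A \<Longrightarrow> norm \<xi> = 1"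
  using partition_onD1[OF part] by (metis UnionI mem_sphere_0)

lemma sum_single_cell:
  assumes "A \<in> E" "\<xi> \<in> A" "\<And>B. B \<in> E \<Longrightarrow> \<xi> \<notin> B \<Longrightarrow> f B = 0"
  shows "(\<Sum>B\<in>E. f B) = f A"
proof -
  have "(\<Sum>B\<in>E - {A}. f B) = 0"
    using assms disjoint_cells by (intro sum.neutral ballI) blast
  then show ?thesis using assms(1) fin by (simp add: sum.remove)
qed

lemma sum_indicator_cells:
  assumes "norm \<xi> = 1"
  shows "(\<Sum>A\<in>E. indicator A \<xi>) = (1 :: 'b::semiring_1)"
proof -
  obtain A where A: "A \<in> E" "\<xi> \<in> A"
    using partition_onD1[OF part] assms by (metis UnionE mem_sphere_0)
  have "(\<Sum>B\<in>E. indicator B \<xi>) = (indicator A \<xi> :: 'b)"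
    by (rule sum_single_cell[OF A]) auto
  then show ?thesis using A by simp
qed

lemma nn_integral_cells:
  assumes [measurable]: "f \<in> borel_measurable sphere_measure"
  shows "(\<Sum>A\<in>E. \<integral>\<^sup>+\<xi>\<in>A. f \<xi> \<partial>sphere_measure) = (\<integral>\<^sup>+\<xi>. f \<xi> \<partial>sphere_measure)"
proof -
  have "(\<Sum>A\<in>E. \<integral>\<^sup>+\<xi>\<in>A. f \<xi> \<partial>sphere_measure) = (\<integral>\<^sup>+\<xi>. (\<Sum>A\<in>E. f \<xi> * indicator A \<xi>) \<partial>sphere_measure)"
    by (rule nn_integral_sum[symmetric]) measurable
  also have "\<dots> = (\<integral>\<^sup>+\<xi>. f \<xi> \<partial>sphere_measure)"
    by (rule nn_integral_cong) (simp add: sum_distrib_left[symmetric] sum_indicator_cells)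
  finally show ?thesis .
qed

definition weight :: "(real^'n) set \<Rightarrow> real" where "weight A = (\<integral>\<xi>. \<phi> A \<xi> \<partial>sphere_measure)"

lemma weight_ge: "A \<in> E \<Longrightarrow> c0 * V \<le> weight A" "A \<in> E \<Longrightarrow> 0 < weight A"
  using mass less_le_trans[OF mult_pos_pos[OF pos(2,1)] mass] unfolding weight_def by auto

lemma integrable_bump: "A \<in> E \<Longrightarrow> integrable sphere_measure (\<phi> A)"
  by (rule integrable_sphere_bounded[where B = 1]) (use bump_range in auto)

text \<open>The constant of the cell averages: the power mean inequality gives
  \<open>(C0 * V) powr (q - 1)\<close>, division by the mass of the bump gives
  \<open>(c0 * V) powr (- q)\<close>, and with one further factor \<open>V\<close> the scale
  cancels.\<close>

definition \<kappa> :: real where "\<kappa> = C0 powr (q - 1) / c0 powr q"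

section \<open>Cell averages and moments of one function, and the error of the approximation\<close>

context
  fixes g :: "real^'n \<Rightarrow> complex" and I :: real
  assumes g [measurable]: "g \<in> borel_measurable sphere_measure"
    and I: "(\<integral>\<^sup>+\<xi>. ennreal (norm (g \<xi>) powr q) \<partial>sphere_measure) = ennreal I" "0 \<le> I"
begin

definition cellI :: "(real^'n) set \<Rightarrow> real" where
  "cellI A = enn2real (\<integral>\<^sup>+\<xi>\<in>A. ennreal (norm (g \<xi>) powr q) \<partial>sphere_measure)"

definition cellU :: "(real^'n) set \<Rightarrow> real" where
  "cellU A = enn2real (\<integral>\<^sup>+\<xi>\<in>A. ennreal (norm (g \<xi>)) \<partial>sphere_measure)"

lemma cellI:
  "A \<in> E \<Longrightarrow> (\<integral>\<^sup>+\<xi>\<in>A. ennreal (norm (g \<xi>) powr q) \<partial>sphere_measure) = ennreal (cellI A)"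
  "0 \<le> cellI A" "(\<Sum>A\<in>E. cellI A) = I"
proof -
  show 1: "(\<integral>\<^sup>+\<xi>\<in>A. ennreal (norm (g \<xi>) powr q) \<partial>sphere_measure) = ennreal (cellI A)" if "A \<in> E" for A
  proof -
    have "(\<integral>\<^sup>+\<xi>\<in>A. ennreal (norm (g \<xi>) powr q) \<partial>sphere_measure) \<le> ennreal I"
      unfolding I(1)[symmetric] by (intro nn_integral_mono) (auto simp: indicator_def)
    also have "\<dots> < top" by simp
    finally show ?thesis unfolding cellI_def by simp
  qed
  show 2: "0 \<le> cellI A" for A by (simp add: cellI_def)
  have "ennreal (\<Sum>A\<in>E. cellI A) = (\<Sum>A\<in>E. \<integral>\<^sup>+\<xi>\<in>A. ennreal (norm (g \<xi>) powr q) \<partial>sphere_measure)"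
    using 1 2 by (subst sum_ennreal[symmetric]) auto
  also have "\<dots> = ennreal I" unfolding I(1)[symmetric] by (rule nn_integral_cells) measurable
  finally show "(\<Sum>A\<in>E. cellI A) = I" using I(2) 2 by (simp add: sum_nonneg)
qed

lemma cellU:
  assumes A: "A \<in> E"
  shows "(\<integral>\<^sup>+\<xi>\<in>A. ennreal (norm (g \<xi>)) \<partial>sphere_measure) = ennreal (cellU A)"
    "0 \<le> cellU A" "cellU A powr q \<le> (C0 * V) powr (q - 1) * cellI A"
    "integrable sphere_measure (\<lambda>\<xi>. norm (g \<xi>) * indicator A \<xi>)"
    "(\<integral>\<xi>. norm (g \<xi>) * indicator A \<xi> \<partial>sphere_measure) = cellU A"
proof -
  interpret finite_measure "sphere_measure :: (real^'n) measure" by (rule finite_measure_sphere_measure)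
  obtain U where U: "0 \<le> U" "(\<integral>\<^sup>+\<xi>\<in>A. ennreal (norm (g \<xi>)) \<partial>sphere_measure) = ennreal U"
    "U powr q \<le> measure sphere_measure A powr (q - 1) * cellI A"
    by (rule nn_integral_power_mean[OF q _ _ sets_cell[OF A] _ cellI(1)[OF A] cellI(2), rotated 3])
       (auto simp: less_top[symmetric])
  have eq: "cellU A = U" unfolding cellU_def U(2) using U(1) by simp
  show 1: "(\<integral>\<^sup>+\<xi>\<in>A. ennreal (norm (g \<xi>)) \<partial>sphere_measure) = ennreal (cellU A)" "0 \<le> cellU A"
    using U eq by auto
  have "measure sphere_measure A powr (q - 1) * cellI A \<le> (C0 * V) powr (q - 1) * cellI A"
    using vol[OF A] q cellI(2) by (intro mult_right_mono powr_mono2) auto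
  then show "cellU A powr q \<le> (C0 * V) powr (q - 1) * cellI A" using U(3) eq by simp
  have nn: "(\<integral>\<^sup>+\<xi>. ennreal (norm (g \<xi>) * indicator A \<xi>) \<partial>sphere_measure) = ennreal (cellU A)"
    unfolding 1(1)[symmetric] by (intro nn_integral_cong) (auto simp: indicator_def)
  have m: "(\<lambda>\<xi>. norm (g \<xi>) * indicator A \<xi>) \<in> borel_measurable sphere_measure"
    using A by measurable
  show "integrable sphere_measure (\<lambda>\<xi>. norm (g \<xi>) * indicator A \<xi>)"
    using m nn by (intro integrableI_nn_integral_finite[where x = "cellU A"]) (auto simp: 1)
  show "(\<integral>\<xi>. norm (g \<xi>) * indicator A \<xi> \<partial>sphere_measure) = cellU A"
    using m nn 1(2) by (subst integral_eq_nn_integral) auto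
qed

lemma cell_integral:
  assumes A: "A \<in> E" and [measurable]: "h \<in> borel_measurable sphere_measure"
    and H: "\<And>\<xi>. \<xi> \<in> A \<Longrightarrow> norm (h \<xi>) \<le> H"
  shows "integrable sphere_measure (\<lambda>\<xi>. g \<xi> * indicator A \<xi> * h \<xi>)"
    "norm (\<integral>\<xi>. g \<xi> * indicator A \<xi> * h \<xi> \<partial>sphere_measure) \<le> H * cellU A"
proof -
  have int: "integrable sphere_measure (\<lambda>\<xi>. H * (norm (g \<xi>) * indicator A \<xi>))"
    by (intro integrable_mult_right cellU A)
  have le: "norm (g \<xi> * indicator A \<xi> * h \<xi>) \<le> H * (norm (g \<xi>) * indicator A \<xi>)" for \<xi>
    using mult_left_mono[OF H[of \<xi>] norm_ge_zero[of "g \<xi>"]]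
    by (cases "\<xi> \<in> A") (auto simp: norm_mult mult.commute)
  have m: "(\<lambda>\<xi>. g \<xi> * indicator A \<xi> * h \<xi>) \<in> borel_measurable sphere_measure"
    using A by measurable
  show i: "integrable sphere_measure (\<lambda>\<xi>. g \<xi> * indicator A \<xi> * h \<xi>)"
    by (intro Bochner_Integration.integrable_bound[OF int m] AE_I2)
       (simp only: real_norm_def, rule order_trans[OF le abs_ge_self])
  show "norm (\<integral>\<xi>. g \<xi> * indicator A \<xi> * h \<xi> \<partial>sphere_measure) \<le> H * cellU A"
    using Bochner_Integration.integral_norm_bound_integral[OF i int le] cellU(5)[OF A] by simp
qed

lemma cellU_weight_powr:
  assumes A: "A \<in> E"
  shows "(cellU A / weight A) powr q * V \<le> \<kappa> * cellI A"
proof -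
  have "(cellU A / weight A) powr q \<le> (cellU A / (c0 * V)) powr q"
    using weight_ge[OF A] cellU(2)[OF A] q pos
    by (intro powr_mono2 divide_left_mono mult_pos_pos) auto
  also have "\<dots> = cellU A powr q / (c0 * V) powr q"
    using cellU(2)[OF A] pos by (simp add: powr_divide)
  also have "\<dots> \<le> (C0 * V) powr (q - 1) * cellI A / (c0 * V) powr q"
    by (intro divide_right_mono cellU A) auto
  also have "\<dots> * V = \<kappa> * cellI A"
    using pos by (simp add: \<kappa>_def powr_mult powr_diff field_simps)
  finally show ?thesis using pos by (simp add: mult_right_mono)
qed

definition approximant :: "real^'n \<Rightarrow> complex" where
  "approximant \<xi> = (\<Sum>A\<in>E. (\<integral>\<eta>. g \<eta> * indicator A \<eta> \<partial>sphere_measure) / of_real (weight A) * of_real (\<phi> A \<xi>))"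

lemma approximant_bound:
  "(\<integral>\<^sup>+x\<in>ball 0 R. ennreal (norm (extension approximant x) powr q) \<partial>lborel) \<le> ennreal (M * \<kappa> * I)"
proof -
  let ?c = "\<lambda>A. (\<integral>\<eta>. g \<eta> * indicator A \<eta> \<partial>sphere_measure) / complex_of_real (weight A)"
  have "V * norm (?c A) powr q \<le> \<kappa> * cellI A" if A: "A \<in> E" for A
  proof -
    have "norm (\<integral>\<eta>. g \<eta> * indicator A \<eta> \<partial>sphere_measure) \<le> cellU A"
      using cell_integral(2)[OF A, of "\<lambda>_. 1" 1] by simp
    then have "norm (?c A) \<le> cellU A / weight A"
      using weight_ge(2)[OF A] by (simp add: norm_divide divide_right_mono)
    then have "norm (?c A) powr q * V \<le> (cellU A / weight A) powr q * V"
      using q pos by (intro mult_right_mono powr_mono2) auto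
    then show ?thesis using cellU_weight_powr[OF A] by (simp add: mult.commute)
  qed
  then have "(\<Sum>A\<in>E. V * norm (?c A) powr q) \<le> (\<Sum>A\<in>E. \<kappa> * cellI A)" by (rule sum_mono)
  then have le: "M * V * (\<Sum>A\<in>E. norm (?c A) powr q) \<le> M * \<kappa> * I"
    using pos(4) unfolding sum_distrib_left[symmetric] cellI(3) by (simp add: mult.assoc mult_left_mono)
  show ?thesis
    unfolding approximant_def[abs_def] by (rule order_trans[OF combination_bound ennreal_leI[OF le]])
qed

text \<open>The moment of \<open>g\<close> on a cell about the variable point \<open>\<eta>\<close>,
  spread over the cell by the normalised bump. The empty word would give the approximant. For other
  words the moment varies with \<open>\<eta>\<close>, so this need not be a combination of bumps,
  and its extension is estimated by the assumed restriction bound.\<close>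

definition corrector :: "'n list \<Rightarrow> real^'n \<Rightarrow> complex" where
  "corrector w \<eta> = (\<Sum>A\<in>E. of_real (\<phi> A \<eta> / weight A)
     * (\<integral>\<xi>. g \<xi> * indicator A \<xi> * of_real (mon (\<xi> - \<eta>) w) \<partial>sphere_measure))"

lemma measurable_mon_diff: "(\<lambda>\<xi>. of_real (mon (\<xi> - \<eta>) w) :: complex) \<in> borel_measurable sphere_measure"
  by (intro continuous_measurable_sphere continuous_intros continuous_on_compose2[OF continuous_mon[of UNIV]]) auto

lemma measurable_corrector: "corrector w \<in> borel_measurable sphere_measure"
proof -
  interpret finite_measure "sphere_measure :: (real^'n) measure" by (rule finite_measure_sphere_measure)
  let ?S = "sphere_measure :: (real^'n) measure"
  have [measurable]: "(\<lambda>x. fst x) \<in> ?S \<Otimes>\<^sub>M ?S \<rightarrow>\<^sub>M borel" "(\<lambda>x. snd x) \<in> ?S \<Otimes>\<^sub>M ?S \<rightarrow>\<^sub>M borel"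
    using measurable_compose[OF measurable_fst measurable_ident_sphere]
      measurable_compose[OF measurable_snd measurable_ident_sphere] by auto
  have "(\<lambda>\<eta>. \<integral>\<xi>. g \<xi> * indicator A \<xi> * of_real (mon (\<xi> - \<eta>) w) \<partial>?S) \<in> borel_measurable ?S" if A: "A \<in> E" for A
  proof (rule borel_measurable_lebesgue_integral)
    show "(\<lambda>(\<eta>, \<xi>). g \<xi> * indicator A \<xi> * of_real (mon (\<xi> - \<eta>) w)) \<in> borel_measurable (?S \<Otimes>\<^sub>M ?S)"
      unfolding case_prod_beta using A by measurable
  qed
  moreover have "(\<lambda>\<eta>. complex_of_real (\<phi> A \<eta> / weight A)) \<in> borel_measurable ?S" if A: "A \<in> E" for A
    using A by measurable
  ultimately show ?thesis
    unfolding corrector_def[abs_def] by (intro borel_measurable_sum borel_measurable_times)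
qed

lemma corrector_on_cell:
  assumes A: "A \<in> E" and \<eta>: "\<eta> \<in> A"
  shows "corrector w \<eta> = of_real (\<phi> A \<eta> / weight A)
     * (\<integral>\<xi>. g \<xi> * indicator A \<xi> * of_real (mon (\<xi> - \<eta>) w) \<partial>sphere_measure)"
  unfolding corrector_def
  by (rule sum_single_cell[OF A \<eta>]) (use bump_support cell_on_sphere[OF A \<eta>] in auto)

text \<open>A monomial of degree k in \<open>\<xi> - \<eta>\<close> is at most \<open>d ^ k\<close>
  on a cell. This is the smallness that pays for the growth \<open>R ^ k\<close> of the Taylor
  coefficients on the ball.\<close>

lemma norm_corrector_le:
  assumes A: "A \<in> E" and \<eta>: "\<eta> \<in> A"
  shows "norm (corrector w \<eta>) \<le> d ^ length w * (cellU A / weight A)"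
proof -
  have "norm (complex_of_real (mon (\<xi> - \<eta>) w)) \<le> d ^ length w" if "\<xi> \<in> A" for \<xi>
    unfolding norm_of_real
    using abs_mon_le[of "\<xi> - \<eta>" w] power_mono[OF diam[OF A that \<eta>] norm_ge_zero, of "length w"] by linarith
  then have "norm (\<integral>\<xi>. g \<xi> * indicator A \<xi> * of_real (mon (\<xi> - \<eta>) w) \<partial>sphere_measure) \<le> d ^ length w * cellU A"
    by (rule cell_integral(2)[OF A measurable_mon_diff])
  moreover have "\<bar>\<phi> A \<eta> / weight A\<bar> \<le> 1 / weight A"
    using bump_range[OF A cell_on_sphere[OF A \<eta>]] weight_ge(2)[OF A] by (simp add: divide_right_mono)
  ultimately have "norm (corrector w \<eta>) \<le> (1 / weight A) * (d ^ length w * cellU A)"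
    unfolding corrector_on_cell[OF A \<eta>] norm_mult norm_of_real
    using weight_ge(2)[OF A] by (intro mult_mono) auto
  then show ?thesis by simp
qed

lemma corrector_bound:
  "(\<integral>\<^sup>+\<eta>. ennreal (norm (corrector w \<eta>) powr q) \<partial>sphere_measure) \<le> ennreal (C0 * \<kappa> * (d ^ length w) powr q * I)"
proof -
  interpret finite_measure "sphere_measure :: (real^'n) measure" by (rule finite_measure_sphere_measure)
  let ?D = "(d ^ length w) powr q"
  have [measurable]: "corrector w \<in> borel_measurable sphere_measure" by (rule measurable_corrector)
  have cell: "(\<integral>\<^sup>+\<eta>\<in>A. ennreal (norm (corrector w \<eta>) powr q) \<partial>sphere_measure) \<le> ennreal (C0 * \<kappa> * ?D * cellI A)"
    if A: "A \<in> E" for A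
  proof -
    let ?u = "(cellU A / weight A) powr q"
    have "(\<integral>\<^sup>+\<eta>\<in>A. ennreal (norm (corrector w \<eta>) powr q) \<partial>sphere_measure)
        \<le> (\<integral>\<^sup>+\<eta>. ennreal (?D * ?u) * indicator A \<eta> \<partial>sphere_measure)"
    proof (intro nn_integral_mono)
      fix \<eta>
      show "ennreal (norm (corrector w \<eta>) powr q) * indicator A \<eta> \<le> ennreal (?D * ?u) * indicator A \<eta>"
      proof (cases "\<eta> \<in> A")
        case True
        have "norm (corrector w \<eta>) powr q \<le> (d ^ length w * (cellU A / weight A)) powr q"
          using norm_corrector_le[OF A True] q by (intro powr_mono2) auto
        also have "\<dots> = ?D * ?u"
          by (rule powr_mult)
        finally show ?thesis by (intro mult_right_mono ennreal_leI) auto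
      qed simp
    qed
    also have "\<dots> = ennreal (?D * ?u) * ennreal (measure sphere_measure A)"
      using A by (subst nn_integral_cmult_indicator) (auto simp: emeasure_eq_measure)
    also have "\<dots> = ennreal (?D * ?u * measure sphere_measure A)"
      by (simp add: ennreal_mult)
    also have "\<dots> \<le> ennreal (C0 * \<kappa> * ?D * cellI A)"
    proof (rule ennreal_leI)
      have "?D * ?u * measure sphere_measure A \<le> ?D * ?u * (C0 * V)"
        by (intro mult_left_mono vol A) auto
      also have "\<dots> = C0 * ?D * (?u * V)" by (simp only: mult_ac)
      also have "\<dots> \<le> C0 * ?D * (\<kappa> * cellI A)"
        using pos by (intro mult_left_mono cellU_weight_powr A) auto
      finally show "?D * ?u * measure sphere_measure A \<le> C0 * \<kappa> * ?D * cellI A" by (simp only: mult_ac)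
    qed
    finally show ?thesis .
  qed
  have "(\<integral>\<^sup>+\<eta>. ennreal (norm (corrector w \<eta>) powr q) \<partial>sphere_measure)
      = (\<Sum>A\<in>E. \<integral>\<^sup>+\<eta>\<in>A. ennreal (norm (corrector w \<eta>) powr q) \<partial>sphere_measure)"
    by (rule nn_integral_cells[symmetric]) measurable
  also have "\<dots> \<le> (\<Sum>A\<in>E. ennreal (C0 * \<kappa> * ?D * cellI A))"
    by (rule sum_mono) (rule cell)
  also have "\<dots> = ennreal (\<Sum>A\<in>E. C0 * \<kappa> * ?D * cellI A)"
    using pos cellI(2) by (intro sum_ennreal mult_nonneg_nonneg) (auto simp: \<kappa>_def)
  also have "(\<Sum>A\<in>E. C0 * \<kappa> * ?D * cellI A) = C0 * \<kappa> * ?D * I"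
    by (simp add: sum_distrib_left[symmetric] cellI(3))
  finally show ?thesis .
qed

lemma integrable_corrector: "integrable sphere_measure (corrector w)"
proof (rule integrable_sphere_bounded[OF measurable_corrector])
  fix \<eta> :: "real^'n" assume \<eta>: "norm \<eta> = 1"
  obtain A where A: "A \<in> E" "\<eta> \<in> A"
    using partition_onD1[OF part] \<eta> by (metis UnionE mem_sphere_0)
  have "norm (corrector w \<eta>) \<le> d ^ length w * (cellU A / weight A)"
    by (rule norm_corrector_le[OF A])
  also have "\<dots> \<le> (\<Sum>A\<in>E. d ^ length w * (cellU A / weight A))"
    using fin A(1)
  proof (intro member_le_sum[of A E "\<lambda>A. d ^ length w * (cellU A / weight A)"])
    fix B assume "B \<in> E - {A}"
    then show "0 \<le> d ^ length w * (cellU B / weight B)"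
      using pos(6) cellU(2)[of B] weight_ge(2)[of B] by simp
  qed
  finally show "norm (corrector w \<eta>) \<le> (\<Sum>A\<in>E. d ^ length w * (cellU A / weight A))" .
qed

lemma integrable_approximant: "integrable sphere_measure approximant"
  unfolding approximant_def[abs_def]
  by (intro Bochner_Integration.integrable_sum integrable_mult_right integrable_of_real integrable_bump)

lemma character_diff: "character x \<xi> = character x \<eta> * character x (\<xi> - \<eta>)"
  by (simp add: character_def inner_diff_right exp_add[symmetric] algebra_simps)

lemma taylor_cell_integral:
  assumes A: "A \<in> E"
  shows "(\<integral>\<xi>. g \<xi> * indicator A \<xi> * taylor m x (\<xi> - \<eta>) \<partial>sphere_measure)
    = (\<Sum>w\<in>words m. taylor_coeff x w * (\<integral>\<xi>. g \<xi> * indicator A \<xi> * of_real (mon (\<xi> - \<eta>) w) \<partial>sphere_measure))"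
proof -
  have bd: "norm (complex_of_real (mon (\<xi> - \<eta>) w)) \<le> (1 + norm \<eta>) ^ length w" if "\<xi> \<in> A" for \<xi> and w :: "'n list"
  proof -
    have "norm (\<xi> - \<eta>) \<le> 1 + norm \<eta>"
      using norm_triangle_ineq4[of \<xi> \<eta>] cell_on_sphere[OF A that] by simp
    from power_mono[OF this norm_ge_zero, of "length w"] show ?thesis
      using abs_mon_le[of "\<xi> - \<eta>" w] unfolding norm_of_real by linarith
  qed
  have "(\<integral>\<xi>. g \<xi> * indicator A \<xi> * taylor m x (\<xi> - \<eta>) \<partial>sphere_measure)
      = (\<integral>\<xi>. (\<Sum>w\<in>words m. taylor_coeff x w * (g \<xi> * indicator A \<xi> * of_real (mon (\<xi> - \<eta>) w))) \<partial>sphere_measure)"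
    unfolding taylor_def by (simp add: sum_distrib_left mult_ac)
  also have "\<dots> = (\<Sum>w\<in>words m. \<integral>\<xi>. taylor_coeff x w * (g \<xi> * indicator A \<xi> * of_real (mon (\<xi> - \<eta>) w)) \<partial>sphere_measure)"
    by (intro Bochner_Integration.integral_sum integrable_mult_right cell_integral(1)[OF A measurable_mon_diff bd])
  finally show ?thesis by simp
qed

text \<open>After \<open>character x \<eta>\<close> is pulled out, the remaining phase is at most
  \<open>2 * pi * (R * d) \<le> 1\<close> on the cell, and the Taylor remainder applies
  pointwise.\<close>

lemma cell_remainder_le:
  assumes A: "A \<in> E" and \<eta>: "\<eta> \<in> A" and x: "norm x \<le> R"
  shows "norm ((\<integral>\<xi>. g \<xi> * indicator A \<xi> * character x \<xi> \<partial>sphere_measure)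
      - character x \<eta> * (\<integral>\<xi>. g \<xi> * indicator A \<xi> \<partial>sphere_measure)
      - character x \<eta> * (\<integral>\<xi>. g \<xi> * indicator A \<xi> * taylor m x (\<xi> - \<eta>) \<partial>sphere_measure))
    \<le> 1 / fact m * cellU A"
proof -
  let ?i = "\<lambda>h. \<integral>\<xi>. g \<xi> * indicator A \<xi> * h \<xi> \<partial>sphere_measure"
  have cont: "continuous_on UNIV (\<lambda>\<xi>. character x (\<xi> - \<eta>))" "continuous_on UNIV (\<lambda>\<xi>. taylor m x (\<xi> - \<eta>))"
    by (rule continuous_on_compose2[OF continuous_character[of UNIV]] continuous_on_compose2[OF continuous_taylor[of UNIV]];
        auto intro!: continuous_intros)+
  have int: "integrable sphere_measure (\<lambda>\<xi>. g \<xi> * indicator A \<xi> * h \<xi>)" if h: "continuous_on UNIV h" for h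
  proof -
    obtain B where "\<And>\<xi>. norm \<xi> = 1 \<Longrightarrow> norm (h \<xi>) \<le> B" using continuous_bounded_sphere[OF h] by blast
    then show ?thesis
      using continuous_measurable_sphere[OF h] cell_on_sphere[OF A] by (intro cell_integral(1)[OF A, of h B]) auto
  qed
  have "?i (character x) = character x \<eta> * ?i (\<lambda>\<xi>. character x (\<xi> - \<eta>))"
    unfolding integral_mult_right_zero[symmetric]
    by (intro Bochner_Integration.integral_cong refl) (subst character_diff[of x _ \<eta>], simp add: mult_ac)
  moreover have "?i (\<lambda>\<xi>. character x (\<xi> - \<eta>) - 1 - taylor m x (\<xi> - \<eta>))
      = ?i (\<lambda>\<xi>. character x (\<xi> - \<eta>)) - ?i (\<lambda>_. 1) - ?i (\<lambda>\<xi>. taylor m x (\<xi> - \<eta>))"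
    unfolding right_diff_distrib
    by ((subst Bochner_Integration.integral_diff;
        (intro Bochner_Integration.integrable_diff int cont continuous_on_const)?)+) (rule refl)
  ultimately have "?i (character x) - character x \<eta> * ?i (\<lambda>_. 1) - character x \<eta> * ?i (\<lambda>\<xi>. taylor m x (\<xi> - \<eta>))
      = character x \<eta> * ?i (\<lambda>\<xi>. character x (\<xi> - \<eta>) - 1 - taylor m x (\<xi> - \<eta>))"
    by (simp only: right_diff_distrib)
  moreover have "norm (?i (\<lambda>\<xi>. character x (\<xi> - \<eta>) - 1 - taylor m x (\<xi> - \<eta>))) \<le> 1 / fact m * cellU A"
  proof (rule cell_integral(2)[OF A])
    show "(\<lambda>\<xi>. character x (\<xi> - \<eta>) - 1 - taylor m x (\<xi> - \<eta>)) \<in> borel_measurable sphere_measure"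
      by (intro continuous_measurable_sphere continuous_intros cont)
    fix \<xi> assume \<xi>: "\<xi> \<in> A"
    have "\<bar>x \<bullet> (\<xi> - \<eta>)\<bar> \<le> norm x * norm (\<xi> - \<eta>)" by (rule Cauchy_Schwarz_ineq2)
    also have "\<dots> \<le> R * d" using x diam[OF A \<xi> \<eta>] pos by (intro mult_mono) auto
    finally have "2 * pi * \<bar>x \<bullet> (\<xi> - \<eta>)\<bar> \<le> 2 * pi * (R * d)" by (intro mult_left_mono) auto
    then show "norm (character x (\<xi> - \<eta>) - 1 - taylor m x (\<xi> - \<eta>)) \<le> 1 / fact m"
      using small by (intro taylor_remainder) linarith
  qed
  ultimately show ?thesis by (simp add: norm_mult)
qed

text \<open>The contribution of a cell to the extension of \<open>g\<close> is a number, so it may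
  be averaged over \<open>\<eta>\<close> against the normalised bump. The comparison then becomes a
  pointwise estimate in \<open>\<eta>\<close> that involves a single cell.\<close>

lemma extension_remainder:
  assumes x: "norm x \<le> R"
  shows "norm (extension g x - extension approximant x - (\<Sum>w\<in>words m. taylor_coeff x w * extension (corrector w) x))
    \<le> 1 / fact m * (\<Sum>A\<in>E. cellU A)"
proof -
  let ?e = "character x"
  define \<gamma> where "\<gamma> A = (\<integral>\<xi>. g \<xi> * indicator A \<xi> * ?e \<xi> \<partial>sphere_measure)" for A
  define P where "P A \<eta> = complex_of_real (\<phi> A \<eta> / weight A)" for A \<eta>
  \<comment> \<open>Each \<open>P A\<close> has integral 1, so the integral of \<open>N\<close> is
    \<open>extension g x\<close>; \<open>Z\<close> is the pointwise error at
    \<open>\<eta>\<close>.\<close>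
  define N where "N \<eta> = (\<Sum>A\<in>E. P A \<eta> * \<gamma> A)" for \<eta>
  define Z where "Z \<eta> = N \<eta> - approximant \<eta> * ?e \<eta> - (\<Sum>w\<in>words m. taylor_coeff x w * (corrector w \<eta> * ?e \<eta>))" for \<eta>
  have intP: "integrable sphere_measure (P A)" "(\<integral>\<eta>. P A \<eta> \<partial>sphere_measure) = 1" if A: "A \<in> E" for A
  proof -
    have i: "integrable sphere_measure (\<lambda>\<eta>. \<phi> A \<eta> / weight A)"
      using integrable_bump[OF A] by simp
    then show "integrable sphere_measure (P A)"
      unfolding P_def[abs_def] by (rule integrable_of_real)
    have "(\<integral>\<eta>. P A \<eta> \<partial>sphere_measure) = of_real (\<integral>\<eta>. \<phi> A \<eta> / weight A \<partial>sphere_measure)"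
      unfolding P_def by (rule integral_complex_of_real)
    also have "(\<integral>\<eta>. \<phi> A \<eta> / weight A \<partial>sphere_measure) = 1"
      using weight_ge(2)[OF A] by (simp add: weight_def)
    finally show "(\<integral>\<eta>. P A \<eta> \<partial>sphere_measure) = 1" by simp
  qed
  have intN: "integrable sphere_measure N"
    unfolding N_def[abs_def] by (intro Bochner_Integration.integrable_sum integrable_mult_left intP)
  have "(\<integral>\<eta>. N \<eta> \<partial>sphere_measure) = (\<Sum>A\<in>E. \<gamma> A)"
    unfolding N_def by (subst Bochner_Integration.integral_sum) (auto intro!: integrable_mult_left intP sum.cong simp: intP(2))
  also have "\<dots> = extension g x"
  proof -
    have int: "integrable sphere_measure (\<lambda>\<xi>. g \<xi> * indicator A \<xi> * ?e \<xi>)" if "A \<in> E" for A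
      by (rule cell_integral(1)[OF that measurable_character, where H = 1]) simp
    have "extension g x = (\<integral>\<xi>. (\<Sum>A\<in>E. g \<xi> * indicator A \<xi> * ?e \<xi>) \<partial>sphere_measure)"
      unfolding extension_eq
    proof (rule Bochner_Integration.integral_cong[OF refl])
      fix \<xi> :: "real^'n" assume "\<xi> \<in> space sphere_measure"
      then have "(\<Sum>A\<in>E. indicator A \<xi>) = (1 :: complex)" by (intro sum_indicator_cells) simp
      then show "g \<xi> * ?e \<xi> = (\<Sum>A\<in>E. g \<xi> * indicator A \<xi> * ?e \<xi>)"
        by (simp add: sum_distrib_left[symmetric] sum_distrib_right[symmetric])
    qed
    also have "\<dots> = (\<Sum>A\<in>E. \<gamma> A)"
      unfolding \<gamma>_def by (rule Bochner_Integration.integral_sum[OF int])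
    finally show ?thesis ..
  qed
  finally have N: "(\<integral>\<eta>. N \<eta> \<partial>sphere_measure) = extension g x" .
  have intC: "integrable sphere_measure (\<lambda>\<eta>. taylor_coeff x w * (corrector w \<eta> * ?e \<eta>))" for w
    by (intro integrable_mult_right integrable_times_character integrable_corrector)
  have intA: "integrable sphere_measure (\<lambda>\<eta>. approximant \<eta> * ?e \<eta>)"
    by (intro integrable_times_character integrable_approximant)
  have intS: "integrable sphere_measure (\<lambda>\<eta>. \<Sum>w\<in>words m. taylor_coeff x w * (corrector w \<eta> * ?e \<eta>))"
    by (intro Bochner_Integration.integrable_sum intC)
  have intZ: "integrable sphere_measure Z"
    unfolding Z_def[abs_def] by (intro Bochner_Integration.integrable_diff intN intA intS)
  have "(\<integral>\<eta>. Z \<eta> \<partial>sphere_measure)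
      = (\<integral>\<eta>. N \<eta> \<partial>sphere_measure) - (\<integral>\<eta>. approximant \<eta> * ?e \<eta> \<partial>sphere_measure)
        - (\<integral>\<eta>. (\<Sum>w\<in>words m. taylor_coeff x w * (corrector w \<eta> * ?e \<eta>)) \<partial>sphere_measure)"
    unfolding Z_def
    by (simp only: Bochner_Integration.integral_diff Bochner_Integration.integrable_diff intN intA intS)
  also have "(\<integral>\<eta>. (\<Sum>w\<in>words m. taylor_coeff x w * (corrector w \<eta> * ?e \<eta>)) \<partial>sphere_measure)
      = (\<Sum>w\<in>words m. taylor_coeff x w * extension (corrector w) x)"
    unfolding extension_eq by (subst Bochner_Integration.integral_sum[OF intC]) simp
  finally have eq: "extension g x - extension approximant x - (\<Sum>w\<in>words m. taylor_coeff x w * extension (corrector w) x)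
      = (\<integral>\<eta>. Z \<eta> \<partial>sphere_measure)"
    unfolding N extension_eq[of approximant] by simp
  have le: "norm (Z \<eta>) \<le> (\<Sum>A\<in>E. \<phi> A \<eta> / weight A * (1 / fact m * cellU A))" if \<eta>: "norm \<eta> = 1" for \<eta>
  proof -
    obtain A where A: "A \<in> E" "\<eta> \<in> A"
      using partition_onD1[OF part] \<eta> by (metis UnionE mem_sphere_0)
    have z: "\<phi> B \<eta> = 0" if "B \<in> E" "\<eta> \<notin> B" for B using bump_support[OF that(1) \<eta> that(2)] .
    let ?G = "\<lambda>w. \<integral>\<xi>. g \<xi> * indicator A \<xi> * of_real (mon (\<xi> - \<eta>) w) \<partial>sphere_measure"
    have 1: "N \<eta> = P A \<eta> * \<gamma> A" unfolding N_def P_def by (rule sum_single_cell[OF A]) (simp add: z)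
    have 2: "approximant \<eta> = P A \<eta> * (\<integral>\<eta>. g \<eta> * indicator A \<eta> \<partial>sphere_measure)"
      unfolding approximant_def P_def by (subst sum_single_cell[OF A]) (simp_all add: z)
    have 3: "corrector w \<eta> = P A \<eta> * ?G w" for w unfolding P_def by (rule corrector_on_cell[OF A])
    have "Z \<eta> = P A \<eta> * (\<gamma> A - ?e \<eta> * (\<integral>\<eta>. g \<eta> * indicator A \<eta> \<partial>sphere_measure)
        - ?e \<eta> * (\<Sum>w\<in>words m. taylor_coeff x w * ?G w))"
      unfolding Z_def 1 2 3 by (simp add: right_diff_distrib sum_distrib_left mult_ac)
    then have "norm (Z \<eta>) = norm (P A \<eta>) * norm (\<gamma> A - ?e \<eta> * (\<integral>\<eta>. g \<eta> * indicator A \<eta> \<partial>sphere_measure)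
        - ?e \<eta> * (\<integral>\<xi>. g \<xi> * indicator A \<xi> * taylor m x (\<xi> - \<eta>) \<partial>sphere_measure))"
      by (simp only: norm_mult taylor_cell_integral[OF A(1)])
    also have "\<dots> \<le> norm (P A \<eta>) * (1 / fact m * cellU A)"
      unfolding \<gamma>_def by (intro mult_left_mono cell_remainder_le A x) auto
    also have "norm (P A \<eta>) = \<phi> A \<eta> / weight A"
      unfolding P_def norm_of_real using bump_range[OF A(1) \<eta>] weight_ge(2)[OF A(1)] by simp
    also have "\<phi> A \<eta> / weight A * (1 / fact m * cellU A) = (\<Sum>A\<in>E. \<phi> A \<eta> / weight A * (1 / fact m * cellU A))"
      by (rule sum_single_cell[OF A, symmetric]) (simp add: z)
    finally show ?thesis .
  qed
  have intB: "integrable sphere_measure (\<lambda>\<eta>. \<phi> A \<eta> / weight A * (1 / fact m * cellU A))" if "A \<in> E" for A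
    using integrable_bump[OF that] by (intro integrable_mult_left) simp
  have "norm (\<integral>\<eta>. Z \<eta> \<partial>sphere_measure) \<le> (\<integral>\<eta>. (\<Sum>A\<in>E. \<phi> A \<eta> / weight A * (1 / fact m * cellU A)) \<partial>sphere_measure)"
  proof (rule Bochner_Integration.integral_norm_bound_integral[OF intZ])
    show "integrable sphere_measure (\<lambda>\<eta>. \<Sum>A\<in>E. \<phi> A \<eta> / weight A * (1 / fact m * cellU A))"
      by (rule Bochner_Integration.integrable_sum[OF intB])
    fix \<eta> :: "real^'n" assume "\<eta> \<in> space sphere_measure"
    then show "norm (Z \<eta>) \<le> (\<Sum>A\<in>E. \<phi> A \<eta> / weight A * (1 / fact m * cellU A))"
      by (intro le) simp
  qed
  also have "\<dots> = (\<Sum>A\<in>E. \<integral>\<eta>. \<phi> A \<eta> / weight A * (1 / fact m * cellU A) \<partial>sphere_measure)"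
    by (rule Bochner_Integration.integral_sum[OF intB])
  also have "\<dots> = (\<Sum>A\<in>E. 1 / fact m * cellU A)"
    using weight_ge(2) by (intro sum.cong refl) (simp add: weight_def less_imp_neq[symmetric])
  also have "\<dots> = 1 / fact m * (\<Sum>A\<in>E. cellU A)" by (rule sum_distrib_left[symmetric])
  finally show ?thesis unfolding eq .
qed

text \<open>A crude bound that depends on the number of cells. It only meets the Taylor remainder,
  whose factorial defeats any such constant.\<close>

lemma sum_cellU_powr_le: "(\<Sum>A\<in>E. cellU A) powr q \<le> (real (card E) * (C0 * V)) powr (q - 1) * I"
proof -
  have "(\<Sum>A\<in>E. cellU A * 1) powr q \<le> (\<Sum>A\<in>E. 1) powr (q - 1) * (\<Sum>A\<in>E. cellU A powr q * 1)"
    by (rule sum_powr_Jensen) (use fin q cellU(2) in auto)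
  also have "\<dots> \<le> (\<Sum>A\<in>E. 1) powr (q - 1) * (\<Sum>A\<in>E. (C0 * V) powr (q - 1) * cellI A)"
    by (intro mult_left_mono sum_mono) (auto intro: cellU(3))
  also have "\<dots> = (real (card E) * (C0 * V)) powr (q - 1) * I"
    unfolding sum_distrib_left[symmetric] cellI(3) by (simp add: powr_mult)
  finally show ?thesis by simp
qed

end

text \<open>Approximant, correctors and Taylor remainder contribute \<open>M * \<kappa>\<close>, a
  small multiple of \<open>B\<close>, and 1; \<open>3 powr q\<close> is the price of adding three
  terms. In \<open>\<Lambda>\<close> the factor \<open>2 * pi * R\<close> comes from a Taylor
  coefficient, \<open>2 * CARD('n)\<close> from the weight of a letter and \<open>d\<close> from the
  corrector; the \<open>CARD('n) ^ k\<close> words of length k explain the condition on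
  \<open>CARD('n) * \<Lambda>\<close>.\<close>

lemma restriction_bound_step:
  fixes \<Lambda> B :: real
  assumes B: "restriction_bound TYPE('n) q R B" "0 \<le> B"
    and \<Lambda>: "\<Lambda> = 4 * pi * CARD('n) * R * d" "CARD('n) * \<Lambda> \<le> 1 / 2"
  shows "restriction_bound TYPE('n) q R (3 powr q * (M * \<kappa> + 2 * (CARD('n) * \<Lambda>) * (C0 * \<kappa>) * B + 1))"
  unfolding restriction_bound_def
proof (intro allI impI)
  let ?N = "real CARD('n)"
  have \<kappa>0: "0 \<le> \<kappa>" by (simp add: \<kappa>_def)
  have \<Lambda>0: "0 \<le> \<Lambda>" using pos by (simp add: \<Lambda>(1))
  have \<Lambda>1: "\<Lambda> \<le> 1"
  proof -
    have "1 * \<Lambda> \<le> ?N * \<Lambda>" using \<Lambda>0 by (intro mult_right_mono) (auto simp: Suc_le_eq)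
    then show ?thesis using \<Lambda>(2) by linarith
  qed
  let ?B' = "3 powr q * (M * \<kappa> + 2 * (?N * \<Lambda>) * (C0 * \<kappa>) * B + 1)"
  have B'pos: "0 < ?B'" using pos \<kappa>0 \<Lambda>0 B(2) by (intro mult_pos_pos add_nonneg_pos add_nonneg_nonneg mult_nonneg_nonneg) auto
  fix g :: "real^'n \<Rightarrow> complex" assume g: "g \<in> borel_measurable sphere_measure"
  show "(\<integral>\<^sup>+x\<in>ball 0 R. ennreal (norm (extension g x) powr q) \<partial>lborel)
    \<le> ennreal ?B' * (\<integral>\<^sup>+\<xi>. ennreal (norm (g \<xi>) powr q) \<partial>sphere_measure)"
  proof (cases "\<integral>\<^sup>+\<xi>. ennreal (norm (g \<xi>) powr q) \<partial>sphere_measure")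
    case top
    have "ennreal c * top = top" if "0 < c" for c :: real using that by (simp add: ennreal_mult_top)
    from this[OF B'pos] show ?thesis unfolding top by (simp only: top_greatest)
  next
    case (real I)
    note gI = g real(2,1)
    define X where "X = (real (card E) * (C0 * V)) powr (q - 1)"
    define b where "b = measure lborel (ball (0::real^'n) R)"
    have b: "emeasure lborel (ball (0::real^'n) R) = ennreal b" "0 \<le> b"
      unfolding b_def using emeasure_bounded_finite[of "ball (0::real^'n) R"] by (auto intro: emeasure_eq_ennreal_measure)
    \<comment> \<open>The degree depends on \<open>R\<close> and the cells but not on
      \<open>g\<close>. Since \<open>m\<close> is at most its factorial, the remainder contributes
      no more than \<open>I\<close>.\<close>
    obtain m :: nat where m: "X * b \<le> real m" using real_arch_simple by blast
    let ?c = "corrector g" and ?a = "approximant g"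
    let ?S = "\<lambda>x. \<Sum>w\<in>words m. taylor_coeff x w * extension (?c w) x"
    let ?F = "\<lambda>w x. ((4 * pi * ?N * R) ^ length w) powr q * norm (extension (?c w) x) powr q"
    let ?r = "(1 / fact m * (\<Sum>A\<in>E. cellU g A)) powr q"
    have rb: "?r * b \<le> I"
    proof -
      have "?r = (1 / fact m) powr q * (\<Sum>A\<in>E. cellU g A) powr q" by (rule powr_mult)
      also have "\<dots> \<le> (1 / fact m) powr 1 * (X * I)"
        unfolding X_def using q by (intro mult_mono powr_mono' sum_cellU_powr_le[OF gI]) auto
      finally have "?r * b \<le> (1 / fact m) powr 1 * (X * I) * b" using b(2) by (intro mult_right_mono)
      also have "\<dots> = (X * b) * I / fact m" by simp
      also have "\<dots> \<le> fact m * I / fact m"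
      proof (intro divide_right_mono mult_right_mono real(1))
        have "real m \<le> fact m" using fact_ge_self[of m] by (metis of_nat_fact of_nat_le_iff)
        then show "X * b \<le> fact m" using m by linarith
      qed auto
      finally show ?thesis by simp
    qed
    have pt: "norm (extension g x) powr q \<le> 3 powr q * (norm (extension ?a x) powr q + (\<Sum>w\<in>words m. ?F w x) + ?r)"
      if x: "norm x < R" for x
    proof -
      let ?rem = "extension g x - extension ?a x - ?S x"
      have "extension g x = extension ?a x + ?S x + ?rem" by simp
      then have "norm (extension g x) powr q \<le> 3 powr q * (norm (extension ?a x) powr q + norm (?S x) powr q + norm ?rem powr q)"
        using norm_powr_add3_le[OF q, of "extension ?a x" "?S x" ?rem] by simp
      moreover have "norm ?rem powr q \<le> ?r"
        using q x by (intro powr_mono2 extension_remainder[OF gI]) auto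
      moreover have "norm (?S x) powr q \<le> (\<Sum>w\<in>words m. ?F w x)"
      proof -
        have "norm (?S x) powr q \<le> (\<Sum>w\<in>words m. (norm (taylor_coeff x w * extension (?c w) x) / (1 / (2 * ?N)) ^ length w) powr q)"
        proof (rule norm_powr_sum_le[OF finite_words_le q])
          \<comment> \<open>There are \<open>CARD('n) ^ k\<close> words of length k, so the weights
            of that length add up to \<open>(1 / 2) ^ k\<close>.\<close>
          have "(\<Sum>w\<in>(words m :: 'n list set). (1 / (2 * ?N)) ^ length w) = (\<Sum>k=1..m. (1/2) ^ k)"
            unfolding sum_words by (intro sum.cong refl) (simp add: card_words power_divide power_mult_distrib)
          also have "\<dots> = 1 - (1/2) ^ m" by (induction m) auto
          finally show "(\<Sum>w\<in>(words m :: 'n list set). (1 / (2 * ?N)) ^ length w) \<le> 1" by simp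
        qed simp
        also have "\<dots> \<le> (\<Sum>w\<in>words m. ?F w x)"
        proof (rule sum_mono)
          fix w :: "'n list"
          have "norm (taylor_coeff x w) \<le> (2 * pi * norm x) ^ length w" by (rule norm_taylor_coeff_le)
          also have "\<dots> \<le> (2 * pi * R) ^ length w" using x by (intro power_mono mult_left_mono) auto
          finally have "norm (taylor_coeff x w) * (2 * ?N) ^ length w \<le> (2 * pi * R) ^ length w * (2 * ?N) ^ length w"
            by (rule mult_right_mono) simp
          also have "\<dots> = (4 * pi * ?N * R) ^ length w"
            unfolding power_mult_distrib[symmetric] by (rule arg_cong[where f = "\<lambda>z. z ^ length w"]) simp
          finally have "norm (taylor_coeff x w) * (2 * ?N) ^ length w * norm (extension (?c w) x)
              \<le> (4 * pi * ?N * R) ^ length w * norm (extension (?c w) x)" by (rule mult_right_mono) simp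
          moreover have "norm (taylor_coeff x w * extension (?c w) x) / (1 / (2 * ?N)) ^ length w
              = norm (taylor_coeff x w) * (2 * ?N) ^ length w * norm (extension (?c w) x)"
            by (simp add: norm_mult power_one_over field_simps)
          ultimately have "(norm (taylor_coeff x w * extension (?c w) x) / (1 / (2 * ?N)) ^ length w) powr q
              \<le> ((4 * pi * ?N * R) ^ length w * norm (extension (?c w) x)) powr q"
            using q by (intro powr_mono2) auto
          then show "(norm (taylor_coeff x w * extension (?c w) x) / (1 / (2 * ?N)) ^ length w) powr q \<le> ?F w x"
            by (simp add: powr_mult)
        qed
        finally show ?thesis .
      qed
      ultimately show ?thesis by (smt (verit) mult_left_mono powr_ge_zero)
    qed
    have am: "(\<lambda>x. ennreal (norm (extension ?a x) powr q) * indicator (ball 0 R) x) \<in> borel_measurable lborel"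
      and cm: "(\<lambda>x. ennreal (norm (extension (?c w) x) powr q) * indicator (ball 0 R) x) \<in> borel_measurable lborel" for w
    proof -
      have *: "(\<lambda>x. ennreal (norm (extension h x) powr q) * indicator (ball 0 R) x) \<in> borel_measurable lborel"
        if "h \<in> borel_measurable sphere_measure" for h :: "real^'n \<Rightarrow> complex"
      proof -
        have e: "(\<lambda>x. ennreal (norm (extension h x) powr q)) \<in> borel_measurable borel"
          by (rule measurable_compose[OF powr_real_measurable[OF measurable_compose[OF measurable_extension[OF that]
              borel_measurable_norm] borel_measurable_const] measurable_ennreal])
        show ?thesis
          by (intro borel_measurable_times_ennreal borel_measurable_indicator) (use e in simp_all)
      qed
      show "(\<lambda>x. ennreal (norm (extension ?a x) powr q) * indicator (ball 0 R) x) \<in> borel_measurable lborel"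
        by (intro * borel_measurable_integrable integrable_approximant[OF gI])
      show "(\<lambda>x. ennreal (norm (extension (?c w) x) powr q) * indicator (ball 0 R) x) \<in> borel_measurable lborel"
        by (intro * measurable_corrector[OF gI])
    qed
    let ?i = "indicator (ball 0 R) :: real^'n \<Rightarrow> ennreal"
    let ?p = "\<lambda>w. ennreal (((4 * pi * ?N * R) ^ length w) powr q)"
    have "(\<integral>\<^sup>+x\<in>ball 0 R. ennreal (norm (extension g x) powr q) \<partial>lborel)
        \<le> (\<integral>\<^sup>+x. ennreal (3 powr q) * (ennreal (norm (extension ?a x) powr q) * ?i x
            + (\<Sum>w\<in>words m. ?p w * (ennreal (norm (extension (?c w) x) powr q) * ?i x)) + ennreal ?r * ?i x) \<partial>lborel)"
    proof (intro nn_integral_mono)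
      fix x :: "real^'n"
      show "ennreal (norm (extension g x) powr q) * ?i x \<le> ennreal (3 powr q) * (ennreal (norm (extension ?a x) powr q) * ?i x
            + (\<Sum>w\<in>words m. ?p w * (ennreal (norm (extension (?c w) x) powr q) * ?i x)) + ennreal ?r * ?i x)"
      proof (cases "x \<in> ball 0 R")
        case True
        then have "ennreal (norm (extension g x) powr q)
            \<le> ennreal (3 powr q * (norm (extension ?a x) powr q + (\<Sum>w\<in>words m. ?F w x) + ?r))"
          by (intro ennreal_leI pt) simp
        also have "\<dots> = ennreal (3 powr q) * (ennreal (norm (extension ?a x) powr q)
            + (\<Sum>w\<in>words m. ?p w * (ennreal (norm (extension (?c w) x) powr q))) + ennreal ?r)"
          by (simp add: ennreal_mult sum_nonneg ennreal_plus sum_ennreal[symmetric] del: sum_ennreal)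
        finally show ?thesis using True by simp
      qed simp
    qed
    also have "\<dots> = ennreal (3 powr q) * ((\<integral>\<^sup>+x\<in>ball 0 R. ennreal (norm (extension ?a x) powr q) \<partial>lborel)
            + (\<Sum>w\<in>words m. ?p w * (\<integral>\<^sup>+x\<in>ball 0 R. ennreal (norm (extension (?c w) x) powr q) \<partial>lborel)) + ennreal ?r * ennreal b)"
    proof -
      have [measurable]: "ball (0::real^'n) R \<in> sets borel" by simp
      note [measurable] = am cm
      have s: "(\<integral>\<^sup>+x. (\<Sum>w\<in>words m. ?p w * (ennreal (norm (extension (?c w) x) powr q) * ?i x)) \<partial>lborel)
        = (\<Sum>w\<in>words m. ?p w * (\<integral>\<^sup>+x\<in>ball 0 R. ennreal (norm (extension (?c w) x) powr q) \<partial>lborel))"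
        by (subst nn_integral_sum, measurable) (intro sum.cong refl nn_integral_cmult cm)
      have c: "(\<integral>\<^sup>+x. ennreal ?r * ?i x \<partial>lborel) = ennreal ?r * ennreal b"
        by (subst nn_integral_cmult_indicator) (auto simp: b)
      show ?thesis
        by (subst nn_integral_cmult, measurable, subst nn_integral_add, measurable, subst nn_integral_add, measurable)
           (simp only: s c)
    qed
    also have "\<dots> \<le> ennreal (3 powr q) * (ennreal (M * \<kappa> * I) + ennreal (2 * (?N * \<Lambda>) * (C0 * \<kappa>) * B * I) + ennreal I)"
    proof (intro mult_left_mono add_mono)
      show "(\<integral>\<^sup>+x\<in>ball 0 R. ennreal (norm (extension ?a x) powr q) \<partial>lborel) \<le> ennreal (M * \<kappa> * I)"
        by (rule approximant_bound[OF gI])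
      show "ennreal ?r * ennreal b \<le> ennreal I"
        using rb b(2) by (simp add: ennreal_mult[symmetric] ennreal_leI)
      let ?Y = "C0 * \<kappa> * B * I"
      have Y: "0 \<le> ?Y" using pos \<kappa>0 B(2) real(1) by simp
      have "(\<Sum>w\<in>words m. ?p w * (\<integral>\<^sup>+x\<in>ball 0 R. ennreal (norm (extension (?c w) x) powr q) \<partial>lborel))
          \<le> (\<Sum>w\<in>(words m :: 'n list set). ennreal (\<Lambda> ^ length w * ?Y))"
      proof (rule sum_mono)
        fix w :: "'n list"
        have "(\<integral>\<^sup>+x\<in>ball 0 R. ennreal (norm (extension (?c w) x) powr q) \<partial>lborel)
            \<le> ennreal B * (\<integral>\<^sup>+\<eta>. ennreal (norm (?c w \<eta>) powr q) \<partial>sphere_measure)"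
          using B(1) measurable_corrector[OF gI] unfolding restriction_bound_def by blast
        also have "\<dots> \<le> ennreal B * ennreal (C0 * \<kappa> * (d ^ length w) powr q * I)"
          by (intro mult_left_mono corrector_bound[OF gI]) auto
        finally have "?p w * (\<integral>\<^sup>+x\<in>ball 0 R. ennreal (norm (extension (?c w) x) powr q) \<partial>lborel)
            \<le> ?p w * (ennreal B * ennreal (C0 * \<kappa> * (d ^ length w) powr q * I))" by (rule mult_left_mono) simp
        also have "\<dots> = ennreal (((4 * pi * ?N * R) ^ length w) powr q * (B * (C0 * \<kappa> * (d ^ length w) powr q * I)))"
          using B(2) pos \<kappa>0 real(1) by (simp add: ennreal_mult)
        also have "((4 * pi * ?N * R) ^ length w) powr q * (B * (C0 * \<kappa> * (d ^ length w) powr q * I)) = (\<Lambda> ^ length w) powr q * ?Y"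
          unfolding \<Lambda>(1) power_mult_distrib[of _ d] powr_mult[of _ "d ^ length w"] by (simp only: mult_ac)
        also have "ennreal \<dots> \<le> ennreal (\<Lambda> ^ length w * ?Y)"
        proof (intro ennreal_leI mult_right_mono Y)
          \<comment> \<open>As \<open>\<Lambda> \<le> 1\<close> and \<open>q \<ge> 1\<close>, the
            exponent may be lowered to 1; the sum over words becomes a geometric series in
            \<open>?N * \<Lambda>\<close>.\<close>
          have "(\<Lambda> ^ length w) powr q \<le> (\<Lambda> ^ length w) powr 1"
            using \<Lambda>0 \<Lambda>1 q by (intro powr_mono') (auto simp: power_le_one)
          then show "(\<Lambda> ^ length w) powr q \<le> \<Lambda> ^ length w" using \<Lambda>0 by simp
        qed
        finally show "?p w * (\<integral>\<^sup>+x\<in>ball 0 R. ennreal (norm (extension (?c w) x) powr q) \<partial>lborel) \<le> ennreal (\<Lambda> ^ length w * ?Y)" .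
      qed
      also have "\<dots> = ennreal (\<Sum>w\<in>(words m :: 'n list set). \<Lambda> ^ length w * ?Y)"
        by (intro sum_ennreal mult_nonneg_nonneg[OF zero_le_power[OF \<Lambda>0] Y])
      also have "(\<Sum>w\<in>(words m :: 'n list set). \<Lambda> ^ length w * ?Y) = (\<Sum>k=1..m. (?N * \<Lambda>) ^ k) * ?Y"
        unfolding sum_words sum_distrib_right by (intro sum.cong refl) (simp add: card_words power_mult_distrib)
      also have "ennreal \<dots> \<le> ennreal (2 * (?N * \<Lambda>) * ?Y)"
      proof (intro ennreal_leI mult_right_mono Y)
        have "(\<Sum>k=1..m. (?N * \<Lambda>) ^ k) = (\<Sum>k<m. ?N * \<Lambda> * (?N * \<Lambda>) ^ k)"
          by (rule sum.reindex_bij_witness[of _ Suc "\<lambda>k. k - 1"]) (auto simp: power_eq_if)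
        also have "\<dots> = ?N * \<Lambda> * (\<Sum>k<m. (?N * \<Lambda>) ^ k)" by (rule sum_distrib_left[symmetric])
        also have "\<dots> \<le> ?N * \<Lambda> * (\<Sum>k\<le>m. (?N * \<Lambda>) ^ k)"
          using \<Lambda>0 by (intro mult_left_mono sum_mono2) auto
        also have "\<dots> \<le> ?N * \<Lambda> * 2"
          using \<Lambda>0 \<Lambda>(2) by (intro mult_left_mono geometric_le_2) auto
        finally show "(\<Sum>k=1..m. (?N * \<Lambda>) ^ k) \<le> 2 * (?N * \<Lambda>)" by (simp only: mult_ac)
      qed
      finally show "(\<Sum>w\<in>words m. ?p w * (\<integral>\<^sup>+x\<in>ball 0 R. ennreal (norm (extension (?c w) x) powr q) \<partial>lborel))
          \<le> ennreal (2 * (?N * \<Lambda>) * (C0 * \<kappa>) * B * I)" by (simp only: mult_ac)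
    qed auto
    also have "\<dots> = ennreal (3 powr q * (M * \<kappa> * I + 2 * (?N * \<Lambda>) * (C0 * \<kappa>) * B * I + I))"
    proof -
      have "0 \<le> M * \<kappa> * I" "0 \<le> 2 * (?N * \<Lambda>) * (C0 * \<kappa>) * B * I"
        using pos \<kappa>0 B(2) real(1) \<Lambda>0 by (auto intro!: mult_nonneg_nonneg)
      then show ?thesis using real(1) by (simp only: ennreal_plus[symmetric] add_nonneg_nonneg ennreal_mult[symmetric] powr_ge_zero)
    qed
    also have "3 powr q * (M * \<kappa> * I + 2 * (?N * \<Lambda>) * (C0 * \<kappa>) * B * I + I) = ?B' * I"
      by (simp only: distrib_right mult.assoc mult_1)
    also have "ennreal (?B' * I) = ennreal ?B' * ennreal I"
      using B'pos real(1) by (intro ennreal_mult) auto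
    finally show ?thesis using real by simp
  qed
qed

end

subsection \<open>Proof of the theorem\<close>

lemma nn_integral_lebesgue_on_ball:
  "(\<integral>\<^sup>+x. f x \<partial>lebesgue_on (ball 0 r)) = (\<integral>\<^sup>+x\<in>ball 0 r. f x \<partial>(lborel :: 'a::euclidean_space measure))"
  by (subst nn_integral_restrict_space) (simp_all add: nn_integral_completion)

lemma restriction_bound_mono:
  "restriction_bound T q R B \<Longrightarrow> B \<le> B' \<Longrightarrow> restriction_bound T q R B'"
  unfolding restriction_bound_def by (meson ennreal_leI mult_right_mono order_trans zero_le)

text \<open>\<open>2 * S\<close> is the fixed point of \<open>B \<mapsto> S + B / 2\<close>, and the
  distance to it halves in every step. Allowing an excess of 1 makes finitely many steps sufficient,
  however large the initial bound is.\<close>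

lemma restriction_bound_iterate:
  assumes q: "1 \<le> q" and S: "0 \<le> S"
    and step: "\<And>B. 0 \<le> B \<Longrightarrow> restriction_bound TYPE('n::finite) q R B \<Longrightarrow> restriction_bound TYPE('n) q R (S + B / 2)"
  shows "restriction_bound TYPE('n) q R (2 * S + 1)"
proof -
  obtain B0 where B0: "0 < B0" "restriction_bound TYPE('n) q R B0"
    using restriction_bound_trivial[OF q] by blast
  have it: "restriction_bound TYPE('n) q R (2 * S + B0 / 2 ^ k)" for k
  proof (induction k)
    case 0
    show ?case by (rule restriction_bound_mono[OF B0(2)]) (use S in simp)
  next
    case (Suc k)
    have "restriction_bound TYPE('n) q R (S + (2 * S + B0 / 2 ^ k) / 2)"
      using S B0(1) by (intro step Suc) simp
    then show ?case by (simp add: add_divide_distrib mult.commute)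
  qed
  obtain k where "B0 < 2 ^ k" using real_arch_pow[of 2 B0] by auto
  then have "B0 / 2 ^ k \<le> 1" by simp
  then show ?thesis by (intro restriction_bound_mono[OF it[of k]]) simp
qed

lemma dyadic_scale:
  fixes D :: real
  assumes "1 \<le> D"
  obtains J where "D \<le> 2 ^ J" "2 ^ J \<le> 2 * D"
proof -
  have ex: "\<exists>J. D \<le> 2 ^ J" using real_arch_pow[of 2 D] by (auto intro: less_imp_le)
  define J where "J = (LEAST J. D \<le> 2 ^ J)"
  have J: "D \<le> 2 ^ J" unfolding J_def using ex by (rule LeastI_ex)
  have "2 ^ J \<le> 2 * D"
  proof (cases J)
    case 0
    then show ?thesis using assms by simp
  next
    case (Suc i)
    then have "\<not> D \<le> 2 ^ i" using not_less_Least[of i "\<lambda>J. D \<le> 2 ^ J"] unfolding J_def by simp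
    then show ?thesis using Suc by simp
  qed
  with J show ?thesis by (rule that)
qed

text \<open>The pointwise bound is integrated over the sphere, whose measure is finite. From
  \<open>N \<ge> exp 1\<close> on, the logarithmic factor is at least 1.\<close>

lemma kakeya_Lnorm_bound:
  assumes n: "1 \<le> n"
  shows "\<exists>C::real. \<forall>\<^sub>F N in at_top. \<forall>f :: 'a::euclidean_space \<Rightarrow> complex. f \<in> borel_measurable lebesgue \<longrightarrow>
         Lnorm (real n) sphere_measure (kakeya_maximal N f)
         \<le> ennreal (C * ln N powr ((real n - 1) / real n)) *
           Lnorm (real n) lebesgue (\<lambda>x. ennreal (norm (f x)))"
proof -
  interpret finite_measure "sphere_measure :: 'a measure" by (rule finite_measure_sphere_measure)
  define s where "s = measure (sphere_measure :: 'a measure) (sphere 0 1)"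
  define m where "m = measure lebesgue (cball (0::'a) (1/2))"
  have m: "0 < m" unfolding m_def using content_cball_pos[of "1/2" "0::'a"] by simp
  define c where "c = s / m + 1"
  have c: "0 < c" using m by (simp add: c_def s_def add_nonneg_pos)
  have "Lnorm (real n) sphere_measure (kakeya_maximal N f)
      \<le> ennreal (c powr (1 / real n) * ln N powr ((real n - 1) / real n)) * Lnorm (real n) lebesgue (\<lambda>x. ennreal (norm (f x)))"
    if N: "exp 1 \<le> N" and f: "f \<in> borel_measurable lebesgue" for N and f :: "'a \<Rightarrow> complex"
  proof -
    have N1: "1 \<le> N" using N one_le_exp_iff[of "1::real"] by linarith
    have lnN: "1 \<le> ln N" using N N1 by (simp add: ln_ge_iff)
    let ?J = "\<integral>\<^sup>+x. ennpowr (ennreal (norm (f x))) (real n) \<partial>lebesgue"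
    have "(\<integral>\<^sup>+\<omega>. ennpowr (kakeya_maximal N f \<omega>) (real n) \<partial>sphere_measure)
        \<le> (\<integral>\<^sup>+\<omega>. ennreal (1 / m) * ?J \<partial>(sphere_measure :: 'a measure))"
      unfolding m_def by (intro nn_integral_mono kakeya_maximal_le f N1) (use n in auto)
    also have "\<dots> = ennreal (1 / m) * ?J * ennreal s"
      by (simp add: emeasure_eq_measure s_def)
    also have "\<dots> = ennreal (s / m) * ?J"
      using m by (simp add: mult_ac ennreal_mult'[symmetric] s_def flip: mult.assoc)
    also have "\<dots> \<le> ennreal c * ?J"
      by (intro mult_right_mono ennreal_leI) (auto simp: c_def)
    finally have "Lnorm (real n) sphere_measure (kakeya_maximal N f)
        \<le> ennreal (c powr (1 / real n)) * Lnorm (real n) lebesgue (\<lambda>x. ennreal (norm (f x)))"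
      using n c by (intro Lnorm_leI) auto
    also have "\<dots> \<le> ennreal (c powr (1 / real n) * ln N powr ((real n - 1) / real n)) * Lnorm (real n) lebesgue (\<lambda>x. ennreal (norm (f x)))"
    proof (intro mult_right_mono ennreal_leI)
      have "1 \<le> ln N powr ((real n - 1) / real n)"
        using lnN n by (intro ge_one_powr_ge_zero) auto
      then show "c powr (1 / real n) \<le> c powr (1 / real n) * ln N powr ((real n - 1) / real n)"
        using mult_left_mono[of 1 "ln N powr ((real n - 1) / real n)" "c powr (1 / real n)"] by simp
    qed simp
    finally show ?thesis .
  qed
  then show ?thesis
    by (intro exI[of _ "c powr (1 / real n)"] eventually_mono[OF eventually_ge_at_top[of "exp 1"]]) blast
qed

lemma cell_bump_sphere_measurable:
  fixes A :: "(real^'n) set"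
  assumes "cell_bump a K \<delta> A \<phi>"
  shows "\<phi> \<in> borel_measurable sphere_measure"
proof -
  obtain F where F: "smooth F" "\<And>\<xi>. norm \<xi> = 1 \<Longrightarrow> F \<xi> = \<phi> \<xi>"
    using assms unfolding cell_bump_def by auto
  have "iter_partial [] F differentiable_on UNIV" using F(1) unfolding smooth_def by blast
  then have "continuous_on UNIV F" by (simp add: differentiable_imp_continuous_on)
  then have "F \<in> borel_measurable sphere_measure" by (rule continuous_measurable_sphere)
  then show ?thesis by (rule measurable_cong[THEN iffD1, rotated]) (simp add: F(2))
qed

text \<open>The constants are those of the cap estimates at the radii
  \<open>a * sqrt \<delta>\<close> and \<open>b * sqrt \<delta>\<close>, with
  \<open>sqrt \<delta> ^ (CARD('n) - 1)\<close> split off. The mass of a bump is bounded below by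
  the cap on which it equals 1.\<close>

lemma bump_cells_of_decomposition:
  fixes a b \<delta> q :: real and \<E> :: "(real^'n) set set"
  assumes dec: "cap_decomposition a b \<delta> \<E>"
    and bump: "\<And>A. A \<in> \<E> \<Longrightarrow> cell_bump a K \<delta> A (\<phi> A)"
    and ab: "0 < a" "a \<le> b" and \<delta>: "0 < \<delta>" "a * sqrt \<delta> \<le> 1"
    and q: "1 \<le> q" and R: "0 < R" "2 * pi * (R * (2 * b * sqrt \<delta>)) \<le> 1" and M: "0 \<le> M"
    and comb: "\<And>c. (\<integral>\<^sup>+x\<in>ball 0 R. ennreal (norm (extension (\<lambda>\<xi>. \<Sum>A\<in>\<E>. c A * of_real (\<phi> A \<xi>)) x) powr q) \<partial>lborel)
      \<le> ennreal (M * sqrt \<delta> ^ (CARD('n) - 1) * (\<Sum>A\<in>\<E>. norm (c A) powr q))"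
  shows "bump_cells \<E> \<phi> (sqrt \<delta> ^ (CARD('n) - 1)) (2 * b * sqrt \<delta>) R q
    (real CARD('n) / 2 * (1 / (8 * real CARD('n))) ^ (CARD('n) - 1) * a ^ (CARD('n) - 1))
    (real CARD('n) * 2 ^ CARD('n) * b ^ (CARD('n) - 1)) M"
proof -
  interpret finite_measure "sphere_measure :: (real^'n) measure" by (rule finite_measure_sphere_measure)
  have fin: "finite \<E>" and part: "partition_on (sphere 0 1) \<E>" and sub: "\<E> \<subseteq> sets sphere_measure"
    and cell: "\<forall>A\<in>\<E>. \<exists>\<xi>\<in>sphere 0 1. cap \<xi> (a * sqrt \<delta>) \<subseteq> A \<and> A \<subseteq> cap \<xi> (b * sqrt \<delta>)"
    using dec by (auto simp: cap_decomposition_def)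
  have capm: "cap \<xi> t \<in> sets (sphere_measure :: (real^'n) measure)" for \<xi> t
    unfolding cap_def by (intro sets_sphere_measure_borel) auto
  have range: "0 \<le> \<phi> A \<xi> \<and> \<phi> A \<xi> \<le> 1" if "A \<in> \<E>" "norm \<xi> = 1" for A \<xi>
    using bump[OF that(1)] that(2) by (auto simp: cell_bump_def)
  show ?thesis
  proof
    show "finite \<E>" "partition_on (sphere 0 1) \<E>" by fact+
    show "A \<in> sets sphere_measure" if "A \<in> \<E>" for A using sub that by blast
    show "norm (\<xi> - \<eta>) \<le> 2 * b * sqrt \<delta>" if "A \<in> \<E>" "\<xi> \<in> A" "\<eta> \<in> A" for A \<xi> \<eta>
    proof -
      obtain z where "A \<subseteq> cap z (b * sqrt \<delta>)" using cell \<open>A \<in> \<E>\<close> by blast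
      then have "dist z \<xi> < b * sqrt \<delta>" "dist z \<eta> < b * sqrt \<delta>" using that by (auto simp: cap_def)
      moreover have "dist \<xi> \<eta> \<le> dist z \<xi> + dist z \<eta>" by (metis dist_commute dist_triangle)
      ultimately show ?thesis by (simp add: dist_norm)
    qed
    show "measure sphere_measure A \<le> real CARD('n) * 2 ^ CARD('n) * b ^ (CARD('n) - 1) * sqrt \<delta> ^ (CARD('n) - 1)"
      if A: "A \<in> \<E>" for A
    proof -
      obtain z where z: "norm z = 1" "A \<subseteq> cap z (b * sqrt \<delta>)" using cell A by auto
      have "measure sphere_measure A \<le> measure sphere_measure (sphere 0 1 \<inter> cball z (b * sqrt \<delta>))"
        using z(2) by (intro finite_measure_mono sets_sphere_measure_borel) (auto simp: cap_def)
      also have "\<dots> \<le> real CARD('n) * 2 ^ CARD('n) * (b * sqrt \<delta>) ^ (CARD('n) - 1)"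
        using cap_measure_le[OF z(1), of "b * sqrt \<delta>"] ab \<delta> by simp
      finally show ?thesis by (simp add: power_mult_distrib)
    qed
    show "\<phi> A \<in> borel_measurable sphere_measure" if "A \<in> \<E>" for A
      by (rule cell_bump_sphere_measurable[OF bump[OF that]])
    show "0 \<le> \<phi> A \<xi> \<and> \<phi> A \<xi> \<le> 1" if "A \<in> \<E>" "norm \<xi> = 1" for A \<xi> by (rule range[OF that])
    show "\<phi> A \<xi> = 0" if "A \<in> \<E>" "norm \<xi> = 1" "\<xi> \<notin> A" for A \<xi>
      using bump[OF that(1)] that(2,3) by (auto simp: cell_bump_def)
    show "real CARD('n) / 2 * (1 / (8 * real CARD('n))) ^ (CARD('n) - 1) * a ^ (CARD('n) - 1) * sqrt \<delta> ^ (CARD('n) - 1)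
        \<le> (\<integral>\<xi>. \<phi> A \<xi> \<partial>sphere_measure)" if A: "A \<in> \<E>" for A
    proof -
      obtain z where z: "norm z = 1" "\<forall>\<eta>\<in>cap z (a * sqrt \<delta>). \<phi> A \<eta> = 1"
        using bump[OF A] by (auto simp: cell_bump_def)
      have "real CARD('n) / 2 * (1 / (8 * real CARD('n))) ^ (CARD('n) - 1) * (a * sqrt \<delta>) ^ (CARD('n) - 1)
          \<le> measure sphere_measure (cap z (a * sqrt \<delta>))"
        using cap_measure_ge[OF z(1), of "a * sqrt \<delta>"] ab \<delta> by simp
      also have "\<dots> = (\<integral>\<xi>. indicator (cap z (a * sqrt \<delta>)) \<xi> \<partial>sphere_measure)"
        by (simp add: cap_def Int_absorb1 Int_assoc Int_commute)
      also have "\<dots> \<le> (\<integral>\<xi>. \<phi> A \<xi> \<partial>sphere_measure)"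
      proof (rule integral_mono)
        show "integrable sphere_measure (\<phi> A)"
          by (rule integrable_sphere_bounded[where B = 1])
             (use range[OF A] cell_bump_sphere_measurable[OF bump[OF A]] in auto)
        show "integrable sphere_measure (indicator (cap z (a * sqrt \<delta>)) :: _ \<Rightarrow> real)"
          using capm by (intro integrable_real_indicator) (auto simp: less_top[symmetric])
        show "indicator (cap z (a * sqrt \<delta>)) \<xi> \<le> \<phi> A \<xi>" if "\<xi> \<in> space sphere_measure" for \<xi>
          using z(2) range[OF A, of \<xi>] that by (auto simp: indicator_def)
      qed
      finally show ?thesis by (simp add: power_mult_distrib mult_ac)
    qed
  qed (use ab \<delta> q R M comb in auto)
qed

lemma restriction_Lnorm:
  assumes B: "restriction_bound TYPE('n) q R B" and q: "0 < q" and B0: "0 < B"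
    and g: "g \<in> borel_measurable (sphere_measure :: (real^'n) measure)"
  shows "Lnorm q (lebesgue_on (ball 0 R)) (\<lambda>x. ennreal (norm (extension g x)))
    \<le> ennreal (B powr (1 / q)) * Lnorm q sphere_measure (\<lambda>\<xi>. ennreal (norm (g \<xi>)))"
proof (rule Lnorm_leI[OF q B0])
  show "(\<integral>\<^sup>+x. ennpowr (ennreal (norm (extension g x))) q \<partial>lebesgue_on (ball 0 R))
      \<le> ennreal B * (\<integral>\<^sup>+\<xi>. ennpowr (ennreal (norm (g \<xi>))) q \<partial>sphere_measure)"
    using B g unfolding restriction_bound_def
    by (simp add: ennpowr_ennreal nn_integral_lebesgue_on_ball)
qed

text \<open>Reverse square function and square function estimates together give the bound for
  combinations of bumps with \<open>M\<close> of order \<open>J + 1\<close>. The cell argument at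
  \<open>sqrt \<delta> = \<tau> / R\<close> transfers it to arbitrary functions.\<close>

lemma restriction_bound_of_reverse_square_function:
  fixes K :: "nat \<Rightarrow> real" and a b \<delta>\<^sub>0 q :: real
    and \<E> :: "real \<Rightarrow> (real^'n) set set" and \<phi> :: "real \<Rightarrow> (real^'n) set \<Rightarrow> real^'n \<Rightarrow> real"
  assumes dim: "2 \<le> CARD('n)" and q: "q = 2 * real CARD('n) / (real CARD('n) - 1)"
    and constants: "0 < a" "a \<le> b" "0 < \<delta>\<^sub>0"
    and decomposition: "\<And>\<delta>. 0 < \<delta> \<Longrightarrow> \<delta> < \<delta>\<^sub>0 \<Longrightarrow> cap_decomposition a b \<delta> (\<E> \<delta>)"
    and bumps: "\<And>\<delta> A. 0 < \<delta> \<Longrightarrow> \<delta> < \<delta>\<^sub>0 \<Longrightarrow> A \<in> \<E> \<delta> \<Longrightarrow> cell_bump a K \<delta> A (\<phi> \<delta> A)"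
    and reverse: "\<forall>\<^sub>F \<delta> in at_right 0. \<forall>g. constant_at_scale (\<E> \<delta>) (\<phi> \<delta>) g \<longrightarrow>
         Lnorm q (lebesgue_on (ball 0 (1 / \<delta>))) (\<lambda>x. ennreal (norm (extension g x)))
         \<le> ennreal C' *
           Lnorm q (lebesgue_on (ball 0 (1 / \<delta>))) (\<lambda>x. ennreal (square_function (\<E> \<delta>) g x))"
  shows "\<exists>C>0. \<forall>\<^sub>F R in at_top. restriction_bound TYPE('n) q R (C * ln R)"
proof -
  let ?N = "real CARD('n)"
  define p where "p = ?N / (?N - 1)"
  have p1: "1 \<le> p" using dim unfolding p_def by (simp add: field_simps)
  have qp: "q = 2 * p" by (simp add: q p_def)
  have q1: "1 \<le> q" using p1 by (simp add: qp)
  have b: "0 \<le> b" "0 < b" using constants by auto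
  obtain Cs where Cs: "0 < Cs" "\<And>\<delta> (\<E> :: (real^'n) set set) \<phi> c J. 0 < \<delta> \<Longrightarrow> \<delta> \<le> 1 \<Longrightarrow> a * sqrt \<delta> \<le> 1 \<Longrightarrow>
      cap_decomposition a b \<delta> \<E> \<Longrightarrow> (\<forall>A\<in>\<E>. cell_bump a K \<delta> A (\<phi> A)) \<Longrightarrow>
      1 / sqrt \<delta> \<le> 2 ^ J \<Longrightarrow> 2 ^ J \<le> 2 / sqrt \<delta> \<Longrightarrow>
      (\<integral>\<^sup>+x\<in>ball 0 (1 / \<delta>). ennreal (square_function \<E> (\<lambda>\<xi>. \<Sum>A\<in>\<E>. c A * of_real (\<phi> A \<xi>)) x powr q) \<partial>lborel)
      \<le> ennreal (Cs * sqrt \<delta> ^ (CARD('n) - 1) * (real J + 1) * (\<Sum>A\<in>\<E>. norm (c A) powr q))"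
    using square_function_bound[OF constants(1) b(1) dim p_def, of K] unfolding qp by blast
  \<comment> \<open>The given constant may fail to be positive, while \<open>Lnorm_leD\<close> asks
    for a positive one.\<close>
  define Ch where "Ch = max 1 C'"
  have Ch: "0 < Ch" by (simp add: Ch_def)
  obtain \<epsilon> where \<epsilon>: "0 < \<epsilon>" "\<And>\<delta> g. 0 < \<delta> \<Longrightarrow> \<delta> < \<epsilon> \<Longrightarrow> constant_at_scale (\<E> \<delta>) (\<phi> \<delta>) g \<Longrightarrow>
         Lnorm q (lebesgue_on (ball 0 (1 / \<delta>))) (\<lambda>x. ennreal (norm (extension g x)))
         \<le> ennreal Ch * Lnorm q (lebesgue_on (ball 0 (1 / \<delta>))) (\<lambda>x. ennreal (square_function (\<E> \<delta>) g x))"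
  proof -
    obtain \<epsilon> where \<epsilon>: "0 < \<epsilon>" and *: "\<forall>\<delta>>0. \<delta> < \<epsilon> \<longrightarrow> (\<forall>g. constant_at_scale (\<E> \<delta>) (\<phi> \<delta>) g \<longrightarrow>
         Lnorm q (lebesgue_on (ball 0 (1 / \<delta>))) (\<lambda>x. ennreal (norm (extension g x)))
         \<le> ennreal C' * Lnorm q (lebesgue_on (ball 0 (1 / \<delta>))) (\<lambda>x. ennreal (square_function (\<E> \<delta>) g x)))"
      using reverse unfolding eventually_at_right_field by blast
    show ?thesis
    proof (rule that[OF \<epsilon>])
      fix \<delta> :: real and g assume "0 < \<delta>" "\<delta> < \<epsilon>" "constant_at_scale (\<E> \<delta>) (\<phi> \<delta>) g"
      then have "Lnorm q (lebesgue_on (ball 0 (1 / \<delta>))) (\<lambda>x. ennreal (norm (extension g x)))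
         \<le> ennreal C' * Lnorm q (lebesgue_on (ball 0 (1 / \<delta>))) (\<lambda>x. ennreal (square_function (\<E> \<delta>) g x))"
        using * by blast
      also have "\<dots> \<le> ennreal Ch * Lnorm q (lebesgue_on (ball 0 (1 / \<delta>))) (\<lambda>x. ennreal (square_function (\<E> \<delta>) g x))"
        by (intro mult_right_mono ennreal_leI) (auto simp: Ch_def)
      finally show "Lnorm q (lebesgue_on (ball 0 (1 / \<delta>))) (\<lambda>x. ennreal (norm (extension g x)))
         \<le> ennreal Ch * Lnorm q (lebesgue_on (ball 0 (1 / \<delta>))) (\<lambda>x. ennreal (square_function (\<E> \<delta>) g x))" .
    qed
  qed
  \<comment> \<open>\<open>Y * \<tau>\<close> will be the value of \<open>?N * \<Lambda>\<close>,
    and \<open>\<tau>\<close> solves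
    \<open>Y * \<tau> * (1 + 2 * 3 powr q * (C0 * \<mu>)) = 1 / 2\<close>. So both the ratio of the
    series over words and the coefficient of \<open>B\<close> in the absorption step are at most
    1/2.\<close>
  define c0 C0 \<mu> Y \<tau> where "c0 = ?N / 2 * (1 / (8 * ?N)) ^ (CARD('n) - 1) * a ^ (CARD('n) - 1)"
    and "C0 = ?N * 2 ^ CARD('n) * b ^ (CARD('n) - 1)" and "\<mu> = C0 powr (q - 1) / c0 powr q"
    and "Y = 8 * pi * ?N * ?N * b" and "\<tau> = 1 / (2 * Y * (1 + 2 * 3 powr q * (C0 * \<mu>)))"
  have C0: "0 < C0" using b by (simp add: C0_def)
  have \<mu>: "0 \<le> \<mu>" by (simp add: \<mu>_def)
  have Y: "0 < Y" using b by (simp add: Y_def)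
  have Z: "0 \<le> 2 * 3 powr q * (C0 * \<mu>)" using C0 \<mu> by simp
  have \<tau>: "0 < \<tau>" unfolding \<tau>_def using Y Z by (intro divide_pos_pos mult_pos_pos add_pos_nonneg) auto
  have Y\<tau>: "Y * \<tau> * (1 + 2 * 3 powr q * (C0 * \<mu>)) = 1 / 2"
  proof -
    have "1 + 2 * 3 powr q * (C0 * \<mu>) \<noteq> 0" using Z by linarith
    moreover have "Y * (1 / (2 * Y * w)) * w = 1 / 2" if "w \<noteq> 0" for w
      using Y that by simp
    ultimately show ?thesis unfolding \<tau>_def by blast
  qed
  have Y\<tau>0: "0 \<le> Y * \<tau>" using Y \<tau> by simp
  have Y\<tau>1: "Y * \<tau> \<le> 1 / 2" "3 powr q * (2 * (Y * \<tau>) * (C0 * \<mu>)) \<le> 1 / 2"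
  proof -
    have "Y * \<tau> + Y * \<tau> * (2 * 3 powr q * (C0 * \<mu>)) = 1 / 2" using Y\<tau> by (simp add: distrib_left)
    moreover have "0 \<le> Y * \<tau> * (2 * 3 powr q * (C0 * \<mu>))" using Y\<tau>0 Z by (rule mult_nonneg_nonneg)
    moreover have "Y * \<tau> * (2 * 3 powr q * (C0 * \<mu>)) = 3 powr q * (2 * (Y * \<tau>) * (C0 * \<mu>))" by simp
    ultimately show "Y * \<tau> \<le> 1 / 2" "3 powr q * (2 * (Y * \<tau>) * (C0 * \<mu>)) \<le> 1 / 2" using Y\<tau>0 by linarith+
  qed
  define C where "C = 2 * (3 powr q * (Ch powr q * Cs * 5 * \<mu> + 1)) + 1"
  have Cpos: "0 < C" unfolding C_def using Cs(1) \<mu> by (intro add_nonneg_pos mult_nonneg_nonneg add_nonneg_nonneg) auto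
  \<comment> \<open>Below \<open>1 / a\<^sup>2\<close> the caps of radius
    \<open>a * sqrt \<delta>\<close> have radius at most 1, as the lower bound for their measure
    requires.\<close>
  define \<epsilon>' where "\<epsilon>' = min \<epsilon> (min \<delta>\<^sub>0 (min 1 (1 / a\<^sup>2)))"
  have \<epsilon>': "0 < \<epsilon>'" using \<epsilon>(1) constants by (simp add: \<epsilon>'_def)
  \<comment> \<open>The four thresholds give, in this order, \<open>\<delta> < \<epsilon>'\<close>,
    the inclusion of the ball of radius \<open>R\<close> in that of radius
    \<open>1 / \<delta>\<close>, \<open>1 \<le> ln R\<close>, and
    \<open>2 ^ J \<le> R * R\<close>.\<close>
  have "restriction_bound TYPE('n) q R (C * ln R)"
    if R: "\<tau> / sqrt \<epsilon>' < R" "\<tau>\<^sup>2 < R" "exp 1 < R" "2 / \<tau> < R" for R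
  proof -
    have R0: "0 < R" using R(3) exp_gt_zero[of "1::real"] by linarith
    have lnR: "1 \<le> ln R" using R(3) R0 by (simp add: ln_ge_iff)
    define \<delta> where "\<delta> = (\<tau> / R)\<^sup>2"
    have sq: "sqrt \<delta> = \<tau> / R" using \<tau> R0 by (simp add: \<delta>_def)
    have \<delta>0: "0 < \<delta>" using \<tau> R0 by (simp add: \<delta>_def)
    have "\<tau> / R < sqrt \<epsilon>'" using R(1) R0 \<epsilon>' by (simp add: field_simps)
    then have "\<delta> < \<epsilon>'" unfolding sq[symmetric] by simp
    then have \<delta>: "\<delta> < \<epsilon>" "\<delta> < \<delta>\<^sub>0" "\<delta> \<le> 1" "\<delta> < 1 / a\<^sup>2" by (auto simp: \<epsilon>'_def)
    have "sqrt \<delta> < sqrt (1 / a\<^sup>2)" using \<delta>(4) by simp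
    then have a\<delta>: "a * sqrt \<delta> \<le> 1" using constants(1) by (simp add: real_sqrt_divide field_simps)
    have R\<delta>: "R \<le> 1 / \<delta>"
    proof -
      have "R * \<tau>\<^sup>2 \<le> R * R" using R(2) R0 by (intro mult_left_mono) auto
      then show ?thesis using \<tau> R0 by (simp add: \<delta>_def power_divide power2_eq_square field_simps)
    qed
    have "1 \<le> 1 / sqrt \<delta>" using \<delta>0 \<delta>(3) by simp
    then obtain J where J: "1 / sqrt \<delta> \<le> 2 ^ J" "2 ^ J \<le> 2 * (1 / sqrt \<delta>)" by (rule dyadic_scale)
    \<comment> \<open>From \<open>J / 2 \<le> J * ln 2 \<le> 2 * ln R\<close> follows
      \<open>J \<le> 4 * ln R\<close>, and the remaining 1 is at most \<open>ln R\<close>.\<close>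
    have J5: "real J + 1 \<le> 5 * ln R"
    proof -
      have "2 ^ J \<le> R * R"
      proof -
        have "2 ^ J \<le> 2 / \<tau> * R" using J(2) sq by simp
        also have "\<dots> \<le> R * R" using R(4) R0 by (intro mult_right_mono) auto
        finally show ?thesis .
      qed
      then have "ln (2 ^ J) \<le> ln (R * R)" using R0 by (subst ln_le_cancel_iff) auto
      then have "real J * ln 2 \<le> 2 * ln R" using R0 by (simp add: ln_realpow ln_mult)
      moreover have "real J * (1 / 2) \<le> real J * ln 2"
      proof (rule mult_left_mono)
        show "1 / 2 \<le> ln (2::real)" using ln2_ge_two_thirds by simp
      qed simp
      ultimately show ?thesis using lnR by linarith
    qed
    define M where "M = Ch powr q * Cs * (real J + 1)"
    have M: "0 \<le> M" using Cs(1) by (simp add: M_def)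
    have comb: "(\<integral>\<^sup>+x\<in>ball 0 R. ennreal (norm (extension (\<lambda>\<xi>. \<Sum>A\<in>\<E> \<delta>. c A * of_real (\<phi> \<delta> A \<xi>)) x) powr q) \<partial>lborel)
      \<le> ennreal (M * sqrt \<delta> ^ (CARD('n) - 1) * (\<Sum>A\<in>\<E> \<delta>. norm (c A) powr q))" for c
    proof -
      let ?g = "\<lambda>\<xi>. \<Sum>A\<in>\<E> \<delta>. c A * complex_of_real (\<phi> \<delta> A \<xi>)"
      have "constant_at_scale (\<E> \<delta>) (\<phi> \<delta>) ?g" unfolding constant_at_scale_def by blast
      then have "Lnorm q (lebesgue_on (ball 0 (1 / \<delta>))) (\<lambda>x. ennreal (norm (extension ?g x)))
         \<le> ennreal Ch * Lnorm q (lebesgue_on (ball 0 (1 / \<delta>))) (\<lambda>x. ennreal (square_function (\<E> \<delta>) ?g x))"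
        by (rule \<epsilon>(2)[OF \<delta>0 \<delta>(1)])
      then have "(\<integral>\<^sup>+x\<in>ball 0 (1 / \<delta>). ennreal (norm (extension ?g x) powr q) \<partial>lborel)
         \<le> ennreal (Ch powr q) * (\<integral>\<^sup>+x\<in>ball 0 (1 / \<delta>). ennreal (square_function (\<E> \<delta>) ?g x powr q) \<partial>lborel)"
        using Lnorm_leD[of q Ch] q1 Ch
        by (fastforce simp: ennpowr_ennreal nn_integral_lebesgue_on_ball square_function_def sum_nonneg)
      also have "\<dots> \<le> ennreal (Ch powr q) * ennreal (Cs * sqrt \<delta> ^ (CARD('n) - 1) * (real J + 1) * (\<Sum>A\<in>\<E> \<delta>. norm (c A) powr q))"
        using J decomposition[OF \<delta>0 \<delta>(2)] bumps[OF \<delta>0 \<delta>(2)]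
        by (intro mult_left_mono Cs(2)[OF \<delta>0 \<delta>(3) a\<delta>]) auto
      also have "\<dots> = ennreal (M * sqrt \<delta> ^ (CARD('n) - 1) * (\<Sum>A\<in>\<E> \<delta>. norm (c A) powr q))"
        by (subst ennreal_mult'[symmetric]) (simp_all add: M_def mult_ac)
      finally have "(\<integral>\<^sup>+x\<in>ball 0 (1 / \<delta>). ennreal (norm (extension ?g x) powr q) \<partial>lborel)
         \<le> ennreal (M * sqrt \<delta> ^ (CARD('n) - 1) * (\<Sum>A\<in>\<E> \<delta>. norm (c A) powr q))" .
      moreover have "(\<integral>\<^sup>+x\<in>ball 0 R. ennreal (norm (extension ?g x) powr q) \<partial>lborel)
          \<le> (\<integral>\<^sup>+x\<in>ball 0 (1 / \<delta>). ennreal (norm (extension ?g x) powr q) \<partial>lborel)"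
        using R\<delta> by (intro nn_integral_mono) (auto simp: indicator_def)
      ultimately show ?thesis by (rule order_trans[rotated])
    qed
    define \<Lambda> where "\<Lambda> = 4 * pi * ?N * R * (2 * b * sqrt \<delta>)"
    have \<Lambda>: "?N * \<Lambda> = Y * \<tau>" using R0 by (simp add: \<Lambda>_def Y_def sq)
    have small: "2 * pi * (R * (2 * b * sqrt \<delta>)) \<le> 1"
    proof -
      have "2 * pi * (R * (2 * b * sqrt \<delta>)) = 4 * pi * b * \<tau>" using R0 by (simp add: sq)
      also have "\<dots> \<le> 4 * pi * b * \<tau> * (2 * ?N * ?N)"
      proof -
        have "1 * 1 \<le> (2 * ?N) * ?N" using dim by (intro mult_mono) auto
        then show ?thesis using mult_left_mono[of 1 "2 * ?N * ?N" "4 * pi * b * \<tau>"] b \<tau> by simp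
      qed
      also have "\<dots> = Y * \<tau>" by (simp add: Y_def)
      finally show ?thesis using Y\<tau>1(1) by linarith
    qed
    interpret bump_cells "\<E> \<delta>" "\<phi> \<delta>" "sqrt \<delta> ^ (CARD('n) - 1)" "2 * b * sqrt \<delta>" R q c0 C0 M
      unfolding c0_def C0_def
      by (rule bump_cells_of_decomposition[OF decomposition[OF \<delta>0 \<delta>(2)] bumps[OF \<delta>0 \<delta>(2)] constants(1,2) \<delta>0 a\<delta> q1 R0 small M comb])
    have step: "restriction_bound TYPE('n) q R (3 powr q * (M * \<mu> + 1) + B / 2)"
      if "0 \<le> B" "restriction_bound TYPE('n) q R B" for B
    proof (rule restriction_bound_mono[OF restriction_bound_step[OF that(2,1) \<Lambda>_def]])
      show "?N * \<Lambda> \<le> 1 / 2" unfolding \<Lambda> by (rule Y\<tau>1(1))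
      have "3 powr q * (2 * (Y * \<tau>) * (C0 * \<mu>)) * B \<le> 1 / 2 * B"
        using that(1) Y\<tau>1(2) by (rule mult_right_mono[rotated])
      moreover have "3 powr q * (M * \<mu> + 2 * (Y * \<tau>) * (C0 * \<mu>) * B + 1)
          = 3 powr q * (M * \<mu> + 1) + 3 powr q * (2 * (Y * \<tau>) * (C0 * \<mu>)) * B"
        by (simp add: algebra_simps)
      ultimately show "3 powr q * (M * \<kappa> + 2 * (?N * \<Lambda>) * (C0 * \<kappa>) * B + 1) \<le> 3 powr q * (M * \<mu> + 1) + B / 2"
        unfolding \<Lambda> \<kappa>_def \<mu>_def[symmetric] by linarith
    qed
    have "restriction_bound TYPE('n) q R (2 * (3 powr q * (M * \<mu> + 1)) + 1)"
      using M \<mu> by (intro restriction_bound_iterate[OF q1 _ step]) auto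
    moreover have "2 * (3 powr q * (M * \<mu> + 1)) + 1 \<le> C * ln R"
    proof -
      have "M * \<mu> \<le> Ch powr q * Cs * (5 * ln R) * \<mu>"
        unfolding M_def using J5 Cs(1) \<mu> by (intro mult_right_mono mult_left_mono) auto
      then have "M * \<mu> + 1 \<le> (Ch powr q * Cs * 5 * \<mu> + 1) * ln R"
        using lnR by (simp add: algebra_simps)
      then have "2 * (3 powr q * (M * \<mu> + 1)) \<le> 2 * (3 powr q * ((Ch powr q * Cs * 5 * \<mu> + 1) * ln R))"
        by (intro mult_left_mono) auto
      also have "\<dots> = C * ln R - ln R" unfolding C_def by (simp add: algebra_simps)
      finally show ?thesis using lnR by linarith
    qed
    ultimately show ?thesis by (rule restriction_bound_mono)
  qed
  then have "\<forall>\<^sub>F R in at_top. restriction_bound TYPE('n) q R (C * ln R)"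
    by (intro eventually_mono[OF eventually_gt_at_top[of "max (max (\<tau> / sqrt \<epsilon>') (\<tau>\<^sup>2)) (max (exp 1) (2 / \<tau>))"]]) simp
  with Cpos show ?thesis by blast
qed

theorem proposition1:
  fixes n :: nat
    and q a b \<delta>\<^sub>0 :: real
    and K :: "nat \<Rightarrow> real"
    and \<E> :: "real \<Rightarrow> (real^'n) set set"
    and \<phi> :: "real \<Rightarrow> (real^'n) set \<Rightarrow> real^'n \<Rightarrow> real"
  assumes dim: "n = CARD('n)" "2 \<le> n"
    and q: "q = 2 * real n / (real n - 1)"
    and constants: "0 < a" "a \<le> b" "0 < \<delta>\<^sub>0"
    and decomposition: "\<And>\<delta>. 0 < \<delta> \<Longrightarrow> \<delta> < \<delta>\<^sub>0 \<Longrightarrow> cap_decomposition a b \<delta> (\<E> \<delta>)"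
    and bumps: "\<And>\<delta> A. 0 < \<delta> \<Longrightarrow> \<delta> < \<delta>\<^sub>0 \<Longrightarrow> A \<in> \<E> \<delta> \<Longrightarrow> cell_bump a K \<delta> A (\<phi> \<delta> A)"
    and reverse_square_function:
      "\<exists>C::real. \<forall>\<^sub>F \<delta> in at_right 0. \<forall>g. constant_at_scale (\<E> \<delta>) (\<phi> \<delta>) g \<longrightarrow>
         Lnorm q (lebesgue_on (ball 0 (1 / \<delta>))) (\<lambda>x. ennreal (norm (extension g x)))
         \<le> ennreal C *
           Lnorm q (lebesgue_on (ball 0 (1 / \<delta>))) (\<lambda>x. ennreal (square_function (\<E> \<delta>) g x))"
  shows
    "(\<exists>C::real. \<forall>\<^sub>F N in at_top. \<forall>f :: real^'n \<Rightarrow> complex. f \<in> borel_measurable lebesgue \<longrightarrow>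
         Lnorm (real n) sphere_measure (kakeya_maximal N f)
         \<le> ennreal (C * ln N powr ((real n - 1) / real n)) *
           Lnorm (real n) lebesgue (\<lambda>x. ennreal (norm (f x))))
     \<and>
     (\<exists>C::real. \<forall>\<^sub>F R in at_top. \<forall>g :: real^'n \<Rightarrow> complex. g \<in> borel_measurable sphere_measure \<longrightarrow>
         Lnorm q (lebesgue_on (ball 0 R)) (\<lambda>x. ennreal (norm (extension g x)))
         \<le> ennreal (C * ln R powr ((real n - 1) / (2 * real n))) *
           Lnorm q sphere_measure (\<lambda>\<xi>. ennreal (norm (g \<xi>))))"
proof (rule conjI)
  show "\<exists>C::real. \<forall>\<^sub>F N in at_top. \<forall>f :: real^'n \<Rightarrow> complex. f \<in> borel_measurable lebesgue \<longrightarrow>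
         Lnorm (real n) sphere_measure (kakeya_maximal N f)
         \<le> ennreal (C * ln N powr ((real n - 1) / real n)) *
           Lnorm (real n) lebesgue (\<lambda>x. ennreal (norm (f x)))"
    using dim by (intro kakeya_Lnorm_bound) simp
  have q0: "0 < q" and q1: "1 / q = (real n - 1) / (2 * real n)" using dim(2) by (auto simp: q)
  obtain C' where C': "\<forall>\<^sub>F \<delta> in at_right 0. \<forall>g. constant_at_scale (\<E> \<delta>) (\<phi> \<delta>) g \<longrightarrow>
         Lnorm q (lebesgue_on (ball 0 (1 / \<delta>))) (\<lambda>x. ennreal (norm (extension g x)))
         \<le> ennreal C' *
           Lnorm q (lebesgue_on (ball 0 (1 / \<delta>))) (\<lambda>x. ennreal (square_function (\<E> \<delta>) g x))"
    using reverse_square_function by blast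
  obtain C where C: "0 < C" "\<forall>\<^sub>F R in at_top. restriction_bound TYPE('n) q R (C * ln R)"
    using restriction_bound_of_reverse_square_function[OF dim(2)[unfolded dim(1)] q[unfolded dim(1)]
        constants decomposition bumps C'] by blast
  show "\<exists>C::real. \<forall>\<^sub>F R in at_top. \<forall>g :: real^'n \<Rightarrow> complex. g \<in> borel_measurable sphere_measure \<longrightarrow>
         Lnorm q (lebesgue_on (ball 0 R)) (\<lambda>x. ennreal (norm (extension g x)))
         \<le> ennreal (C * ln R powr ((real n - 1) / (2 * real n))) *
           Lnorm q sphere_measure (\<lambda>\<xi>. ennreal (norm (g \<xi>)))"
  \<comment> \<open>The q-th root of \<open>C * ln R\<close> has the exponent
    \<open>1 / q = (n - 1) / (2 * n)\<close> on the logarithm; \<open>R > 1\<close> keeps the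
    constant positive.\<close>
  proof (intro exI[of _ "C powr (1 / q)"] eventually_mono[OF eventually_conj[OF C(2) eventually_gt_at_top[of 1]]] allI impI)
    fix R and g :: "real^'n \<Rightarrow> complex"
    assume R: "restriction_bound TYPE('n) q R (C * ln R) \<and> 1 < R" and g: "g \<in> borel_measurable sphere_measure"
    then have "0 < C * ln R" using C(1) by simp
    from restriction_Lnorm[OF conjunct1[OF R] q0 this g]
    show "Lnorm q (lebesgue_on (ball 0 R)) (\<lambda>x. ennreal (norm (extension g x)))
         \<le> ennreal (C powr (1 / q) * ln R powr ((real n - 1) / (2 * real n))) *
           Lnorm q sphere_measure (\<lambda>\<xi>. ennreal (norm (g \<xi>)))"
      using C(1) R by (simp add: powr_mult q1)
  qed
qed

end
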